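(* Let $m>0$, $e>0$, $Q>0$, and $\phi(s)=\frac{Q}{2}e^{-|s|}$ for $s\in\mathbb R$. Then the reduced hamiltonian $$h=\begin{pmatrix} m-e\phi & -\frac{d}{ds}\\ \frac{d}{ds} & -m-e\phi\end{pmatrix}$$ is self-adjoint, and its essential spectrum is $(-\infty,-m]\cup[m,\infty)$. Its discrete spectrum, if non-empty, consists only of simple eigenvalues (i.e. the eigenspaces are one-dimensional).
   Context: $h$ is regarded as an operator in the Hilbert space $L^2(\mathbb R)^2$ of pairs of square-integrable complex-valued functions, with its natural (maximal) domain $H^1(\mathbb R;\mathbb C^2)$. The discrete spectrum is the set of isolated points $\lambda$ of the spectrum that are eigenvalues with finite-dimensional eigenspace; the essential spectrum is the rest of the spectrum. *)

theory Defs
  imports "HOL-Analysis.Analysis"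
begin

section \<open>Complex inner product spaces\<close>

class complex_vector = real_vector +
  fixes scaleC :: "complex \<Rightarrow> 'a \<Rightarrow> 'a"  (infixr \<open>*\<^sub>C\<close> 75)
  assumes scaleC_add_right: "a *\<^sub>C (x + y) = a *\<^sub>C x + a *\<^sub>C y"
    and scaleC_add_left: "(a + b) *\<^sub>C x = a *\<^sub>C x + b *\<^sub>C x"
    and scaleC_scaleC: "a *\<^sub>C (b *\<^sub>C x) = (a * b) *\<^sub>C x"
    and scaleC_one: "1 *\<^sub>C x = x"
    and scaleR_eq_scaleC: "r *\<^sub>R x = complex_of_real r *\<^sub>C x"

global_interpretation complex_vector:
  vector_space "scaleC :: complex \<Rightarrow> 'a \<Rightarrow> 'a::complex_vector"
  by unfold_locales (simp_all add: scaleC_add_right scaleC_add_left scaleC_scaleC scaleC_one)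

text \<open>
  The inner product \<open>cinner\<close> is antilinear in its first argument. Positive definiteness and the
  relation to the norm are inherited from \<^class>\<open>real_inner\<close>, because
  \<open>cinner x x\<close> is real by conjugate symmetry and its real part is \<open>inner x x\<close>.
\<close>

class complex_inner = complex_vector + real_inner +
  fixes cinner :: "'a \<Rightarrow> 'a \<Rightarrow> complex"
  assumes cinner_commute: "cinner x y = cnj (cinner y x)"
    and cinner_add_right: "cinner x (y + z) = cinner x y + cinner x z"
    and cinner_scaleC_right: "cinner x (a *\<^sub>C y) = a * cinner x y"
    and inner_eq_Re_cinner: "inner x y = Re (cinner x y)"

instantiation prod :: (complex_vector, complex_vector) complex_vector
begin

definition scaleC_prod :: "complex \<Rightarrow> 'a \<times> 'b \<Rightarrow> 'a \<times> 'b"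
  where "scaleC_prod a p = (a *\<^sub>C fst p, a *\<^sub>C snd p)"

instance
  by standard
    (simp_all add: scaleC_prod_def prod_eq_iff scaleC_add_right scaleC_add_left scaleC_scaleC
      scaleC_one scaleR_eq_scaleC)

end

instantiation prod :: (complex_inner, complex_inner) complex_inner
begin

definition cinner_prod :: "'a \<times> 'b \<Rightarrow> 'a \<times> 'b \<Rightarrow> complex"
  where "cinner_prod p q = cinner (fst p) (fst q) + cinner (snd p) (snd q)"

instance
proof
  fix x y z :: "'a \<times> 'b" and a :: complex
  show "cinner x y = cnj (cinner y x)"
    unfolding cinner_prod_def complex_cnj_add
    by (simp only: cinner_commute[symmetric])
  show "cinner x (y + z) = cinner x y + cinner x z"
    by (simp add: cinner_prod_def cinner_add_right)
  show "cinner x (a *\<^sub>C y) = a * cinner x y"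
    by (simp add: cinner_prod_def scaleC_prod_def cinner_scaleC_right distrib_left)
  show "inner x y = Re (cinner x y)"
    by (simp add: cinner_prod_def inner_prod_def inner_eq_Re_cinner)
qed

end


section \<open>Unbounded operators\<close>

text \<open>
  An unbounded operator is given by its domain \<open>D\<close> and a function \<open>A\<close>; the values of \<open>A\<close>
  outside \<open>D\<close> are irrelevant. The description in \<open>adj_op\<close> is unique on \<open>adj_domain\<close>
  when \<open>D\<close> is dense.
\<close>

definition clinear_on :: "'a::complex_vector set \<Rightarrow> ('a \<Rightarrow> 'a) \<Rightarrow> bool" where
  "clinear_on D A \<longleftrightarrow> complex_vector.subspace D \<and>
     (\<forall>x\<in>D. \<forall>y\<in>D. A (x + y) = A x + A y) \<and> (\<forall>x\<in>D. \<forall>c. A (c *\<^sub>C x) = c *\<^sub>C A x)"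

definition adj_domain :: "'a::complex_inner set \<Rightarrow> ('a \<Rightarrow> 'a) \<Rightarrow> 'a set" where
  "adj_domain D A = {y. \<exists>z. \<forall>x\<in>D. cinner y (A x) = cinner z x}"

definition adj_op :: "'a::complex_inner set \<Rightarrow> ('a \<Rightarrow> 'a) \<Rightarrow> 'a \<Rightarrow> 'a" where
  "adj_op D A y = (THE z. \<forall>x\<in>D. cinner y (A x) = cinner z x)"

definition self_adjoint :: "'a::complex_inner set \<Rightarrow> ('a \<Rightarrow> 'a) \<Rightarrow> bool" where
  "self_adjoint D A \<longleftrightarrow> clinear_on D A \<and> closure D = UNIV \<and>
     adj_domain D A = D \<and> (\<forall>y\<in>D. adj_op D A y = A y)"

definition resolvent_set :: "'a::complex_inner set \<Rightarrow> ('a \<Rightarrow> 'a) \<Rightarrow> complex set" where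
  "resolvent_set D A = {z. bij_betw (\<lambda>x. A x - z *\<^sub>C x) D UNIV \<and>
     (\<exists>C. \<forall>x\<in>D. norm x \<le> C * norm (A x - z *\<^sub>C x))}"

definition spectrum :: "'a::complex_inner set \<Rightarrow> ('a \<Rightarrow> 'a) \<Rightarrow> complex set" where
  "spectrum D A = - resolvent_set D A"

definition eigenspace :: "'a::complex_inner set \<Rightarrow> ('a \<Rightarrow> 'a) \<Rightarrow> complex \<Rightarrow> 'a set" where
  "eigenspace D A z = {x\<in>D. A x = z *\<^sub>C x}"

definition finite_cdim :: "'a::complex_vector set \<Rightarrow> bool" where
  "finite_cdim S \<longleftrightarrow> (\<exists>B. finite B \<and> S \<subseteq> complex_vector.span B)"

definition discrete_spectrum :: "'a::complex_inner set \<Rightarrow> ('a \<Rightarrow> 'a) \<Rightarrow> complex set" where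
  "discrete_spectrum D A = {z. z isolated_in spectrum D A \<and>
     eigenspace D A z \<noteq> {0} \<and> finite_cdim (eigenspace D A z)}"

definition essential_spectrum :: "'a::complex_inner set \<Rightarrow> ('a \<Rightarrow> 'a) \<Rightarrow> complex set" where
  "essential_spectrum D A = spectrum D A - discrete_spectrum D A"


section \<open>The space of square-integrable functions on the real line\<close>

definition square_integrable :: "(real \<Rightarrow> complex) \<Rightarrow> bool" where
  "square_integrable f \<longleftrightarrow>
     f \<in> borel_measurable lborel \<and> integrable lborel (\<lambda>s. (cmod (f s))\<^sup>2)"

lemma square_integrable_measurable:
  "square_integrable f \<Longrightarrow> f \<in> borel_measurable lborel"
  by (simp add: square_integrable_def)

lemma square_integrable_zero: "square_integrable (\<lambda>_. 0)"
  by (simp add: square_integrable_def)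

lemma square_integrable_bound:
  assumes "square_integrable f" "g \<in> borel_measurable lborel" "\<And>s. cmod (g s) \<le> C * cmod (f s)"
  shows "square_integrable g"
  unfolding square_integrable_def
proof
  show "integrable lborel (\<lambda>s. (cmod (g s))\<^sup>2)"
  proof (rule Bochner_Integration.integrable_bound)
    show "integrable lborel (\<lambda>s. C\<^sup>2 * (cmod (f s))\<^sup>2)"
      using assms(1) by (simp add: square_integrable_def)
    show "(\<lambda>s. (cmod (g s))\<^sup>2) \<in> borel_measurable lborel"
      using assms(2) by measurable
    have "(cmod (g s))\<^sup>2 \<le> C\<^sup>2 * (cmod (f s))\<^sup>2" for s
      using power_mono[OF assms(3)[of s], of 2] by (simp add: power_mult_distrib)
    then show "AE s in lborel. norm ((cmod (g s))\<^sup>2) \<le> norm (C\<^sup>2 * (cmod (f s))\<^sup>2)"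
      by simp
  qed
qed (fact assms(2))

lemma square_integrable_scale:
  assumes "square_integrable f"
  shows "square_integrable (\<lambda>s. a * f s)"
proof (rule square_integrable_bound[OF assms])
  note [measurable] = square_integrable_measurable[OF assms]
  show "(\<lambda>s. a * f s) \<in> borel_measurable lborel"
    by measurable
  show "cmod (a * f s) \<le> cmod a * cmod (f s)" for s
    by (simp add: norm_mult)
qed

lemma square_integrable_uminus:
  "square_integrable f \<Longrightarrow> square_integrable (\<lambda>s. - f s)"
  using square_integrable_scale[of f "- 1"] by simp

lemma square_integrable_add:
  assumes "square_integrable f" "square_integrable g"
  shows "square_integrable (\<lambda>s. f s + g s)"
proof -
  note [measurable] = assms[THEN square_integrable_measurable]
  have "(cmod (f s + g s))\<^sup>2 \<le> 2 * (cmod (f s))\<^sup>2 + 2 * (cmod (g s))\<^sup>2" for s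
  proof -
    have "(cmod (f s + g s))\<^sup>2 \<le> (cmod (f s) + cmod (g s))\<^sup>2"
      by (simp add: norm_triangle_ineq power_mono)
    also have "\<dots> \<le> 2 * (cmod (f s))\<^sup>2 + 2 * (cmod (g s))\<^sup>2"
      using sum_squares_bound[of "cmod (f s)" "cmod (g s)"] by (simp add: power2_sum)
    finally show ?thesis .
  qed
  then have "AE s in lborel. norm ((cmod (f s + g s))\<^sup>2) \<le>
      norm (2 * (cmod (f s))\<^sup>2 + 2 * (cmod (g s))\<^sup>2)"
    by simp
  moreover have "integrable lborel (\<lambda>s. 2 * (cmod (f s))\<^sup>2 + 2 * (cmod (g s))\<^sup>2)"
    using assms by (simp add: square_integrable_def)
  moreover have "(\<lambda>s. (cmod (f s + g s))\<^sup>2) \<in> borel_measurable lborel"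
    by measurable
  ultimately have "integrable lborel (\<lambda>s. (cmod (f s + g s))\<^sup>2)"
    using Bochner_Integration.integrable_bound by blast
  then show ?thesis
    by (simp add: square_integrable_def)
qed

lemma integrable_cnj_mult:
  assumes "square_integrable f" "square_integrable g"
  shows "integrable lborel (\<lambda>s. cnj (f s) * g s)"
proof -
  note [measurable] = assms[THEN square_integrable_measurable]
  have cnj_meas [measurable]: "(\<lambda>s. cnj (f s)) \<in> borel_measurable lborel"
    by (rule borel_measurable_continuous_on[of cnj]) (auto intro: continuous_on_cnj continuous_on_id)
  have "cmod (f s) * cmod (g s) \<le> (cmod (f s))\<^sup>2 + (cmod (g s))\<^sup>2" for s
  proof -
    have "0 \<le> cmod (f s) * cmod (g s)"
      by simp
    then show ?thesis
      using sum_squares_bound[of "cmod (f s)" "cmod (g s)"] by linarith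
  qed
  then have "AE s in lborel. norm (cnj (f s) * g s) \<le> norm ((cmod (f s))\<^sup>2 + (cmod (g s))\<^sup>2)"
    by (simp add: norm_mult)
  moreover have "integrable lborel (\<lambda>s. (cmod (f s))\<^sup>2 + (cmod (g s))\<^sup>2)"
    using assms by (simp add: square_integrable_def)
  moreover have "(\<lambda>s. cnj (f s) * g s) \<in> borel_measurable lborel"
    by measurable
  ultimately show ?thesis
    using Bochner_Integration.integrable_bound by blast
qed

text \<open>
  Elements of \<open>L2\<close> are classes of square-integrable functions modulo equality almost everywhere.
  Since every Lebesgue measurable function is almost everywhere equal to a Borel measurable one,
  Borel measurable representatives suffice.
\<close>

definition L2_rel :: "(real \<Rightarrow> complex) \<Rightarrow> (real \<Rightarrow> complex) \<Rightarrow> bool" where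
  "L2_rel f g \<longleftrightarrow> square_integrable f \<and> square_integrable g \<and> (AE s in lborel. f s = g s)"

quotient_type L2 = "real \<Rightarrow> complex" / partial: L2_rel
proof (rule part_equivpI)
  show "\<exists>f. L2_rel f f"
    using square_integrable_zero by (auto simp: L2_rel_def)
  have "AE s in lborel. g s = f s" if "AE s in lborel. f s = g s" for f g :: "real \<Rightarrow> complex"
    using that by eventually_elim simp
  then show "symp L2_rel"
    by (auto simp: symp_def L2_rel_def)
  have "AE s in lborel. f s = k s" if "AE s in lborel. f s = g s" "AE s in lborel. g s = k s"
    for f g k :: "real \<Rightarrow> complex"
    using that by eventually_elim simp
  then show "transp L2_rel"
    unfolding transp_def L2_rel_def by blast
qed

lemma L2_relE:
  assumes "L2_rel f g"
  obtains "square_integrable f" "square_integrable g" "AE s in lborel. f s = g s"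
    "f \<in> borel_measurable lborel" "g \<in> borel_measurable lborel"
  using assms by (auto simp: L2_rel_def square_integrable_def)

instantiation L2 :: ab_group_add
begin

lift_definition zero_L2 :: L2 is "\<lambda>_. 0"
  by (simp add: L2_rel_def square_integrable_zero)

lift_definition plus_L2 :: "L2 \<Rightarrow> L2 \<Rightarrow> L2" is "\<lambda>f g s. f s + g s"
  by (auto simp: L2_rel_def intro: square_integrable_add)

lift_definition uminus_L2 :: "L2 \<Rightarrow> L2" is "\<lambda>f s. - f s"
  by (auto simp: L2_rel_def intro: square_integrable_uminus)

definition minus_L2 :: "L2 \<Rightarrow> L2 \<Rightarrow> L2" where "minus_L2 f g = f + - g"

instance
proof
  fix a b c :: L2
  show "a + b + c = a + (b + c)"
    by transfer (auto simp: L2_rel_def add.assoc intro: square_integrable_add)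
  show "a + b = b + a"
    by transfer (auto simp: L2_rel_def add.commute intro: square_integrable_add)
  show "0 + a = a"
    by transfer (auto simp: L2_rel_def)
  show "- a + a = 0"
    by transfer (auto simp: L2_rel_def square_integrable_zero)
  show "a - b = a + - b"
    by (fact minus_L2_def)
qed

end

instantiation L2 :: complex_vector
begin

lift_definition scaleC_L2 :: "complex \<Rightarrow> L2 \<Rightarrow> L2" is "\<lambda>a f s. a * f s"
  by (auto simp: L2_rel_def intro: square_integrable_scale)

definition scaleR_L2 :: "real \<Rightarrow> L2 \<Rightarrow> L2" where "scaleR_L2 r f = complex_of_real r *\<^sub>C f"

instance
proof
  fix x y :: L2 and a b :: complex and r t :: real
  show add_right: "a *\<^sub>C (x + y) = a *\<^sub>C x + a *\<^sub>C y" for a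
    by transfer (auto simp: L2_rel_def distrib_left intro: square_integrable_add square_integrable_scale)
  show add_left: "(a + b) *\<^sub>C x = a *\<^sub>C x + b *\<^sub>C x" for a b
    by transfer (auto simp: L2_rel_def distrib_right intro: square_integrable_add square_integrable_scale)
  show assoc: "a *\<^sub>C (b *\<^sub>C x) = (a * b) *\<^sub>C x" for a b
    by transfer (auto simp: L2_rel_def mult.assoc intro: square_integrable_scale)
  show one: "1 *\<^sub>C x = x"
    by transfer (auto simp: L2_rel_def)
  show "r *\<^sub>R x = complex_of_real r *\<^sub>C x"
    by (fact scaleR_L2_def)
  show "r *\<^sub>R (x + y) = r *\<^sub>R x + r *\<^sub>R y"
    by (simp add: scaleR_L2_def add_right)
  show "(r + t) *\<^sub>R x = r *\<^sub>R x + t *\<^sub>R x"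
    by (simp add: scaleR_L2_def add_left)
  show "r *\<^sub>R t *\<^sub>R x = (r * t) *\<^sub>R x"
    by (simp add: scaleR_L2_def assoc)
  show "1 *\<^sub>R x = x"
    by (simp add: scaleR_L2_def one)
qed

end

instantiation L2 :: complex_inner
begin

lift_definition cinner_L2 :: "L2 \<Rightarrow> L2 \<Rightarrow> complex"
  is "\<lambda>f g. LINT s|lborel. cnj (f s) * g s"
proof -
  fix f f' g g' assume f: "L2_rel f f'" and g: "L2_rel g g'"
  have "AE s in lborel. cnj (f s) * g s = cnj (f' s) * g' s"
    using f g by (auto simp: L2_rel_def)
  moreover have "integrable lborel (\<lambda>s. cnj (f s) * g s)" "integrable lborel (\<lambda>s. cnj (f' s) * g' s)"
    using f g by (auto simp: L2_rel_def intro: integrable_cnj_mult)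
  ultimately show "(LINT s|lborel. cnj (f s) * g s) = (LINT s|lborel. cnj (f' s) * g' s)"
    by (intro integral_cong_AE) (auto intro: borel_measurable_integrable)
qed

definition inner_L2 :: "L2 \<Rightarrow> L2 \<Rightarrow> real" where "inner_L2 f g = Re (cinner f g)"

definition norm_L2 :: "L2 \<Rightarrow> real" where "norm_L2 f = sqrt (inner f f)"

definition sgn_L2 :: "L2 \<Rightarrow> L2" where "sgn_L2 f = inverse (norm f) *\<^sub>R f"

definition dist_L2 :: "L2 \<Rightarrow> L2 \<Rightarrow> real" where "dist_L2 f g = norm (f - g)"

definition uniformity_L2 :: "(L2 \<times> L2) filter"
  where "uniformity_L2 = (INF e\<in>{0<..}. principal {(x, y). dist x y < e})"

definition open_L2 :: "L2 set \<Rightarrow> bool"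
  where "open_L2 U = (\<forall>x\<in>U. eventually (\<lambda>(x', y). x' = x \<longrightarrow> y \<in> U) uniformity)"

instance
proof
  fix x y z :: L2 and a :: complex and r :: real
  show commute: "cinner x y = cnj (cinner y x)" for x y :: L2
  proof transfer
    fix f g :: "real \<Rightarrow> complex"
    have "cnj (LINT s|lborel. cnj (g s) * f s) = (LINT s|lborel. cnj (cnj (g s) * f s))"
      by (rule Bochner_Integration.integral_cnj[symmetric])
    also have "(\<lambda>s. cnj (cnj (g s) * f s)) = (\<lambda>s. cnj (f s) * g s)"
      by (simp add: fun_eq_iff)
    finally show "(LINT s|lborel. cnj (f s) * g s) = cnj (LINT s|lborel. cnj (g s) * f s)"
      by (rule sym)
  qed
  show add_right: "cinner x (y + z) = cinner x y + cinner x z" for x y z :: L2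
    by transfer (simp add: L2_rel_def distrib_left integrable_cnj_mult)
  show scaleC_right: "cinner x (a *\<^sub>C y) = a * cinner x y" for x y :: L2 and a
    by transfer (simp add: mult.left_commute)
  show "inner x y = Re (cinner x y)"
    by (fact inner_L2_def)
  show inner_comm: "inner x y = inner y x" for x y :: L2
    unfolding inner_L2_def by (subst commute) simp
  show "inner (x + y) z = inner x z + inner y z"
    unfolding inner_comm[of "x + y" z] inner_comm[of x z] inner_comm[of y z]
    by (simp add: inner_L2_def add_right)
  show "inner (r *\<^sub>R x) y = r * inner x y"
    unfolding inner_comm[of "r *\<^sub>R x" y] inner_comm[of x y]
    by (simp add: inner_L2_def scaleR_L2_def scaleC_right)
  have cinner_self: "cinner (abs_L2 f) (abs_L2 f) = complex_of_real (LINT s|lborel. (cmod (f s))\<^sup>2)"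
    if "square_integrable f" for f
  proof -
    have "cinner (abs_L2 f) (abs_L2 f) = (LINT s|lborel. cnj (f s) * f s)"
      using that by (intro cinner_L2.abs_eq) (auto simp: L2_rel_def)
    also have "\<dots> = (LINT s|lborel. complex_of_real ((cmod (f s))\<^sup>2))"
      by (simp only: complex_norm_square mult.commute)
    finally show ?thesis
      by (simp only: integral_complex_of_real)
  qed
  obtain f where f: "square_integrable f" "x = abs_L2 f"
    using Quotient3_rep_reflp[OF Quotient3_L2, of x] Quotient3_abs_rep[OF Quotient3_L2, of x]
    by (metis L2_rel_def)
  have inner_self: "inner x x = (LINT s|lborel. (cmod (f s))\<^sup>2)"
    by (simp add: inner_L2_def f cinner_self)
  show "0 \<le> inner x x"
    by (simp add: inner_self)
  have "(LINT s|lborel. (cmod (f s))\<^sup>2) = 0 \<longleftrightarrow> (AE s in lborel. f s = 0)"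
    using f(1) by (subst integral_nonneg_eq_0_iff_AE) (auto simp: square_integrable_def)
  also have "\<dots> \<longleftrightarrow> x = 0"
    using f(1) Quotient3_rel[OF Quotient3_L2, of f "\<lambda>_. 0"]
    by (simp add: f(2) zero_L2_def L2_rel_def square_integrable_zero)
  finally show "inner x x = 0 \<longleftrightarrow> x = 0"
    by (simp add: inner_self)
qed (simp_all add: norm_L2_def sgn_L2_def dist_L2_def uniformity_L2_def open_L2_def)

end


section \<open>Multiplication operators and weak derivatives\<close>

text \<open>
  Multiplication by a bounded measurable real function. For functions that are not of this kind,
  where pointwise multiplication need not preserve square integrability, the value is \<open>0\<close>.
\<close>

lift_definition mult_op :: "(real \<Rightarrow> real) \<Rightarrow> L2 \<Rightarrow> L2"
  is "\<lambda>a f. if a \<in> borel_measurable borel \<and> bounded (range a)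
            then (\<lambda>s. complex_of_real (a s) * f s) else (\<lambda>_. 0)"
proof -
  fix a :: "real \<Rightarrow> real" and f g assume fg: "L2_rel f g"
  have mult: "square_integrable (\<lambda>s. complex_of_real (a s) * f s)"
    if a: "a \<in> borel_measurable borel" "bounded (range a)" and f: "square_integrable f" for f
  proof -
    obtain C where "\<And>s. \<bar>a s\<bar> \<le> C"
      using a(2) by (auto simp: bounded_iff)
    then show ?thesis
      using a(1) square_integrable_measurable[OF f]
      by (intro square_integrable_bound[OF f, where C = C]) (auto simp: norm_mult mult_right_mono)
  qed
  show "L2_rel
      (if a \<in> borel_measurable borel \<and> bounded (range a)
       then (\<lambda>s. complex_of_real (a s) * f s) else (\<lambda>_. 0))
      (if a \<in> borel_measurable borel \<and> bounded (range a)
       then (\<lambda>s. complex_of_real (a s) * g s) else (\<lambda>_. 0))"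
    using fg mult by (auto simp: L2_rel_def square_integrable_zero)
qed

definition test_function :: "(real \<Rightarrow> real) \<Rightarrow> bool" where
  "test_function \<psi> \<longleftrightarrow> (\<forall>k s. (deriv ^^ k) \<psi> field_differentiable at s) \<and>
     compact (closure {s. \<psi> s \<noteq> 0})"

lift_definition has_weak_derivative :: "L2 \<Rightarrow> L2 \<Rightarrow> bool"
  is "\<lambda>f g. \<forall>\<psi>. test_function \<psi> \<longrightarrow>
        (LINT s|lborel. f s * complex_of_real (deriv \<psi> s)) =
        - (LINT s|lborel. g s * complex_of_real (\<psi> s))"
proof -
  fix f f' g g' assume f: "L2_rel f f'" and g: "L2_rel g g'"
  have "(LINT s|lborel. f s * complex_of_real (deriv \<psi> s)) =
          (LINT s|lborel. f' s * complex_of_real (deriv \<psi> s)) \<and>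
        (LINT s|lborel. g s * complex_of_real (\<psi> s)) =
          (LINT s|lborel. g' s * complex_of_real (\<psi> s))"
    if \<psi>: "test_function \<psi>" for \<psi>
  proof -
    have "(deriv ^^ k) \<psi> \<in> borel_measurable lborel" for k
      using \<psi> unfolding test_function_def
      by (auto intro!: borel_measurable_continuous_onI continuous_at_imp_continuous_on
          field_differentiable_imp_continuous_at)
    from this[of 0] this[of 1]
    have [measurable]: "\<psi> \<in> borel_measurable lborel" "deriv \<psi> \<in> borel_measurable lborel"
      by simp_all
    show ?thesis
      using f g by (auto elim!: L2_relE intro!: integral_cong_AE)
  qed
  then show "(\<forall>\<psi>. test_function \<psi> \<longrightarrow> (LINT s|lborel. f s * complex_of_real (deriv \<psi> s)) =
        - (LINT s|lborel. g s * complex_of_real (\<psi> s))) =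
      (\<forall>\<psi>. test_function \<psi> \<longrightarrow> (LINT s|lborel. f' s * complex_of_real (deriv \<psi> s)) =
        - (LINT s|lborel. g' s * complex_of_real (\<psi> s)))"
    by auto
qed

text \<open>A weak derivative is unique as an element of \<open>L2\<close>, so \<open>THE\<close> is determined on \<open>H1\<close>.\<close>

definition H1 :: "L2 set" where
  "H1 = {f. \<exists>g. has_weak_derivative f g}"

definition weak_deriv :: "L2 \<Rightarrow> L2" where
  "weak_deriv f = (THE g. has_weak_derivative f g)"


section \<open>The reduced Hamiltonian\<close>

definition phi :: "real \<Rightarrow> real \<Rightarrow> real" where
  "phi Q s = Q / 2 * exp (- \<bar>s\<bar>)"

lemma phi_bounded_measurable:
  "phi Q \<in> borel_measurable borel" "bounded (range (phi Q))"
proof -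
  show "phi Q \<in> borel_measurable borel"
    unfolding phi_def by measurable
  have "\<bar>phi Q s\<bar> \<le> \<bar>Q\<bar> / 2" for s
    by (simp add: phi_def abs_mult mult_left_le)
  then show "bounded (range (phi Q))"
    unfolding bounded_iff by (intro exI[of _ "\<bar>Q\<bar> / 2"]) auto
qed

definition h_domain :: "(L2 \<times> L2) set" where
  "h_domain = H1 \<times> H1"

definition h :: "real \<Rightarrow> real \<Rightarrow> real \<Rightarrow> L2 \<times> L2 \<Rightarrow> L2 \<times> L2" where
  "h m e Q = (\<lambda>(u, v).
     (mult_op (\<lambda>s. m - e * phi Q s) u - weak_deriv v,
      weak_deriv u + mult_op (\<lambda>s. - m - e * phi Q s) v))"

end

theory Submission
  imports Defs
begin

text \<open>
  The form of the operator gives symmetry by integration by parts in \<open>H1\<close>, and testing against test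
  functions shows that the domain of the adjoint is no larger. For real \<open>l\<close> with \<open>\<bar>l\<bar> < m\<close> one has
  \<open>norm x \<le> C (norm ((h - l) x) + \<bar>x(0)\<bar>)\<close>: the free operator is bounded below by \<open>m\<close>, the potential
  is small outside a compact interval, and on the interval Gronwall's inequality applies. As \<open>x(0)\<close>
  lies in a space of dimension two, approximate eigenvectors accumulate; hence points of the spectrum
  in the gap are eigenvalues, and they are isolated because eigenvectors for different eigenvalues are
  orthogonal. Eigenvalues in the gap are simple since the Wronskian of two eigenvectors is constant
  and integrable. Damped plane waves show that every real \<open>l\<close> with \<open>\<bar>l\<bar> \<ge> m\<close> is in the spectrum.
\<close>

section \<open>Self-adjoint operators in complex Hilbert spaces\<close>

text \<open>The map \<open>initial_value\<close> plays the role that relative compactness of the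
  potential has in Weyl's argument: in the gap a vector is controlled by its residual and two
  complex numbers. The free bound \<open>m\<close> comes from cross terms that cancel by integration
  by parts; the shift by \<open>l\<close> costs \<open>\<bar>l\<bar>\<close>, half of the remaining
  \<open>m - \<bar>l\<bar>\<close> absorbs the tail of the potential and the other half survives.
  The obstacle is that \<open>L2\<close> is a quotient and derivatives are weak, so evaluation at
  \<open>0\<close> has a meaning only after the du Bois-Reymond lemma: an element of
  \<open>H1\<close> has a continuous representative that is an indefinite integral of its weak
  derivative. Gronwall's inequality, the Wronskian and integration by parts are all run on these
  representatives. Outside the gap every real point is a limit of other spectral points, so it is
  essential whether or not it is an eigenvalue. Damping by
  \<open>exp (- \<epsilon> * \<bar>s\<bar>)\<close> gives explicit norms at the price of a kink at
  \<open>0\<close>, and square integrability of the potential keeps its product with the wave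
  bounded as \<epsilon> tends to \<open>0\<close>.\<close>

lemma cinner_add_left: "cinner (x + y) z = cinner x z + cinner y z"
  unfolding cinner_commute[of "x + y" z] cinner_commute[of x z] cinner_commute[of y z]
  by (simp add: cinner_add_right)

lemma cinner_scaleC_left: "cinner (a *\<^sub>C x) y = cnj a * cinner x y"
  unfolding cinner_commute[of "a *\<^sub>C x" y] cinner_commute[of x y]
  by (simp add: cinner_scaleC_right)

lemma scaleC_minus1: "(- 1) *\<^sub>C x = - (x::'a::complex_vector)"
  by (simp add: complex_vector.scale_minus_left scaleC_one)

lemma cinner_minus_right: "cinner x (- y) = - cinner x y"
  using cinner_scaleC_right[of x "- 1" y] by (simp add: scaleC_minus1)

lemma cinner_minus_left: "cinner (- x) y = - cinner x y"
  using cinner_scaleC_left[of "- 1" x y] by (simp add: scaleC_minus1)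

lemma cinner_diff_right: "cinner x (y - z) = cinner x y - cinner x z"
  using cinner_add_right[of x y "- z"] by (simp add: cinner_minus_right)

lemma cinner_diff_left: "cinner (x - y) z = cinner x z - cinner y z"
  using cinner_add_left[of x "- y" z] by (simp add: cinner_minus_left)

lemma cinner_zero_right [simp]: "cinner x 0 = 0"
  using cinner_diff_right[of x 0 0] by simp

lemma cinner_zero_left [simp]: "cinner 0 x = 0"
  using cinner_diff_left[of 0 0 x] by simp

lemma cinner_self: "cinner x x = complex_of_real ((norm x)\<^sup>2)"
proof -
  have "Im (cinner x x) = 0"
    using arg_cong[OF cinner_commute[of x x], of Im] by simp
  moreover have "Re (cinner x x) = (norm x)\<^sup>2"
    by (simp add: inner_eq_Re_cinner[symmetric] power2_norm_eq_inner)
  ultimately show ?thesis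
    by (simp add: complex_eq_iff)
qed

lemma norm_scaleC: "norm (a *\<^sub>C x) = cmod a * norm (x::'a::complex_inner)"
proof -
  have "complex_of_real ((norm (a *\<^sub>C x))\<^sup>2) = cnj a * a * complex_of_real ((norm x)\<^sup>2)"
    by (simp only: cinner_self[symmetric] cinner_scaleC_left cinner_scaleC_right mult_ac)
  also have "cnj a * a = complex_of_real ((cmod a)\<^sup>2)"
    by (simp only: complex_norm_square mult.commute)
  finally have "complex_of_real ((norm (a *\<^sub>C x))\<^sup>2) = complex_of_real ((cmod a * norm x)\<^sup>2)"
    by (simp only: of_real_mult power_mult_distrib)
  then have "(norm (a *\<^sub>C x))\<^sup>2 = (cmod a * norm x)\<^sup>2"
    by (simp only: of_real_eq_iff)
  then show ?thesis
    by (simp add: power2_eq_iff_nonneg)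
qed

lemma cinner_Cauchy_Schwarz: "cmod (cinner x y) \<le> norm x * norm y"
proof (cases "cinner x y = 0")
  case False
  \<comment> \<open>The phase \<open>c\<close> rotates \<open>y\<close> so that the inner product
    becomes real and nonnegative; the real Cauchy-Schwarz inequality then suffices.\<close>
  define c where "c = cnj (cinner x y) / cmod (cinner x y)"
  have "cmod c = 1"
    using False by (simp add: c_def norm_divide)
  have "c * cinner x y = (cinner x y * cnj (cinner x y)) / cmod (cinner x y)"
    by (simp add: c_def)
  also have "\<dots> = complex_of_real (cmod (cinner x y))"
    using False by (simp add: complex_norm_square[symmetric] power2_eq_square)
  finally have "c * cinner x y = complex_of_real (cmod (cinner x y))" .
  then have "cmod (cinner x y) = Re (cinner x (c *\<^sub>C y))"
    by (simp add: cinner_scaleC_right)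
  also have "\<dots> \<le> norm x * norm (c *\<^sub>C y)"
    unfolding inner_eq_Re_cinner[symmetric] by (rule norm_cauchy_schwarz)
  finally show ?thesis
    by (simp add: norm_scaleC \<open>cmod c = 1\<close>)
qed simp

lemma tendsto_cinner:
  fixes x y :: "'a::complex_inner"
  assumes "(f \<longlongrightarrow> x) F" "(g \<longlongrightarrow> y) F"
  shows "((\<lambda>i. cinner (f i) (g i)) \<longlongrightarrow> cinner x y) F"
proof -
  \<comment> \<open>The imaginary part is the real inner product with
    \<open>- \<i> *\<^sub>C v\<close>, so continuity reduces to that of
    \<open>inner\<close>.\<close>
  have eq: "cinner u v = Complex (inner u v) (inner u (- \<i> *\<^sub>C v))" for u v :: 'a
    by (simp add: complex_eq_iff inner_eq_Re_cinner cinner_scaleC_right cinner_minus_right)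
  have "bounded_linear (\<lambda>v::'a. - \<i> *\<^sub>C v)"
    by (rule bounded_linear_intro[where K = 1])
       (simp_all add: scaleC_add_right scaleR_eq_scaleC scaleC_scaleC norm_scaleC mult.commute)
  then have "((\<lambda>i. - \<i> *\<^sub>C g i) \<longlongrightarrow> - \<i> *\<^sub>C y) F"
    using assms(2) by (rule bounded_linear.tendsto)
  then show ?thesis
    unfolding eq[of x y] unfolding eq[of "f _" "g _"]
    using assms by (intro tendsto_Complex tendsto_inner)
qed

lemma tendsto_scaleC:
  fixes g :: "_ \<Rightarrow> 'a::complex_inner"
  assumes "(g \<longlongrightarrow> y) F"
  shows "((\<lambda>i. a *\<^sub>C g i) \<longlongrightarrow> a *\<^sub>C y) F"
proof -
  have "bounded_linear (\<lambda>v::'a. a *\<^sub>C v)"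
    by (rule bounded_linear_intro[where K = "cmod a"])
       (simp_all add: scaleC_add_right scaleR_eq_scaleC scaleC_scaleC norm_scaleC mult.commute)
  then show ?thesis
    using assms by (rule bounded_linear.tendsto)
qed

section \<open>Orthogonal projection onto a closed subspace\<close>

lemma inner_zero_if_minimal:
  assumes "\<And>r::real. norm y \<le> norm (y - r *\<^sub>R t)"
  shows "inner t y = 0"
proof (cases "t = 0")
  case False
  \<comment> \<open>This is the minimiser in \<open>r\<close> of the quadratic polynomial
    \<open>(norm (y - r *\<^sub>R t))\<^sup>2\<close>.\<close>
  define r where "r = inner t y / inner t t"
  have pos: "inner t t > 0"
    using False by simp
  have "inner y y \<le> inner (y - r *\<^sub>R t) (y - r *\<^sub>R t)"
    using assms[of r] by (simp add: norm_le)
  also have "\<dots> = inner y y - 2 * r * inner t y + r\<^sup>2 * inner t t"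
    by (simp add: inner_diff_left inner_diff_right inner_commute power2_eq_square algebra_simps)
  finally have "2 * r * inner t y \<le> r\<^sup>2 * inner t t"
    by simp
  moreover have "r\<^sup>2 * inner t t = r * inner t y"
    using pos by (simp add: r_def power2_eq_square)
  ultimately have "r * inner t y \<le> 0"
    by simp
  then have "(inner t y)\<^sup>2 / inner t t \<le> 0"
    by (simp add: r_def power2_eq_square)
  then show ?thesis
    using pos by (simp add: divide_le_0_iff)
qed simp

text \<open>For a point outside \<open>S\<close>, a sequence in \<open>S\<close> minimising the
  distance is Cauchy; the difference between the point and the limit is orthogonal to
  \<open>S\<close>.\<close>

lemma proper_closed_subspace_orthogonal:
  fixes S :: "'a::{complex_inner, complete_space} set"
  assumes S: "complex_vector.subspace S" "closed S" "S \<noteq> UNIV"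
  obtains y where "y \<noteq> 0" "\<forall>t\<in>S. cinner t y = 0"
proof -
  obtain x where x: "x \<notin> S"
    using S(3) by blast
  have ne: "S \<noteq> {}"
    using complex_vector.subspace_0[OF S(1)] by auto
  have sc: "r *\<^sub>R s \<in> S" if "s \<in> S" for r s
    using complex_vector.subspace_scale[OF S(1) that] by (simp add: scaleR_eq_scaleC)
  have ad: "s + t \<in> S" if "s \<in> S" "t \<in> S" for s t
    using complex_vector.subspace_add[OF S(1)] that by blast
  define d where "d = infdist x S"
  have d0: "0 \<le> d"
    by (simp add: d_def infdist_nonneg)
  have dle: "d \<le> norm (x - s)" if "s \<in> S" for s
    using infdist_le[OF that, of x] by (simp add: d_def dist_norm)
  have "\<exists>s\<in>S. norm (x - s) < d + inverse (Suc n)" for n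
  proof -
    have "(INF s\<in>S. dist x s) < d + inverse (Suc n)"
      by (simp add: d_def infdist_notempty[OF ne])
    then have "\<exists>v\<in>dist x ` S. v < d + inverse (Suc n)"
      using ne by (intro cInf_lessD) auto
    then show ?thesis
      by (auto simp: dist_norm)
  qed
  then obtain s where s: "\<And>n. s n \<in> S" "\<And>n. norm (x - s n) < d + inverse (Suc n)"
    by metis
  have lim: "(\<lambda>n. norm (x - s n)) \<longlonglongrightarrow> d"
  proof (rule tendsto_sandwich)
    show "\<forall>\<^sub>F n in sequentially. d \<le> norm (x - s n)"
      using s dle by (intro always_eventually) blast
    show "\<forall>\<^sub>F n in sequentially. norm (x - s n) \<le> d + inverse (real (Suc n))"
      using s(2) by (intro always_eventually allI less_imp_le)
    show "(\<lambda>n. d + inverse (Suc n)) \<longlonglongrightarrow> d"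
      using tendsto_add[OF tendsto_const[of d] LIMSEQ_inverse_real_of_nat] by simp
    show "(\<lambda>n. d) \<longlonglongrightarrow> d"
      by simp
  qed
  \<comment> \<open>Parallelogram law for \<open>x - s i\<close> and \<open>x - s j\<close>: the
    midpoint of \<open>s i\<close> and \<open>s j\<close> lies in \<open>S\<close>, so its distance
    from \<open>x\<close> is at least \<open>d\<close>.\<close>
  have par: "(dist (s i) (s j))\<^sup>2 \<le> 2 * ((norm (x - s i))\<^sup>2 - d\<^sup>2) + 2 * ((norm (x - s j))\<^sup>2 - d\<^sup>2)" for i j
  proof -
    have "d\<^sup>2 \<le> (norm (x - (1/2) *\<^sub>R (s i + s j)))\<^sup>2"
      using dle[OF sc[OF ad[OF s(1)[of i] s(1)[of j]]], of "1/2"] d0 by (simp add: power_mono)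
    moreover have "(dist (s i) (s j))\<^sup>2 = 2 * (norm (x - s i))\<^sup>2 + 2 * (norm (x - s j))\<^sup>2
        - 4 * (norm (x - (1/2) *\<^sub>R (s i + s j)))\<^sup>2"
      by (simp add: dist_norm power2_norm_eq_inner inner_diff_left inner_diff_right inner_add_left
          inner_add_right inner_commute algebra_simps)
    ultimately show ?thesis
      by simp
  qed
  have "Cauchy s"
  proof (rule metric_CauchyI)
    fix e :: real assume e: "0 < e"
    have "(\<lambda>n. (norm (x - s n))\<^sup>2) \<longlonglongrightarrow> d\<^sup>2"
      by (intro tendsto_power lim)
    then have "eventually (\<lambda>n. (norm (x - s n))\<^sup>2 < d\<^sup>2 + e\<^sup>2 / 4) sequentially"
      by (rule order_tendstoD) (use e in simp)
    then obtain N where N: "\<And>n. n \<ge> N \<Longrightarrow> (norm (x - s n))\<^sup>2 < d\<^sup>2 + e\<^sup>2 / 4"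
      unfolding eventually_sequentially by blast
    have "dist (s i) (s j) < e" if "i \<ge> N" "j \<ge> N" for i j
    proof -
      have "(dist (s i) (s j))\<^sup>2 < e\<^sup>2"
        using par[of i j] N[OF that(1)] N[OF that(2)] by argo
      then show ?thesis
        using e by (simp add: power_less_imp_less_base)
    qed
    then show "\<exists>N. \<forall>i\<ge>N. \<forall>j\<ge>N. dist (s i) (s j) < e"
      by blast
  qed
  then obtain p where p: "s \<longlonglongrightarrow> p"
    using Cauchy_convergent convergent_def by blast
  have pS: "p \<in> S"
    using S(2) s(1) p closed_sequentially by blast
  have "(\<lambda>n. norm (x - s n)) \<longlonglongrightarrow> norm (x - p)"
    by (intro tendsto_intros p)
  then have dp: "norm (x - p) = d"
    using lim LIMSEQ_unique by blast
  have inn: "inner t (x - p) = 0" if "t \<in> S" for t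
  proof (rule inner_zero_if_minimal)
    fix r :: real
    have "p + r *\<^sub>R t \<in> S"
      using ad[OF pS sc[OF that]] .
    from dle[OF this] show "norm (x - p) \<le> norm (x - p - r *\<^sub>R t)"
      by (simp add: dp diff_diff_eq)
  qed
  show thesis
  proof
    show "x - p \<noteq> 0"
      using x pS by auto
    show "\<forall>t\<in>S. cinner t (x - p) = 0"
    proof
      \<comment> \<open>Real orthogonality to \<open>t\<close> and to
        \<open>\<i> *\<^sub>C t\<close> yields the real and the imaginary part of complex
        orthogonality.\<close>
      fix t assume t: "t \<in> S"
      have "\<i> *\<^sub>C t \<in> S"
        using complex_vector.subspace_scale[OF S(1) t] .
      from inn[OF this] inn[OF t] show "cinner t (x - p) = 0"
        by (simp add: inner_eq_Re_cinner cinner_scaleC_left complex_eq_iff)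
    qed
  qed
qed

section \<open>Adjoints, self-adjointness and the resolvent set\<close>

lemma cinner_eq_on_dense:
  fixes z :: "'a::complex_inner"
  assumes "closure D = UNIV" "\<And>x. x \<in> D \<Longrightarrow> cinner z x = cinner z' x"
  shows "z = z'"
proof -
  have "z - z' \<in> closure D"
    using assms(1) by simp
  then obtain x where x: "\<And>n. x n \<in> D" "x \<longlonglongrightarrow> z - z'"
    unfolding closure_sequential by blast
  have "(\<lambda>n. cinner (z - z') (x n)) \<longlonglongrightarrow> cinner (z - z') (z - z')"
    by (intro tendsto_cinner tendsto_const x)
  moreover have "cinner (z - z') (x n) = 0" for n
    by (simp add: cinner_diff_left assms(2)[OF x(1)])
  ultimately have "cinner (z - z') (z - z') = 0"
    using LIMSEQ_unique[OF tendsto_const] by fastforce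
  then show ?thesis
    by (simp add: cinner_self)
qed

lemma adj_op_eqI:
  assumes "closure D = UNIV" "\<And>x. x \<in> D \<Longrightarrow> cinner y (A x) = cinner z x"
  shows "adj_op D A y = z"
  unfolding adj_op_def
proof (rule the_equality)
  show "w = z" if "\<forall>x\<in>D. cinner y (A x) = cinner w x" for w
    using that assms(2) by (intro cinner_eq_on_dense[OF assms(1)]) auto
qed (use assms in auto)

text \<open>Symmetry gives one inclusion of the domains and the values of the adjoint;
  \<open>dom\<close> is the other inclusion, which separates self-adjoint from merely symmetric
  operators.\<close>

lemma self_adjointI:
  assumes "clinear_on D A" "closure D = UNIV"
    and sym: "\<And>x y. x \<in> D \<Longrightarrow> y \<in> D \<Longrightarrow> cinner x (A y) = cinner (A x) y"
    and dom: "\<And>y z. (\<And>x. x \<in> D \<Longrightarrow> cinner y (A x) = cinner z x) \<Longrightarrow> y \<in> D"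
  shows "self_adjoint D A"
  unfolding self_adjoint_def
proof (intro conjI ballI)
  show "adj_domain D A = D"
    using sym dom unfolding adj_domain_def by blast
  show "adj_op D A y = A y" if "y \<in> D" for y
    by (rule adj_op_eqI[OF assms(2)]) (use that sym in auto)
qed (fact assms)+

locale self_adjoint_operator =
  fixes D :: "'a::{complex_inner, complete_space} set" and A :: "'a \<Rightarrow> 'a"
  assumes self_adjoint: "self_adjoint D A"
begin

lemma subspace_D: "complex_vector.subspace D"
  using self_adjoint by (simp add: self_adjoint_def clinear_on_def)

lemma diff_D: "x \<in> D \<Longrightarrow> y \<in> D \<Longrightarrow> x - y \<in> D"
  and scale_D: "x \<in> D \<Longrightarrow> c *\<^sub>C x \<in> D"
  and zero_D: "0 \<in> D"
  using subspace_D
  by (auto intro: complex_vector.subspace_diff complex_vector.subspace_scale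
      complex_vector.subspace_0)

lemma add_A: "x \<in> D \<Longrightarrow> y \<in> D \<Longrightarrow> A (x + y) = A x + A y"
  and scale_A: "x \<in> D \<Longrightarrow> A (c *\<^sub>C x) = c *\<^sub>C A x"
  using self_adjoint by (auto simp: self_adjoint_def clinear_on_def)

lemma diff_A: "x \<in> D \<Longrightarrow> y \<in> D \<Longrightarrow> A (x - y) = A x - A y"
  using add_A[of "x - y" y] diff_D by (simp add: algebra_simps)

lemma dense_D: "closure D = UNIV"
  using self_adjoint by (simp add: self_adjoint_def)

text \<open>Self-adjointness as a regularity statement: an identity tested against the domain
  already places \<open>y\<close> in the domain.\<close>

lemma adjoint_eqD:
  assumes "\<And>x. x \<in> D \<Longrightarrow> cinner y (A x) = cinner z x"
  shows "y \<in> D" "A y = z"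
proof -
  have "y \<in> adj_domain D A"
    using assms by (auto simp: adj_domain_def)
  then show y: "y \<in> D"
    using self_adjoint by (simp add: self_adjoint_def)
  have "adj_op D A y = z"
    by (intro adj_op_eqI dense_D assms)
  then show "A y = z"
    using self_adjoint y by (simp add: self_adjoint_def)
qed

lemma symmetric:
  assumes "x \<in> D" "y \<in> D"
  shows "cinner x (A y) = cinner (A x) y"
proof -
  have "x \<in> adj_domain D A"
    using self_adjoint assms(1) by (simp add: self_adjoint_def)
  then obtain z where z: "\<And>y. y \<in> D \<Longrightarrow> cinner x (A y) = cinner z y"
    by (auto simp: adj_domain_def)
  then have "A x = z"
    by (rule adjoint_eqD(2))
  then show ?thesis
    using z assms(2) by simp
qed

text \<open>Testing against a fixed element of the domain moves \<open>A\<close> onto that element,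
  where the limit passes through the inner product; \<open>adjoint_eqD\<close> does the
  rest.\<close>

lemma closed_operator:
  assumes "\<And>n. x n \<in> D" "x \<longlonglongrightarrow> u" "(\<lambda>n. A (x n)) \<longlonglongrightarrow> v"
  shows "u \<in> D" "A u = v"
proof -
  have "cinner u (A d) = cinner v d" if "d \<in> D" for d
  proof (rule LIMSEQ_unique)
    show "(\<lambda>n. cinner (x n) (A d)) \<longlonglongrightarrow> cinner u (A d)"
      by (intro tendsto_cinner tendsto_const assms)
    have "(\<lambda>n. cinner (A (x n)) d) \<longlonglongrightarrow> cinner v d"
      by (intro tendsto_cinner tendsto_const assms)
    then show "(\<lambda>n. cinner (x n) (A d)) \<longlonglongrightarrow> cinner v d"
      by (simp add: symmetric assms(1) that)
  qed
  then show "u \<in> D" "A u = v"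
    by (auto intro: adjoint_eqD)
qed

text \<open>The lower bound gives injectivity and, since \<open>A\<close> is closed, a closed range.
  A vector orthogonal to the range is an eigenvector of the adjoint, which is \<open>A\<close>
  itself, for the value \<open>cnj z\<close>; this is what \<open>inj\<close> excludes.\<close>

lemma resolvent_setI:
  assumes bound: "\<And>x. x \<in> D \<Longrightarrow> norm x \<le> C * norm (A x - z *\<^sub>C x)"
    and inj: "\<And>x. x \<in> D \<Longrightarrow> A x = cnj z *\<^sub>C x \<Longrightarrow> x = 0"
  shows "z \<in> resolvent_set D A"
proof -
  define B where "B x = A x - z *\<^sub>C x" for x
  have diffB: "B (x - y) = B x - B y" if "x \<in> D" "y \<in> D" for x y
    using that by (simp add: B_def diff_A complex_vector.scale_right_diff_distrib)
  have bB: "norm x \<le> \<bar>C\<bar> * norm (B x)" if "x \<in> D" for x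
    using bound[OF that] mult_right_mono[OF abs_ge_self[of C] norm_ge_zero[of "B x"]]
    by (simp add: B_def)
  have inj_B: "inj_on B D"
  proof (rule inj_onI)
    fix x y assume "x \<in> D" "y \<in> D" "B x = B y"
    then have "norm (x - y) \<le> 0"
      using bB[OF diff_D, of x y] by (simp add: diffB)
    then show "x = y"
      by simp
  qed
  have sub: "complex_vector.subspace (B ` D)"
  proof (rule complex_vector.subspaceI)
    show "0 \<in> B ` D"
      using diffB[OF zero_D zero_D] zero_D by (auto simp: image_iff)
    show "p + q \<in> B ` D" if pq: "p \<in> B ` D" "q \<in> B ` D" for p q
    proof -
      obtain x y where "x \<in> D" "y \<in> D" "p = B x" "q = B y"
        using pq by blast
      then show ?thesis
        by (intro image_eqI[of _ _ "x + y"])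
           (auto simp: B_def add_A scaleC_add_right intro: complex_vector.subspace_add[OF subspace_D])
    qed
    show "c *\<^sub>C p \<in> B ` D" if "p \<in> B ` D" for c p
    proof -
      obtain x where "x \<in> D" "p = B x"
        using \<open>p \<in> B ` D\<close> by blast
      then show ?thesis
        by (intro image_eqI[of _ _ "c *\<^sub>C x"])
           (auto simp: B_def scale_A scaleC_scaleC mult.commute
             complex_vector.scale_right_diff_distrib intro: scale_D)
    qed
  qed
  have cl: "closed (B ` D)"
    unfolding closed_sequential_limits
  proof (intro allI impI, elim conjE)
    fix y l assume y: "\<forall>n. y n \<in> B ` D" "y \<longlonglongrightarrow> l"
    then obtain x where x: "\<And>n. x n \<in> D" "\<And>n. y n = B (x n)"
      unfolding image_iff by metis
    have "Cauchy x"
    proof (rule metric_CauchyI)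
      fix e :: real assume e: "0 < e"
      have "Cauchy y"
        using y(2) by (rule LIMSEQ_imp_Cauchy)
      moreover have "0 < e / (\<bar>C\<bar> + 1)"
        using e by (simp add: add_nonneg_pos)
      ultimately obtain N where N: "\<And>i j. i \<ge> N \<Longrightarrow> j \<ge> N \<Longrightarrow> dist (y i) (y j) < e / (\<bar>C\<bar> + 1)"
        unfolding Cauchy_def by blast
      have "dist (x i) (x j) < e" if "i \<ge> N" "j \<ge> N" for i j
      proof -
        have "norm (x i - x j) \<le> \<bar>C\<bar> * dist (y i) (y j)"
          using bB[OF diff_D[OF x(1) x(1)], of i j] by (simp add: diffB x dist_norm)
        also have "\<dots> \<le> \<bar>C\<bar> * (e / (\<bar>C\<bar> + 1))"
          using N[OF that] by (intro mult_left_mono) auto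
        also have "\<dots> < e"
          using e by (simp add: divide_less_eq add_nonneg_pos algebra_simps)
        finally show ?thesis
          by (simp add: dist_norm)
      qed
      then show "\<exists>N. \<forall>i\<ge>N. \<forall>j\<ge>N. dist (x i) (x j) < e"
        by blast
    qed
    then obtain u where u: "x \<longlonglongrightarrow> u"
      using Cauchy_convergent convergent_def by blast
    have "(\<lambda>n. y n + z *\<^sub>C x n) \<longlonglongrightarrow> l + z *\<^sub>C u"
      by (intro tendsto_add y tendsto_scaleC u)
    then have "(\<lambda>n. A (x n)) \<longlonglongrightarrow> l + z *\<^sub>C u"
      by (simp add: x B_def)
    from closed_operator[OF x(1) u this] have "u \<in> D" "l = B u"
      by (simp_all add: B_def)
    then show "l \<in> B ` D"
      by blast
  qed
  have "B ` D = UNIV"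
  proof (rule ccontr)
    assume "B ` D \<noteq> UNIV"
    then obtain w where w: "w \<noteq> 0" "\<forall>t\<in>B ` D. cinner t w = 0"
      by (rule proper_closed_subspace_orthogonal[OF sub cl])
    have "cinner w (A x) = cinner (cnj z *\<^sub>C w) x" if "x \<in> D" for x
    proof -
      have "cinner w (B x) = 0"
        using w(2) that cinner_commute[of w "B x"] by simp
      then show ?thesis
        by (simp add: B_def cinner_diff_right cinner_scaleC_right cinner_scaleC_left)
    qed
    then have "w \<in> D" "A w = cnj z *\<^sub>C w"
      by (auto intro: adjoint_eqD)
    then show False
      using inj w(1) by blast
  qed
  then have "bij_betw B D UNIV"
    using inj_B by (simp add: bij_betw_def)
  then show ?thesis
    using bound unfolding resolvent_set_def B_def by blast
qed

lemma eigenvalue_real: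
  assumes "x \<in> D" "A x = z *\<^sub>C x" "x \<noteq> 0"
  shows "cnj z = z"
proof -
  have "z * cinner x x = cnj z * cinner x x"
    using symmetric[OF assms(1) assms(1)] by (simp add: assms(2) cinner_scaleC_left cinner_scaleC_right)
  then show ?thesis
    using assms(3) by (simp add: cinner_self)
qed

text \<open>\<open>cinner x (A x)\<close> is real, so the imaginary part of
  \<open>cinner x (A x - z *\<^sub>C x)\<close> comes from \<open>z\<close> alone and bounds the
  residual below by \<open>\<bar>Im z\<bar> * norm x\<close>.\<close>

lemma nonreal_resolvent:
  assumes "Im z \<noteq> 0"
  shows "z \<in> resolvent_set D A"
proof (rule resolvent_setI)
  fix x assume x: "x \<in> D"
  have "cinner (A x) x = cnj (cinner (A x) x)"
    using symmetric[OF x x] cinner_commute[of "A x" x] by simp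
  then have "Im (cinner x (A x)) = 0"
    using symmetric[OF x x] by (metis cnj.simps(2) equal_neg_zero)
  then have "Im (cinner x (A x - z *\<^sub>C x)) = - Im z * (norm x)\<^sup>2"
    by (simp add: cinner_diff_right cinner_scaleC_right cinner_self del: of_real_power)
  then have "\<bar>Im z\<bar> * (norm x)\<^sup>2 \<le> cmod (cinner x (A x - z *\<^sub>C x))"
    using abs_Im_le_cmod[of "cinner x (A x - z *\<^sub>C x)"] by (simp add: abs_mult)
  also have "\<dots> \<le> norm x * norm (A x - z *\<^sub>C x)"
    by (rule cinner_Cauchy_Schwarz)
  finally have "norm x * (\<bar>Im z\<bar> * norm x) \<le> norm x * norm (A x - z *\<^sub>C x)"
    by (simp add: power2_eq_square mult.left_commute)
  then have "\<bar>Im z\<bar> * norm x \<le> norm (A x - z *\<^sub>C x)"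
    by (cases "x = 0") auto
  then show "norm x \<le> (1 / \<bar>Im z\<bar>) * norm (A x - z *\<^sub>C x)"
    using assms by (simp add: field_simps)
next
  fix x assume "x \<in> D" "A x = cnj z *\<^sub>C x"
  then show "x = 0"
    using eigenvalue_real[of x "cnj z"] assms by (auto simp: complex_eq_iff)
qed

lemma eigenvectors_orthogonal:
  assumes "x \<in> D" "A x = complex_of_real a *\<^sub>C x" "y \<in> D" "A y = complex_of_real b *\<^sub>C y" "a \<noteq> b"
  shows "cinner x y = 0"
proof -
  have "complex_of_real b * cinner x y = complex_of_real a * cinner x y"
    using symmetric[OF assms(1,3)] assms(2,4) by (simp add: cinner_scaleC_left cinner_scaleC_right)
  then show ?thesis
    using assms(5) by simp
qed

section \<open>Eigenvalues from a lower bound modulo a finite-dimensional map\<close>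

text \<open>
  The images under \<open>E\<close> have a convergent subsequence, and by the lower bound so do the vectors themselves.
\<close>

lemma approximate_eigenvectors_accumulate:
  fixes E :: "'a \<Rightarrow> 'b::{real_normed_vector, heine_borel}"
  assumes E_diff: "\<And>x y. x \<in> D \<Longrightarrow> y \<in> D \<Longrightarrow> E (x - y) = E x - E y"
    and E_bound: "\<And>x. x \<in> D \<Longrightarrow> norm (E x) \<le> K * (norm x + norm (A x - a *\<^sub>C x))"
    and below: "\<And>x. x \<in> D \<Longrightarrow> norm x \<le> C * (norm (A x - a *\<^sub>C x) + norm (E x))"
    and x: "\<And>n. x n \<in> D" "\<And>n. norm (x n) = 1" "(\<lambda>n. A (x n) - a *\<^sub>C x n) \<longlonglongrightarrow> 0"
  shows "\<exists>u\<in>D. \<exists>r::nat \<Rightarrow> nat. (x \<circ> r) \<longlonglongrightarrow> u \<and> norm u = 1 \<and> A u = a *\<^sub>C u"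
proof -
  define y where "y n = A (x n) - a *\<^sub>C x n" for n
  have y0: "y \<longlonglongrightarrow> 0"
    using x(3) by (simp add: y_def[abs_def])
  have "bounded (range y)"
    using y0 by (auto intro: convergent_imp_bounded)
  then obtain M where M: "\<And>n. norm (y n) \<le> M"
    by (auto simp: bounded_iff)
  have "norm (E (x n)) \<le> \<bar>K\<bar> * (1 + M)" for n
  proof -
    have "norm (E (x n)) \<le> K * (1 + norm (y n))"
      using E_bound[OF x(1)[of n]] x(2)[of n] by (simp add: y_def)
    also have "\<dots> \<le> \<bar>K\<bar> * (1 + norm (y n))"
      by (intro mult_right_mono) auto
    also have "\<dots> \<le> \<bar>K\<bar> * (1 + M)"
      using M[of n] by (intro mult_left_mono) auto
    finally show ?thesis .
  qed
  then have "bounded (range (\<lambda>n. E (x n)))"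
    by (auto simp: bounded_iff)
  then obtain l r where r: "strict_mono r" "((\<lambda>n. E (x n)) \<circ> r) \<longlonglongrightarrow> l"
    using bounded_imp_convergent_subsequence by blast
  have "Cauchy (y \<circ> r)" "Cauchy ((\<lambda>n. E (x n)) \<circ> r)"
    using LIMSEQ_imp_Cauchy[OF LIMSEQ_subseq_LIMSEQ[OF y0 r(1)]] LIMSEQ_imp_Cauchy[OF r(2)] by auto
  have "Cauchy (x \<circ> r)"
  proof (rule metric_CauchyI)
    fix e :: real assume e: "0 < e"
    \<comment> \<open>The denominator makes \<open>\<bar>C\<bar> * (\<epsilon> + \<epsilon>)\<close>
      smaller than \<open>e\<close>, also for \<open>C = 0\<close>.\<close>
    define \<epsilon> where "\<epsilon> = e / (2 * \<bar>C\<bar> + 1)"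
    have \<epsilon>: "\<epsilon> > 0"
      using e by (simp add: \<epsilon>_def add_nonneg_pos)
    obtain N1 where N1: "\<And>i j. i \<ge> N1 \<Longrightarrow> j \<ge> N1 \<Longrightarrow> dist (y (r i)) (y (r j)) < \<epsilon>"
      using \<open>Cauchy (y \<circ> r)\<close> \<epsilon> unfolding Cauchy_def by (metis comp_apply)
    obtain N2 where N2: "\<And>i j. i \<ge> N2 \<Longrightarrow> j \<ge> N2 \<Longrightarrow> dist (E (x (r i))) (E (x (r j))) < \<epsilon>"
      using \<open>Cauchy ((\<lambda>n. E (x n)) \<circ> r)\<close> \<epsilon> unfolding Cauchy_def by (metis comp_apply)
    have "dist (x (r i)) (x (r j)) < e" if "i \<ge> max N1 N2" "j \<ge> max N1 N2" for i j
    proof -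
      let ?d = "x (r i) - x (r j)"
      have d: "?d \<in> D" "E ?d = E (x (r i)) - E (x (r j))" "A ?d - a *\<^sub>C ?d = y (r i) - y (r j)"
        by (simp_all add: diff_D x E_diff diff_A y_def complex_vector.scale_right_diff_distrib)
      have "norm ?d \<le> C * (norm (y (r i) - y (r j)) + norm (E (x (r i)) - E (x (r j))))"
        using below[OF d(1)] by (simp only: d)
      also have "\<dots> \<le> \<bar>C\<bar> * (norm (y (r i) - y (r j)) + norm (E (x (r i)) - E (x (r j))))"
        by (intro mult_right_mono) auto
      also have "\<dots> \<le> \<bar>C\<bar> * (\<epsilon> + \<epsilon>)"
        using N1[of i j] N2[of i j] that by (intro mult_left_mono add_mono) (auto simp: dist_norm)
      also have "\<dots> < e"
        using e by (simp add: \<epsilon>_def divide_less_eq add_nonneg_pos algebra_simps)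
      finally show ?thesis
        by (simp add: dist_norm)
    qed
    then show "\<exists>N. \<forall>i\<ge>N. \<forall>j\<ge>N. dist ((x \<circ> r) i) ((x \<circ> r) j) < e"
      by (metis comp_apply)
  qed
  then obtain u where u: "(x \<circ> r) \<longlonglongrightarrow> u"
    using Cauchy_convergent convergent_def by blast
  have "(\<lambda>n. (y \<circ> r) n + a *\<^sub>C (x \<circ> r) n) \<longlonglongrightarrow> 0 + a *\<^sub>C u"
    by (intro tendsto_add tendsto_scaleC u LIMSEQ_subseq_LIMSEQ[OF y0 r(1)])
  then have "(\<lambda>n. A ((x \<circ> r) n)) \<longlonglongrightarrow> a *\<^sub>C u"
    by (simp add: y_def)
  from closed_operator[OF _ u this] have "u \<in> D" "A u = a *\<^sub>C u"
    by (simp_all add: x)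
  moreover have "norm u = 1"
    using tendsto_norm[OF u] x(2) by (simp add: LIMSEQ_const_iff)
  ultimately show ?thesis
    using u by blast
qed

text \<open>Suppose \<open>a\<close> is not an eigenvalue. If the plain lower bound failed, unit
  approximate eigenvectors would accumulate at an eigenvector; so the bound holds, and
  \<open>resolvent_setI\<close> puts \<open>a\<close> into the resolvent set.\<close>

lemma spectrum_imp_eigenvalue:
  fixes E :: "'a \<Rightarrow> 'b::{real_normed_vector, heine_borel}"
  assumes E_diff: "\<And>x y. x \<in> D \<Longrightarrow> y \<in> D \<Longrightarrow> E (x - y) = E x - E y"
    and E_bound: "\<And>x. x \<in> D \<Longrightarrow> norm (E x) \<le> K * (norm x + norm (A x - of_real a *\<^sub>C x))"
    and below: "\<And>x. x \<in> D \<Longrightarrow> norm x \<le> C * (norm (A x - of_real a *\<^sub>C x) + norm (E x))"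
    and "of_real a \<in> spectrum D A"
  obtains u where "u \<in> D" "norm u = 1" "A u = of_real a *\<^sub>C u"
proof -
  have "\<exists>u\<in>D. norm u = 1 \<and> A u = of_real a *\<^sub>C u"
  proof (rule ccontr)
    assume no: "\<not> ?thesis"
    have inj: "x = 0" if "x \<in> D" "A x = of_real a *\<^sub>C x" for x
    proof (rule ccontr)
      assume "x \<noteq> 0"
      let ?u = "of_real (inverse (norm x)) *\<^sub>C x"
      have "?u \<in> D" "norm ?u = 1" "A ?u = of_real a *\<^sub>C ?u"
        using that \<open>x \<noteq> 0\<close> by (simp_all add: scale_D norm_scaleC scale_A scaleC_scaleC norm_inverse mult.commute)
      then show False
        using no by blast
    qed
    have "\<exists>C. \<forall>x\<in>D. norm x \<le> C * norm (A x - of_real a *\<^sub>C x)"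
    proof (rule ccontr)
      assume "\<not> ?thesis"
      then have "\<exists>x\<in>D. norm x > real (Suc n) * norm (A x - of_real a *\<^sub>C x)" for n
        by (meson not_le)
      then obtain x where x: "\<And>n. x n \<in> D"
          "\<And>n. norm (x n) > real (Suc n) * norm (A (x n) - of_real a *\<^sub>C x n)"
        by metis
      have pos: "norm (x n) > 0" for n
        using x(2)[of n] by (meson le_less_trans mult_nonneg_nonneg norm_ge_zero of_nat_0_le_iff)
      \<comment> \<open>Violating the bound with constant \<open>Suc n\<close> leaves a normalised
        vector with residual at most \<open>inverse (Suc n)\<close>.\<close>
      define v where "v n = complex_of_real (inverse (norm (x n))) *\<^sub>C x n" for n
      have v: "v n \<in> D" "norm (v n) = 1" for n
        using pos[of n] by (simp_all add: v_def scale_D x norm_scaleC norm_inverse)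
      have Av: "A (v n) - of_real a *\<^sub>C v n
          = complex_of_real (inverse (norm (x n))) *\<^sub>C (A (x n) - of_real a *\<^sub>C x n)" for n
        by (simp add: v_def scale_A x scaleC_scaleC mult.commute complex_vector.scale_right_diff_distrib)
      have "norm (A (v n) - of_real a *\<^sub>C v n) \<le> inverse (real (Suc n))" for n
        using x(2)[of n] pos[of n]
        by (simp add: Av norm_scaleC norm_inverse del: of_real_inverse complex_vector.scale_right_diff_distrib)
          (simp add: field_simps)
      then have "(\<lambda>n. A (v n) - of_real a *\<^sub>C v n) \<longlonglongrightarrow> 0"
        by (intro Lim_null_comparison[OF _ LIMSEQ_inverse_real_of_nat] always_eventually allI)
      from approximate_eigenvectors_accumulate[OF E_diff E_bound below v this] no show False
        by blast
    qed
    then obtain C' where "\<And>x. x \<in> D \<Longrightarrow> norm x \<le> C' * norm (A x - of_real a *\<^sub>C x)"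
      by blast
    then have "of_real a \<in> resolvent_set D A"
      using inj by (intro resolvent_setI) auto
    then show False
      using assms(4) by (simp add: spectrum_def)
  qed
  then show thesis
    using that by blast
qed

text \<open>Spectral points accumulating at \<open>a\<close> are real and eventually within
  \<open>r\<close>, so \<open>eig\<close> supplies unit eigenvectors. They are approximate
  eigenvectors for \<open>a\<close>; the limit of a subsequence is an eigenvector for
  \<open>a\<close> orthogonal to all of them, hence to itself.\<close>

lemma spectrum_point_isolated:
  fixes E :: "'a \<Rightarrow> 'b::{real_normed_vector, heine_borel}"
  assumes E_diff: "\<And>x y. x \<in> D \<Longrightarrow> y \<in> D \<Longrightarrow> E (x - y) = E x - E y"
    and E_bound: "\<And>x. x \<in> D \<Longrightarrow> norm (E x) \<le> K * (norm x + norm (A x - of_real a *\<^sub>C x))"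
    and below: "\<And>x. x \<in> D \<Longrightarrow> norm x \<le> C * (norm (A x - of_real a *\<^sub>C x) + norm (E x))"
    and "of_real a \<in> spectrum D A"
    and "r > 0"
    and eig: "\<And>b. \<bar>b - a\<bar> < r \<Longrightarrow> of_real b \<in> spectrum D A
      \<Longrightarrow> \<exists>u\<in>D. norm u = 1 \<and> A u = of_real b *\<^sub>C u"
  shows "of_real a isolated_in spectrum D A"
proof (rule ccontr)
  assume "\<not> ?thesis"
  then have "complex_of_real a islimpt spectrum D A"
    using assms(4) by (simp add: isolated_in_islimpt_iff)
  then obtain z where z: "\<And>n::nat. z n \<in> spectrum D A - {of_real a}" "z \<longlonglongrightarrow> of_real a"
    unfolding islimpt_sequential by blast
  define b where "b n = Re (z n)" for n
  have b: "z n = of_real (b n)" for n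
    using nonreal_resolvent[of "z n"] z(1)[of n] by (auto simp: b_def spectrum_def complex_eq_iff)
  have lim: "b \<longlonglongrightarrow> a"
    using tendsto_Re[OF z(2)] by (simp add: b_def[abs_def])
  have "eventually (\<lambda>n. dist (b n) a < r) sequentially"
    using lim assms(5) by (rule tendstoD)
  then obtain N where N: "\<And>n. n \<ge> N \<Longrightarrow> \<bar>b n - a\<bar> < r"
    by (auto simp: eventually_sequentially dist_norm)
  define c where "c n = b (n + N)" for n
  have c: "c \<longlonglongrightarrow> a" "\<And>n. c n \<noteq> a"
    using LIMSEQ_ignore_initial_segment[OF lim, of N] z(1) by (auto simp: c_def[abs_def] b)
  have "\<exists>u\<in>D. norm u = 1 \<and> A u = of_real (c n) *\<^sub>C u" for n
    using z(1)[of "n + N"] N[of "n + N"] by (intro eig) (auto simp: c_def b)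
  then obtain u where u: "\<And>n. u n \<in> D" "\<And>n. norm (u n) = 1" "\<And>n. A (u n) = of_real (c n) *\<^sub>C u n"
    by metis
  have nrm: "norm (A (u n) - of_real a *\<^sub>C u n) = \<bar>c n - a\<bar>" for n
    by (simp add: u flip: complex_vector.scale_left_diff_distrib of_real_diff)
       (simp add: norm_scaleC u(2) del: of_real_diff flip: of_real_diff)
  have "(\<lambda>n. A (u n) - of_real a *\<^sub>C u n) \<longlonglongrightarrow> 0"
  proof (rule tendsto_norm_zero_cancel)
    show "(\<lambda>n. norm (A (u n) - of_real a *\<^sub>C u n)) \<longlonglongrightarrow> 0"
      unfolding nrm by (intro tendsto_rabs_zero LIM_zero c)
  qed
  from approximate_eigenvectors_accumulate[OF E_diff E_bound below u(1,2) this]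
  obtain v s where v: "(u \<circ> s) \<longlonglongrightarrow> v" "v \<in> D" "norm v = 1" "A v = of_real a *\<^sub>C v"
    by blast
  have "cinner ((u \<circ> s) n) v = 0" for n
    by (rule eigenvectors_orthogonal[where a = "c (s n)" and b = a]) (simp_all add: u v c)
  then have "cinner v v = 0"
    using tendsto_cinner[OF v(1) tendsto_const[of v]] by (simp add: LIMSEQ_const_iff)
  then show False
    using v(3) by (simp add: cinner_self)
qed

end


section \<open>Completeness of \<open>L2\<close>\<close>

lemma L2_cases:
  obtains f where "square_integrable f" "x = abs_L2 f"
  using Quotient3_rep_reflp[OF Quotient3_L2, of x] Quotient3_abs_rep[OF Quotient3_L2, of x]
  by (metis L2_rel_def)

lemma L2_rel_refl: "square_integrable f \<Longrightarrow> L2_rel f f"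
  by (simp add: L2_rel_def)

lemma abs_L2_eq_iff:
  assumes "square_integrable f" "square_integrable g"
  shows "abs_L2 f = abs_L2 g \<longleftrightarrow> (AE s in lborel. f s = g s)"
  using Quotient3_rel[OF Quotient3_L2, of f g] assms by (simp add: L2_rel_def)

lemma cinner_abs_L2:
  assumes "square_integrable f" "square_integrable g"
  shows "cinner (abs_L2 f) (abs_L2 g) = (LINT s|lborel. cnj (f s) * g s)"
  using assms by (intro cinner_L2.abs_eq L2_rel_refl)

lemma norm_abs_L2:
  assumes "square_integrable f"
  shows "(norm (abs_L2 f))\<^sup>2 = (LINT s|lborel. (cmod (f s))\<^sup>2)"
proof -
  have "cinner (abs_L2 f) (abs_L2 f) = (LINT s|lborel. complex_of_real ((cmod (f s))\<^sup>2))"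
    by (simp only: cinner_abs_L2[OF assms assms] complex_norm_square mult.commute)
  then have "complex_of_real ((norm (abs_L2 f))\<^sup>2) = complex_of_real (LINT s|lborel. (cmod (f s))\<^sup>2)"
    by (simp only: cinner_self integral_complex_of_real)
  then show ?thesis
    by (simp only: of_real_eq_iff)
qed

lemma plus_abs_L2:
  "square_integrable f \<Longrightarrow> square_integrable g \<Longrightarrow> abs_L2 f + abs_L2 g = abs_L2 (\<lambda>s. f s + g s)"
  by (intro plus_L2.abs_eq L2_rel_refl)

lemma scaleC_abs_L2:
  "square_integrable f \<Longrightarrow> c *\<^sub>C abs_L2 f = abs_L2 (\<lambda>s. c * f s)"
  by (intro scaleC_L2.abs_eq L2_rel_refl)

lemma square_integrable_diff:
  assumes "square_integrable f" "square_integrable g"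
  shows "square_integrable (\<lambda>s. f s - g s)"
  using square_integrable_add[OF assms(1) square_integrable_uminus[OF assms(2)]] by simp

lemma diff_abs_L2:
  assumes "square_integrable f" "square_integrable g"
  shows "abs_L2 f - abs_L2 g = abs_L2 (\<lambda>s. f s - g s)"
proof -
  have "- abs_L2 g = abs_L2 (\<lambda>s. - g s)"
    by (intro uminus_L2.abs_eq L2_rel_refl assms)
  then show ?thesis
    using plus_abs_L2[OF assms(1) square_integrable_uminus[OF assms(2)]]
    by (simp add: minus_L2_def)
qed

lemma integrable_cmod_mult:
  assumes "square_integrable f" "square_integrable g"
  shows "integrable lborel (\<lambda>s. cmod (f s) * cmod (g s))"
  using integrable_norm[OF integrable_cnj_mult[OF assms]] by (simp add: norm_mult)

lemma square_integrable_cmod: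
  assumes "square_integrable f"
  shows "square_integrable (\<lambda>s. complex_of_real (cmod (f s)))"
proof (rule square_integrable_bound[OF assms, where C = 1])
  note [measurable] = square_integrable_measurable[OF assms]
  show "(\<lambda>s. complex_of_real (cmod (f s))) \<in> borel_measurable lborel"
    by measurable
qed simp

lemma integral_cmod_mult_le:
  assumes "square_integrable f" "square_integrable g"
  shows "(LINT s|lborel. cmod (f s) * cmod (g s)) \<le> norm (abs_L2 f) * norm (abs_L2 g)"
proof -
  define F G where "F s = complex_of_real (cmod (f s))" and "G s = complex_of_real (cmod (g s))" for s
  have FG: "square_integrable F" "square_integrable G"
    unfolding F_def G_def by (intro square_integrable_cmod assms)+
  have "(norm (abs_L2 F))\<^sup>2 = (norm (abs_L2 f))\<^sup>2" "(norm (abs_L2 G))\<^sup>2 = (norm (abs_L2 g))\<^sup>2"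
    using assms by (simp_all only: norm_abs_L2 FG) (simp_all add: F_def G_def)
  then have nrm: "norm (abs_L2 F) = norm (abs_L2 f)" "norm (abs_L2 G) = norm (abs_L2 g)"
    by simp_all
  have "cinner (abs_L2 F) (abs_L2 G) = (LINT s|lborel. complex_of_real (cmod (f s) * cmod (g s)))"
    by (simp add: cinner_abs_L2 FG) (simp add: F_def G_def)
  also have "\<dots> = complex_of_real (LINT s|lborel. cmod (f s) * cmod (g s))"
    by (rule integral_complex_of_real)
  finally have "cmod (cinner (abs_L2 F) (abs_L2 G)) = \<bar>LINT s|lborel. cmod (f s) * cmod (g s)\<bar>"
    by (simp only: norm_of_real)
  then show ?thesis
    using cinner_Cauchy_Schwarz[of "abs_L2 F" "abs_L2 G"] by (simp add: nrm)
qed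

lemma has_bochner_integral_exp_neg_abs:
  fixes a :: real
  assumes "a > 0"
  shows "has_bochner_integral lborel (\<lambda>s. exp (- a * \<bar>s\<bar>)) (2 / a)"
proof -
  have half: "has_bochner_integral lborel (\<lambda>s. indicator {0..} s * exp (- a * s)) (1 / a)"
  proof -
    have hi: "((\<lambda>x. exp (- a * x)) has_integral 1 / a) {0..}"
      using has_integral_exp_minus_to_infinity[OF assms, of 0] by simp
    then have "(\<lambda>x. exp (- a * x)) absolutely_integrable_on {0..}"
      by (intro nonnegative_absolutely_integrable_1) auto
    then have "set_integrable lborel {0..} (\<lambda>x. exp (- a * x))"
      by (simp add: set_integrable_def integrable_completion)
    then show ?thesis
      using set_borel_integral_eq_integral(2)[of "{0..}" "\<lambda>x. exp (- a * x)"] integral_unique[OF hi]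
      by (simp add: has_bochner_integral_iff set_integrable_def set_lebesgue_integral_def)
  qed
  have "has_bochner_integral lborel (\<lambda>s. indicator {0..} (- s) * exp (a * s)) (1 / a)"
    using lborel_has_bochner_integral_real_affine_iff[of "- 1" "\<lambda>s. indicator {0..} s * exp (- a * s)" "1 / a" 0] half
    by simp
  from has_bochner_integral_add[OF half this]
  have *: "has_bochner_integral lborel
      (\<lambda>s. indicator {0..} s * exp (- a * s) + indicator {0..} (- s) * exp (a * s)) (2 / a)"
    by simp
  \<comment> \<open>Both half-line integrands equal \<open>1\<close> at the origin, so their sum is
    the desired function only off the null set \<open>{0}\<close>.\<close>
  have "AE s in lborel. s \<noteq> (0::real)"
    by (rule AE_lborel_singleton)
  then have "AE s in lborel. indicator {0..} s * exp (- a * s) + indicator {0..} (- s) * exp (a * s)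
     = exp (- a * \<bar>s\<bar>)"
    by eventually_elim (auto simp: indicator_def)
  then show ?thesis
    by (rule has_bochner_integral_cong_AE[THEN iffD1, rotated 2])
       (use * in \<open>auto simp: has_bochner_integral_iff\<close>)
qed

lemma square_integrable_exp_neg_abs:
  assumes "a > 0"
  shows "square_integrable (\<lambda>s. complex_of_real (exp (- a * \<bar>s\<bar>)))"
    and "(norm (abs_L2 (\<lambda>s. complex_of_real (exp (- a * \<bar>s\<bar>)))))\<^sup>2 = 1 / a"
proof -
  have eq: "(cmod (complex_of_real (exp (- a * \<bar>s\<bar>))))\<^sup>2 = exp (- (2 * a) * \<bar>s\<bar>)" for s
    by (simp add: exp_double[symmetric] algebra_simps del: exp_double)
  show *: "square_integrable (\<lambda>s. complex_of_real (exp (- a * \<bar>s\<bar>)))"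
    unfolding square_integrable_def eq
    using has_bochner_integral_exp_neg_abs[of "2 * a"] assms
    by (auto simp: has_bochner_integral_iff)
  show "(norm (abs_L2 (\<lambda>s. complex_of_real (exp (- a * \<bar>s\<bar>)))))\<^sup>2 = 1 / a"
    unfolding norm_abs_L2[OF *] eq
    using has_bochner_integral_exp_neg_abs[of "2 * a"] assms
    by (auto simp: has_bochner_integral_iff)
qed

text \<open>
  Multiplication by the positive square-integrable weight \<open>w\<close> maps \<open>L2\<close> into \<open>L1\<close>, where an almost
  everywhere convergent subsequence can be extracted; Fatou's lemma then gives convergence in \<open>L2\<close>.
\<close>

instance L2 :: complete_space
proof
  fix X :: "nat \<Rightarrow> L2" assume X: "Cauchy X"
  have "\<exists>f. square_integrable f \<and> X n = abs_L2 f" for n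
    by (metis L2_cases)
  then obtain f where f: "\<And>n. square_integrable (f n)" "\<And>n. X n = abs_L2 (f n)"
    by metis
  note [measurable] = square_integrable_measurable[OF f(1)]
  have fd: "square_integrable (\<lambda>s. f i s - f j s)" for i j
    by (intro square_integrable_diff f)
  have dist: "dist (X i) (X j) = norm (abs_L2 (\<lambda>s. f i s - f j s))" for i j
    by (simp add: dist_norm f diff_abs_L2)
  define w where "w s = complex_of_real (exp (- 1 * \<bar>s\<bar>))" for s :: real
  have w: "square_integrable w"
    unfolding w_def[abs_def] by (rule square_integrable_exp_neg_abs) simp
  have [measurable]: "w \<in> borel_measurable lborel"
    by (rule square_integrable_measurable[OF w])
  have w0: "cmod (w s) > 0" for s
    by (simp add: w_def)
  define g where "g n s = w s * f n s" for n s
  have int_g: "integrable lborel (g n)" for n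
  proof -
    have "(\<lambda>s. cnj (w s) * f n s) = g n"
      by (auto simp: g_def w_def)
    then show ?thesis
      using integrable_cnj_mult[OF w f(1)[of n]] by simp
  qed
  have "\<exists>N. \<forall>i\<ge>N. \<forall>j\<ge>N. (LINT s|lborel. norm (g i s - g j s)) < e" if e: "e > 0" for e
  proof -
    have pos: "0 < e / (norm (abs_L2 w) + 1)"
      using e by (intro divide_pos_pos) (simp_all add: add_nonneg_pos)
    obtain N where N: "\<And>i j. i \<ge> N \<Longrightarrow> j \<ge> N \<Longrightarrow> dist (X i) (X j) < e / (norm (abs_L2 w) + 1)"
      using X pos unfolding Cauchy_def by blast
    have "(LINT s|lborel. norm (g i s - g j s)) < e" if "i \<ge> N" "j \<ge> N" for i j
    proof -
      have "(LINT s|lborel. norm (g i s - g j s))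
          = (LINT s|lborel. cmod (w s) * cmod (f i s - f j s))"
        by (simp add: g_def norm_mult flip: right_diff_distrib)
      also have "\<dots> \<le> norm (abs_L2 w) * dist (X i) (X j)"
        unfolding dist by (rule integral_cmod_mult_le[OF w fd])
      also have "\<dots> \<le> norm (abs_L2 w) * (e / (norm (abs_L2 w) + 1))"
        using N[OF that] by (intro mult_left_mono) auto
      also have "\<dots> < e"
        using e add_nonneg_pos[OF norm_ge_zero[of "abs_L2 w"] zero_less_one]
        by (simp add: pos_divide_less_eq distrib_left mult.commute)
      finally show ?thesis .
    qed
    then show ?thesis
      by blast
  qed
  then obtain r :: "nat \<Rightarrow> nat" where r: "strict_mono r" "AE s in lborel. Cauchy (\<lambda>i. g (r i) s)"
    by (rule cauchy_L1_AE_cauchy_subseq[OF int_g])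
  \<comment> \<open>\<open>lim\<close> is arbitrary at points of divergence, which are negligible by
    \<open>r(2)\<close>.\<close>
  define F where "F s = lim (\<lambda>i. f (r i) s)" for s
  have [measurable]: "F \<in> borel_measurable lborel"
    unfolding F_def[abs_def] by (rule borel_measurable_lim_metric) simp
  have lim: "AE s in lborel. (\<lambda>i. f (r i) s) \<longlonglongrightarrow> F s"
    using r(2)
  proof eventually_elim
    case (elim s)
    then obtain l where "(\<lambda>i. g (r i) s) \<longlonglongrightarrow> l"
      using Cauchy_convergent convergent_def by blast
    then have "(\<lambda>i. g (r i) s / w s) \<longlonglongrightarrow> l / w s"
      using w0[of s] by (intro tendsto_divide) auto
    moreover have "g (r i) s / w s = f (r i) s" for i
      using w0[of s] by (simp add: g_def)
    ultimately have "convergent (\<lambda>i. f (r i) s)"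
      by (auto simp: convergent_def)
    then show ?case
      by (simp add: F_def convergent_LIMSEQ_iff)
  qed
  \<comment> \<open>Fatou's lemma is applied in \<open>i\<close> with \<open>j\<close> fixed. The
    strict bound becomes a weak one in the limit, hence the \<open>e / 2\<close> in the convergence
    proof below.\<close>
  have tail: "square_integrable (\<lambda>s. F s - f j s) \<and> norm (abs_L2 (\<lambda>s. F s - f j s)) \<le> e"
    if e: "e > 0" and N: "\<And>i j. i \<ge> N \<Longrightarrow> j \<ge> N \<Longrightarrow> dist (X i) (X j) < e" and j: "j \<ge> N" for e N j
  proof -
    have "(\<integral>\<^sup>+ s. ennreal ((cmod (F s - f j s))\<^sup>2) \<partial>lborel)
        = (\<integral>\<^sup>+ s. liminf (\<lambda>i. ennreal ((cmod (f (r i) s - f j s))\<^sup>2)) \<partial>lborel)"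
    proof (rule nn_integral_cong_AE)
      show "AE s in lborel. ennreal ((cmod (F s - f j s))\<^sup>2)
          = liminf (\<lambda>i. ennreal ((cmod (f (r i) s - f j s))\<^sup>2))"
        using lim
      proof eventually_elim
        case (elim s)
        have "(\<lambda>i. ennreal ((cmod (f (r i) s - f j s))\<^sup>2)) \<longlonglongrightarrow> ennreal ((cmod (F s - f j s))\<^sup>2)"
          by (intro tendsto_ennrealI tendsto_intros elim)
        then show ?case
          by (rule lim_imp_Liminf[OF trivial_limit_sequentially, symmetric])
      qed
    qed
    also have "\<dots> \<le> liminf (\<lambda>i. \<integral>\<^sup>+ s. ennreal ((cmod (f (r i) s - f j s))\<^sup>2) \<partial>lborel)"
      by (rule nn_integral_liminf) simp
    also have "\<dots> \<le> ennreal (e\<^sup>2)"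
    proof (rule Liminf_le)
      show "\<forall>\<^sub>F i in sequentially. (\<integral>\<^sup>+ s. ennreal ((cmod (f (r i) s - f j s))\<^sup>2) \<partial>lborel) \<le> ennreal (e\<^sup>2)"
      proof (rule eventually_sequentiallyI[of N])
        fix i assume "i \<ge> N"
        then have ri: "r i \<ge> N"
          using seq_suble[OF r(1), of i] by simp
        have "(\<integral>\<^sup>+ s. ennreal ((cmod (f (r i) s - f j s))\<^sup>2) \<partial>lborel)
            = ennreal (LINT s|lborel. (cmod (f (r i) s - f j s))\<^sup>2)"
          using fd[of "r i" j] by (intro nn_integral_eq_integral) (auto simp: square_integrable_def)
        also have "\<dots> = ennreal ((dist (X (r i)) (X j))\<^sup>2)"
          by (simp add: dist norm_abs_L2[OF fd])
        also have "\<dots> \<le> ennreal (e\<^sup>2)"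
          using N[OF ri j] by (intro ennreal_leI power_mono) auto
        finally show "(\<integral>\<^sup>+ s. ennreal ((cmod (f (r i) s - f j s))\<^sup>2) \<partial>lborel) \<le> ennreal (e\<^sup>2)" .
      qed
    qed simp
    finally have le: "(\<integral>\<^sup>+ s. ennreal ((cmod (F s - f j s))\<^sup>2) \<partial>lborel) \<le> ennreal (e\<^sup>2)" .
    have int: "integrable lborel (\<lambda>s. (cmod (F s - f j s))\<^sup>2)"
      using le by (intro integrableI_nonneg) (auto intro: le_less_trans)
    then have sq: "square_integrable (\<lambda>s. F s - f j s)"
      by (simp add: square_integrable_def)
    have "ennreal ((norm (abs_L2 (\<lambda>s. F s - f j s)))\<^sup>2) \<le> ennreal (e\<^sup>2)"
      using le int by (simp add: norm_abs_L2[OF sq] nn_integral_eq_integral)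
    then have "(norm (abs_L2 (\<lambda>s. F s - f j s)))\<^sup>2 \<le> e\<^sup>2"
      by (simp add: ennreal_le_iff)
    then show ?thesis
      using e sq by (auto intro: power2_le_imp_le)
  qed
  have "\<exists>N. \<forall>i\<ge>N. \<forall>j\<ge>N. dist (X i) (X j) < e" if "e > 0" for e
    using X that unfolding Cauchy_def by blast
  then obtain N where N: "\<And>e i j. e > 0 \<Longrightarrow> i \<ge> N e \<Longrightarrow> j \<ge> N e \<Longrightarrow> dist (X i) (X j) < e"
    by metis
  have "square_integrable (\<lambda>s. (F s - f (N 1) s) + f (N 1) s)"
    using tail[of 1 "N 1" "N 1"] N[of 1] by (intro square_integrable_add f) auto
  then have F: "square_integrable F"
    by simp
  have "X \<longlonglongrightarrow> abs_L2 F"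
  proof (rule metric_LIMSEQ_I)
    fix e :: real assume e: "e > 0"
    have "dist (X j) (abs_L2 F) < e" if "j \<ge> N (e / 2)" for j
    proof -
      have "norm (abs_L2 (\<lambda>s. F s - f j s)) \<le> e / 2"
        using tail[of "e / 2" "N (e / 2)" j] N[of "e / 2"] e that by auto
      then show ?thesis
        using e unfolding dist_norm norm_minus_commute[of "X j"] by (simp add: f diff_abs_L2 F)
    qed
    then show "\<exists>N. \<forall>n\<ge>N. dist (X n) (abs_L2 F) < e"
      by blast
  qed
  then show "convergent X"
    by (auto simp: convergent_def)
qed


section \<open>Test functions\<close>

text \<open>Recursion through the derivative makes closure under sums, products and affine
  substitution an induction over \<open>n\<close> with arbitrary functions;
  \<open>test_function_iff\<close> links it to the iterated derivatives in
  \<open>test_function\<close>.\<close>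

primrec smooth_upto :: "nat \<Rightarrow> (real \<Rightarrow> real) \<Rightarrow> bool" where
  "smooth_upto 0 f \<longleftrightarrow> True"
| "smooth_upto (Suc n) f \<longleftrightarrow> (\<forall>x. f field_differentiable at x) \<and> smooth_upto n (deriv f)"

lemma smooth_upto_Suc_deriv:
  assumes "\<And>x. (f has_field_derivative f' x) (at x)" "smooth_upto n f'"
  shows "smooth_upto (Suc n) f"
proof -
  have "deriv f = f'"
    using assms(1) by (auto intro: DERIV_imp_deriv)
  then show ?thesis
    using assms by (auto simp: field_differentiable_def)
qed

lemma smooth_upto_SucD:
  assumes "smooth_upto (Suc n) f"
  shows "(f has_field_derivative deriv f x) (at x)" "smooth_upto n (deriv f)"
  using assms by (auto simp: field_differentiable_derivI)

lemma smooth_upto_mono: "smooth_upto (Suc n) f \<Longrightarrow> smooth_upto n f"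
  by (induction n arbitrary: f) auto

lemma smooth_upto_const: "smooth_upto n (\<lambda>_. c)"
proof (induction n arbitrary: c)
  case (Suc n)
  show ?case
    by (rule smooth_upto_Suc_deriv[where f' = "\<lambda>_. 0"]) (simp_all add: Suc)
qed simp

lemma smooth_upto_add:
  "smooth_upto n f \<Longrightarrow> smooth_upto n g \<Longrightarrow> smooth_upto n (\<lambda>x. f x + g x)"
proof (induction n arbitrary: f g)
  case (Suc n)
  note f = smooth_upto_SucD[OF Suc.prems(1)] and g = smooth_upto_SucD[OF Suc.prems(2)]
  show ?case
    by (rule smooth_upto_Suc_deriv[where f' = "\<lambda>x. deriv f x + deriv g x"])
       (use f g Suc.IH in \<open>auto intro!: derivative_eq_intros\<close>)
qed simp

lemma smooth_upto_mult:
  "smooth_upto n f \<Longrightarrow> smooth_upto n g \<Longrightarrow> smooth_upto n (\<lambda>x. f x * g x)"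
proof (induction n arbitrary: f g)
  case (Suc n)
  note f = smooth_upto_SucD[OF Suc.prems(1)] and g = smooth_upto_SucD[OF Suc.prems(2)]
  note f0 = smooth_upto_mono[OF Suc.prems(1)] and g0 = smooth_upto_mono[OF Suc.prems(2)]
  have "smooth_upto n (\<lambda>x. deriv f x * g x + f x * deriv g x)"
    by (intro smooth_upto_add Suc.IH f g f0 g0)
  then show ?case
    by (rule smooth_upto_Suc_deriv[rotated])
       (use f g in \<open>auto intro!: derivative_eq_intros\<close>)
qed simp

lemma smooth_upto_affine:
  "smooth_upto n f \<Longrightarrow> smooth_upto n (\<lambda>x. f (a * x + b))"
proof (induction n arbitrary: f)
  case (Suc n)
  note f = smooth_upto_SucD[OF Suc.prems(1)]
  have "smooth_upto n (\<lambda>x. a * deriv f (a * x + b))"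
    by (intro smooth_upto_mult smooth_upto_const Suc.IH f)
  moreover have "((\<lambda>x. f (a * x + b)) has_field_derivative a * deriv f (a * x + b)) (at x)" for x
    by (rule DERIV_chain'[of "\<lambda>x. a * x + b" a, THEN DERIV_cong])
       (auto intro!: derivative_eq_intros f simp: mult.commute)
  ultimately show ?case
    by (rule smooth_upto_Suc_deriv[rotated])
qed simp

lemma test_function_iff:
  "test_function \<psi> \<longleftrightarrow> (\<forall>n. smooth_upto n \<psi>) \<and> (\<exists>R. \<forall>s. \<bar>s\<bar> > R \<longrightarrow> \<psi> s = 0)"
proof -
  have "smooth_upto n \<psi> \<longleftrightarrow> (\<forall>k<n. \<forall>s. (deriv ^^ k) \<psi> field_differentiable at s)" for n
  proof (induction n arbitrary: \<psi>)
    case (Suc n)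
    have "(\<forall>k<Suc n. \<forall>s. (deriv ^^ k) \<psi> field_differentiable at s) \<longleftrightarrow>
        (\<forall>s. \<psi> field_differentiable at s) \<and>
        (\<forall>k<n. \<forall>s. (deriv ^^ k) (deriv \<psi>) field_differentiable at s)"
      by (auto simp: less_Suc_eq_0_disj funpow_Suc_right simp del: funpow.simps)
    with Suc show ?case
      by simp
  qed simp
  then have 1: "(\<forall>n. smooth_upto n \<psi>) \<longleftrightarrow> (\<forall>k s. (deriv ^^ k) \<psi> field_differentiable at s)"
    by (metis lessI)
  have 2: "compact (closure {s. \<psi> s \<noteq> 0}) \<longleftrightarrow> (\<exists>R. \<forall>s. \<bar>s\<bar> > R \<longrightarrow> \<psi> s = 0)"
    unfolding compact_closure bounded_iff by (auto simp: not_less[symmetric])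
  show ?thesis
    unfolding test_function_def 1 2 ..
qed

lemma test_functionD:
  assumes "test_function \<psi>"
  shows "(\<psi> has_field_derivative deriv \<psi> x) (at x)" "test_function (deriv \<psi>)"
    "continuous_on UNIV \<psi>" "bounded (range \<psi>)"
    "\<psi> \<in> borel_measurable borel" "integrable lborel \<psi>"
proof -
  have s: "smooth_upto n \<psi>" for n
    using assms by (simp add: test_function_iff)
  show d: "(\<psi> has_field_derivative deriv \<psi> x) (at x)" for x
    using smooth_upto_SucD(1)[OF s] .
  obtain R where R: "\<And>s. \<bar>s\<bar> > R \<Longrightarrow> \<psi> s = 0"
    using assms by (auto simp: test_function_iff)
  have "deriv \<psi> s = 0" if "\<bar>s\<bar> > R" for s
  proof (rule DERIV_imp_deriv)
    have "open {s. \<bar>s\<bar> > R}"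
      by (intro open_Collect_less continuous_intros)
    then have "\<forall>\<^sub>F t in nhds s. \<bar>t\<bar> > R"
      using that by (auto simp: eventually_nhds)
    then have "\<forall>\<^sub>F t in nhds s. \<psi> t = 0"
      by eventually_elim (rule R)
    then show "(\<psi> has_field_derivative 0) (at s)"
      by (subst DERIV_cong_ev[OF refl _ refl, of _ "\<lambda>_. 0"]) auto
  qed
  then show "test_function (deriv \<psi>)"
    using s[of "Suc _"] by (auto simp: test_function_iff)
  show c: "continuous_on UNIV \<psi>"
    using d by (intro continuous_at_imp_continuous_on) (auto intro: DERIV_isCont)
  then show m: "\<psi> \<in> borel_measurable borel"
    by (rule borel_measurable_continuous_onI)
  have "bounded (\<psi> ` {-R..R})"
    using c by (intro compact_imp_bounded compact_continuous_image continuous_on_subset[OF c]) auto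
  then obtain B where B: "\<And>s. s \<in> {-R..R} \<Longrightarrow> \<bar>\<psi> s\<bar> \<le> B"
    unfolding bounded_iff real_norm_def by blast
  have "\<bar>\<psi> s\<bar> \<le> \<bar>B\<bar>" for s
  proof (cases "\<bar>s\<bar> > R")
    case False
    then show ?thesis
      using B[of s] by (intro order_trans[OF B abs_ge_self]) auto
  qed (simp add: R)
  then show "bounded (range \<psi>)"
    by (auto simp: bounded_iff)
  have "integrable lborel (\<lambda>s. indicator {-R..R} s *\<^sub>R \<psi> s)"
    using borel_integrable_compact[OF compact_Icc continuous_on_subset[OF c]] by simp
  also have "(\<lambda>s. indicator {-R..R} s *\<^sub>R \<psi> s) = \<psi>"
    using R by (force simp: indicator_def fun_eq_iff)
  finally show "integrable lborel \<psi>" .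
qed

lemma test_function_mult:
  assumes "test_function \<psi>" "\<And>n. smooth_upto n \<eta>"
  shows "test_function (\<lambda>s. \<eta> s * \<psi> s)"
  using assms by (auto simp: test_function_iff intro!: smooth_upto_mult)

lemma test_function_scale: "test_function \<psi> \<Longrightarrow> test_function (\<lambda>s. c * \<psi> s)"
  by (rule test_function_mult) (auto intro: smooth_upto_const)

lemma test_function_add:
  assumes "test_function \<psi>" "test_function \<eta>"
  shows "test_function (\<lambda>s. \<psi> s + \<eta> s)"
proof -
  obtain R R' where "\<And>s. \<bar>s\<bar> > R \<Longrightarrow> \<psi> s = 0" "\<And>s. \<bar>s\<bar> > R' \<Longrightarrow> \<eta> s = 0"
    using assms by (auto simp: test_function_iff)
  then have "\<psi> s + \<eta> s = 0" if "\<bar>s\<bar> > max R R'" for s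
    using that by auto
  then show ?thesis
    using assms unfolding test_function_iff by (blast intro: smooth_upto_add)
qed

section \<open>Smooth bump functions\<close>

text \<open>The classical smooth function that is not analytic at \<open>0\<close>. Products of two
  copies facing each other have compact support.\<close>

definition flat :: "real \<Rightarrow> real" where
  "flat x = (if x > 0 then exp (- (1 / x)) else 0)"

lemma poly_times_exp_neg_tendsto_0:
  fixes p :: "real poly"
  shows "((\<lambda>y. poly p y * exp (- y)) \<longlongrightarrow> 0) at_top"
proof -
  have "((\<lambda>y::real. \<Sum>i\<le>degree p. coeff p i * (y ^ i / exp y)) \<longlongrightarrow> (\<Sum>i\<le>degree p. coeff p i * 0)) at_top"
    by (intro tendsto_intros tendsto_power_div_exp_0)
  then show ?thesis
    by (simp add: poly_altdef exp_minus sum_distrib_right divide_inverse mult.assoc)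
qed

text \<open>For \<open>x > 0\<close> the derivative of \<open>p(1/x) exp(-1/x)\<close> is
  \<open>(1/x)^2 (p - p')(1/x) exp(-1/x)\<close>, so these functions form a class closed under
  differentiation; smoothness of \<open>flat\<close> follows by induction over all \<open>p\<close>
  at once.\<close>

lemma has_derivative_poly_flat:
  fixes p :: "real poly"
  defines "f q \<equiv> \<lambda>x::real. poly q (1 / x) * flat x"
  shows "(f p has_field_derivative f ([:0, 0, 1:] * (p - pderiv p)) x) (at x)"
proof -
  consider "x > 0" | "x < 0" | "x = 0"
    by linarith
  then show ?thesis
  proof cases
    case 1
    have "((\<lambda>x. poly p (1 / x) * exp (- (1 / x))) has_field_derivative
        f ([:0, 0, 1:] * (p - pderiv p)) x) (at x)"
      using 1 by (auto intro!: derivative_eq_intros DERIV_chain2[OF poly_DERIV]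
          simp: f_def flat_def field_simps power2_eq_square)
    moreover have "\<forall>\<^sub>F y in nhds x. f p y = poly p (1 / y) * exp (- (1 / y))"
      using 1 eventually_nhds_in_open[of "{0<..}" x]
      by (auto simp: f_def flat_def elim!: eventually_mono)
    ultimately show ?thesis
      by (subst DERIV_cong_ev[OF refl _ refl]) auto
  next
    case 2
    have "\<forall>\<^sub>F y in nhds x. f p y = 0"
      using 2 eventually_nhds_in_open[of "{..<0}" x]
      by (auto simp: f_def flat_def elim!: eventually_mono)
    then show ?thesis
      using 2 by (subst DERIV_cong_ev[OF refl _ refl, of _ "\<lambda>_. 0"]) (auto simp: f_def flat_def)
  next
    case 3
    have "((\<lambda>y. f p y / y) \<longlongrightarrow> 0) (at 0)"
      unfolding filterlim_split_at_real filterlim_def[symmetric]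
    proof (rule filterlim_split_at)
      have "\<forall>\<^sub>F y in at_left 0. f p y / y = 0"
        by (auto simp: f_def flat_def eventually_at_left_real eventually_at_filter)
      then show "((\<lambda>y. f p y / y) \<longlongrightarrow> 0) (at_left 0)"
        by (simp add: tendsto_eventually)
      \<comment> \<open>In the variable \<open>inverse y\<close> the difference quotient at
        \<open>0\<close> is a polynomial times a decaying exponential; the factor
        \<open>[:0, 1:]\<close> is the division by \<open>y\<close>.\<close>
      have "((\<lambda>y. poly ([:0, 1:] * p) (inverse y) * exp (- inverse y)) \<longlongrightarrow> 0) (at_right 0)"
        by (rule filterlim_compose[OF poly_times_exp_neg_tendsto_0 filterlim_inverse_at_top_right])
      moreover have "\<forall>\<^sub>F y in at_right 0.
          poly ([:0, 1:] * p) (inverse y) * exp (- inverse y) = f p y / y"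
        by (auto simp: f_def flat_def eventually_at_filter field_simps)
      ultimately show "((\<lambda>y. f p y / y) \<longlongrightarrow> 0) (at_right 0)"
        by (rule Lim_transform_eventually)
    qed
    then show ?thesis
      by (simp add: 3 has_field_derivative_iff f_def flat_def)
  qed
qed

lemma smooth_flat: "smooth_upto n flat"
proof -
  have "smooth_upto n (\<lambda>x. poly p (1 / x) * flat x)" for p
  proof (induction n arbitrary: p)
    case (Suc n)
    show ?case
      by (rule smooth_upto_Suc_deriv[OF has_derivative_poly_flat Suc])
  qed simp
  from this[of 1] show ?thesis
    by simp
qed

lemma flat_bounds: "0 \<le> flat x" "flat x \<le> 1"
  by (auto simp: flat_def)

text \<open>\<open>k\<close> is a steepness: for growing \<open>k\<close> these functions tend to
  the indicator of \<open>{a<..<b}\<close>, which \<open>fundamental_lemma\<close> exploits.\<close>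

lemma test_function_bump: "test_function (\<lambda>s. flat (k * (s - a)) * flat (k * (b - s)))"
  if "k > 0" for k a b :: real
proof -
  have "flat (k * (s - a)) * flat (k * (b - s)) = 0" if "\<bar>s\<bar> > \<bar>a\<bar> + \<bar>b\<bar>" for s
  proof -
    have "s < a \<or> s > b"
      using that by linarith
    then show ?thesis
      using \<open>k > 0\<close> by (auto simp: flat_def mult_less_0_iff zero_less_mult_iff)
  qed
  moreover have "smooth_upto n (\<lambda>s. flat (k * s + - (k * a)) * flat (- k * s + k * b))" for n
    by (intro smooth_upto_mult smooth_upto_affine smooth_flat)
  then have "smooth_upto n (\<lambda>s. flat (k * (s - a)) * flat (k * (b - s)))" for n
    by (simp add: algebra_simps)
  ultimately show ?thesis
    by (auto simp: test_function_iff)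
qed

lemma flat_tendsto_1:
  assumes "x > 0"
  shows "(\<lambda>n. flat (real (Suc n) * x)) \<longlonglongrightarrow> 1"
proof -
  have "(\<lambda>n. exp (- (inverse (real (Suc n)) * (1 / x)))) \<longlonglongrightarrow> exp (- (0 * (1 / x)))"
    by (intro tendsto_intros LIMSEQ_inverse_real_of_nat)
  moreover have "flat (real (Suc n) * x) = exp (- (inverse (real (Suc n)) * (1 / x)))" for n
    using assms by (simp add: flat_def divide_inverse del: of_nat_Suc)
  ultimately show ?thesis
    by simp
qed


section \<open>The fundamental lemma of the calculus of variations\<close>

definition locally_integrable :: "(real \<Rightarrow> complex) \<Rightarrow> bool" where
  "locally_integrable k \<longleftrightarrow> k \<in> borel_measurable borel \<and> (\<forall>a b. set_integrable lborel {a..b} k)"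

lemma locally_integrable_bounded_mult:
  fixes \<psi> :: "real \<Rightarrow> real"
  assumes "locally_integrable k" "\<psi> \<in> borel_measurable borel" "\<And>s. \<bar>\<psi> s\<bar> \<le> B"
    "\<And>s. s \<notin> {a..b} \<Longrightarrow> \<psi> s = 0"
  shows "integrable lborel (\<lambda>s. k s * complex_of_real (\<psi> s))"
proof (rule Bochner_Integration.integrable_bound)
  show "integrable lborel (\<lambda>s. B * cmod (indicator {a..b} s *\<^sub>R k s))"
    using assms(1) by (intro integrable_mult_right integrable_norm)
      (simp add: locally_integrable_def set_integrable_def)
  show "(\<lambda>s. k s * complex_of_real (\<psi> s)) \<in> borel_measurable lborel"
    using assms(1,2) by (auto simp: locally_integrable_def)
  have "cmod (k s) * \<bar>\<psi> s\<bar> \<le> \<bar>B * cmod (indicator {a..b} s *\<^sub>R k s)\<bar>" for s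
  proof (cases "s \<in> {a..b}")
    case True
    have "cmod (k s) * \<bar>\<psi> s\<bar> \<le> cmod (k s) * \<bar>B\<bar>"
      using assms(3)[of s] by (intro mult_left_mono) auto
    with True show ?thesis
      by (simp add: abs_mult mult.commute)
  qed (simp add: assms(4))
  then show "AE s in lborel. norm (k s * complex_of_real (\<psi> s))
      \<le> norm (B * cmod (indicator {a..b} s *\<^sub>R k s))"
    by (simp add: norm_mult)
qed

lemma locally_integrable_test_mult:
  assumes "locally_integrable k" "test_function \<psi>"
  shows "integrable lborel (\<lambda>s. k s * complex_of_real (\<psi> s))"
proof -
  obtain B where "\<And>s. \<bar>\<psi> s\<bar> \<le> B"
    using test_functionD(4)[OF assms(2)] by (auto simp: bounded_iff)
  moreover obtain R where "\<And>s. \<bar>s\<bar> > R \<Longrightarrow> \<psi> s = 0"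
    using assms(2) by (auto simp: test_function_iff)
  ultimately show ?thesis
    by (intro locally_integrable_bounded_mult[where B = B and a = "- R" and b = R] assms test_functionD)
       auto
qed

text \<open>The sets over which \<open>f\<close> integrates to \<open>0\<close> form a Dynkin system
  containing the open intervals, and these are stable under intersection and generate the Borel
  sets.\<close>

lemma AE_zero_if_integral_intervals_zero:
  fixes f :: "real \<Rightarrow> complex"
  assumes f: "integrable lborel f" and zero: "\<And>a b. a < b \<Longrightarrow> (LINT s:{a<..<b}|lborel. f s) = 0"
  shows "AE s in lborel. f s = 0"
proof (rule sigma_finite_measure.density_zero[OF sigma_finite_lborel f])
  fix A :: "real set" assume "A \<in> sets lborel"
  have sint: "set_integrable lborel A f" if "A \<in> sets lborel" for A
    using f that by (simp add: set_integrable_def integrable_mult_indicator)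
  have borel_eq: "sets borel = sigma_sets UNIV (range (\<lambda>(a, b). {a<..<b::real}))"
    unfolding borel_eq_box box_real[abs_def] by simp
  \<comment> \<open>Complements in the Dynkin argument need the full line, which is exhausted by
    bounded intervals.\<close>
  have whole: "(LINT s:UNIV|lborel. f s) = 0"
  proof -
    have "(\<lambda>n. LINT s:{- real n<..<real n}|lborel. f s) \<longlonglongrightarrow> (LINT s:(\<Union>n. {- real n<..<real n})|lborel. f s)"
      by (intro set_integral_cont_up sint) (auto simp: incseq_def)
    moreover have "(LINT s:{- real n<..<real n}|lborel. f s) = 0" for n
      using zero[of "- real n" "real n"] by (cases n) (auto simp: set_lebesgue_integral_def)
    moreover have "(\<Union>n. {- real n<..<real n}) = UNIV"
    proof -
      have "\<exists>n. x \<in> {- real n<..<real n}" for x :: real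
      proof -
        obtain n where "\<bar>x\<bar> < real n"
          using reals_Archimedean2 by blast
        then show ?thesis
          by (intro exI[of _ n]) auto
      qed
      then show ?thesis
        by blast
    qed
    ultimately show ?thesis
      using LIMSEQ_unique[OF tendsto_const] by fastforce
  qed
  have stable: "Int_stable (range (\<lambda>(a, b). {a<..<b::real}))"
  proof (rule Int_stableI)
    fix S T assume "S \<in> range (\<lambda>(a, b). {a<..<b::real})" "T \<in> range (\<lambda>(a, b). {a<..<b::real})"
    then obtain a b c d where "S = {a<..<b}" "T = {c<..<d}"
      by auto
    then have "S \<inter> T = (\<lambda>(a, b). {a<..<b}) (max a c, min b d)"
      by auto
    then show "S \<inter> T \<in> range (\<lambda>(a, b). {a<..<b::real})"
      by blast
  qed
  have sub: "range (\<lambda>(a, b). {a<..<b::real}) \<subseteq> Pow UNIV"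
    by simp
  have A: "A \<in> sigma_sets UNIV (range (\<lambda>(a, b). {a<..<b::real}))"
    using \<open>A \<in> sets lborel\<close> by (simp add: borel_eq)
  from stable sub A show "(LINT s:A|lborel. f s) = 0"
  proof (induction rule: sigma_sets_induct_disjoint)
    case (basic A)
    then obtain a b where A: "A = {a<..<b}"
      by auto
    show ?case
      using zero[of a b] by (cases "a < b") (auto simp: A set_lebesgue_integral_def)
  next
    case (compl A)
    then have A: "A \<in> sets lborel"
      by (simp add: borel_eq)
    have "(LINT s:A \<union> (UNIV - A)|lborel. f s) = (LINT s:A|lborel. f s) + (LINT s:UNIV - A|lborel. f s)"
      using A by (intro set_integral_Un sint) auto
    then show ?case
      using whole compl by simp
  next
    case (union A)
    have A: "A i \<in> sets lborel" for i
      using union(2) by (auto simp: borel_eq)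
    have "(LINT s:(\<Union>i. A i)|lborel. f s) = (\<Sum>i. LINT s:A i|lborel. f s)"
      using A union(1)
      by (intro lebesgue_integral_countable_add sint) (auto simp: disjoint_family_on_def)
    then show ?case
      by (simp add: union)
  qed (auto simp: set_lebesgue_integral_def)
qed

text \<open>Bump functions of growing steepness converge boundedly to the indicator of an interval,
  so \<open>k\<close> has vanishing integral over every bounded open interval.\<close>

theorem fundamental_lemma:
  assumes k: "locally_integrable k"
    and zero: "\<And>\<psi>. test_function \<psi> \<Longrightarrow> (LINT s|lborel. k s * complex_of_real (\<psi> s)) = 0"
  shows "AE s in lborel. k s = 0"
proof -
  have [measurable]: "k \<in> borel_measurable borel"
    using k by (simp add: locally_integrable_def)
  have int: "integrable lborel (\<lambda>s. indicator {a..b} s *\<^sub>R k s)" for a b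
    using k by (simp add: locally_integrable_def set_integrable_def)
  have interval: "(LINT s:{a<..<b}|lborel. k s) = 0" for a b
  proof -
    define \<psi> where "\<psi> n s = flat (real (Suc n) * (s - a)) * flat (real (Suc n) * (b - s))" for n s
    have test: "test_function (\<psi> n)" for n
      unfolding \<psi>_def by (rule test_function_bump) simp
    note [measurable] = test_functionD(5)[OF test]
    have off: "\<psi> n s = 0" if "s \<notin> {a<..<b}" for n s
      using that by (auto simp: \<psi>_def flat_def zero_less_mult_iff)
    have "(\<lambda>n. LINT s|lborel. k s * complex_of_real (\<psi> n s))
        \<longlonglongrightarrow> (LINT s|lborel. indicator {a<..<b} s *\<^sub>R k s)"
    proof (rule integral_dominated_convergence)
      show "integrable lborel (\<lambda>s. norm (indicator {a..b} s *\<^sub>R k s))"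
        by (intro integrable_norm int)
      show "AE s in lborel. (\<lambda>n. k s * complex_of_real (\<psi> n s)) \<longlonglongrightarrow> indicator {a<..<b} s *\<^sub>R k s"
      proof (rule AE_I2)
        fix s
        show "(\<lambda>n. k s * complex_of_real (\<psi> n s)) \<longlonglongrightarrow> indicator {a<..<b} s *\<^sub>R k s"
        proof (cases "s \<in> {a<..<b}")
          case True
          then have "(\<lambda>n. k s * complex_of_real (\<psi> n s)) \<longlonglongrightarrow> k s * complex_of_real (1 * 1)"
            unfolding \<psi>_def by (intro tendsto_intros flat_tendsto_1) auto
          then show ?thesis
            using True by simp
        qed (simp add: off)
      qed
      show "AE s in lborel. norm (k s * complex_of_real (\<psi> n s)) \<le> norm (indicator {a..b} s *\<^sub>R k s)" for n
      proof (rule AE_I2)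
        fix s
        have "\<bar>\<psi> n s\<bar> \<le> 1"
          unfolding \<psi>_def abs_mult using flat_bounds by (intro mult_le_one) auto
        then show "norm (k s * complex_of_real (\<psi> n s)) \<le> norm (indicator {a..b} s *\<^sub>R k s)"
          by (cases "s \<in> {a<..<b}") (auto simp: norm_mult off mult_left_le)
      qed
    qed simp_all
    then show ?thesis
      by (simp add: zero[OF test] set_lebesgue_integral_def LIMSEQ_const_iff)
  qed
  \<comment> \<open>\<open>k\<close> is only locally integrable, so the criterion for integrable
    functions is applied to each restriction, and countably many null sets are united.\<close>
  have "AE s in lborel. indicator {- real n..real n} s *\<^sub>R k s = 0" for n
  proof (rule AE_zero_if_integral_intervals_zero[OF int])
    fix a b :: real assume "a < b"
    have "(LINT s:{a<..<b}|lborel. indicator {- real n..real n} s *\<^sub>R k s)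
        = (LINT s:{max a (- real n)<..<min b (real n)}|lborel. k s)"
      unfolding set_lebesgue_integral_def
    proof (rule integral_cong_AE)
      have "AE s in lborel. s \<noteq> real n \<and> s \<noteq> - real n"
        by (intro AE_conjI AE_lborel_singleton)
      then show "AE s in lborel. indicator {a<..<b} s *\<^sub>R indicator {- real n..real n} s *\<^sub>R k s
          = indicator {max a (- real n)<..<min b (real n)} s *\<^sub>R k s"
        by eventually_elim (auto simp: indicator_def)
    qed simp_all
    then show "(LINT s:{a<..<b}|lborel. indicator {- real n..real n} s *\<^sub>R k s) = 0"
      by (simp add: interval)
  qed
  then have "AE s in lborel. \<forall>n. indicator {- real n..real n} s *\<^sub>R k s = 0"
    unfolding AE_all_countable by blast
  then show ?thesis
  proof eventually_elim
    case (elim s)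
    obtain n where "\<bar>s\<bar> < real n"
      using reals_Archimedean2 by blast
    then show ?case
      using elim[rule_format, of n] by (auto simp: indicator_def split: if_splits)
  qed
qed

section \<open>Primitives of test functions and vanishing weak derivatives\<close>

text \<open>The running integral of \<eta> is constant beyond the support, and the zero mean makes
  this constant \<open>0\<close> on the right.\<close>

lemma test_function_primitive:
  assumes "test_function \<eta>" "(LINT s|lborel. \<eta> s) = 0"
  obtains \<Psi> where "test_function \<Psi>" "deriv \<Psi> = \<eta>"
proof -
  obtain R where R: "\<And>s. \<bar>s\<bar> > R \<Longrightarrow> \<eta> s = 0"
    using assms(1) by (auto simp: test_function_iff)
  \<comment> \<open>Starting one unit before the support leaves an overlap: the fundamental theorem
    covers \<open>x > a\<close>, and for \<open>x \<le> a\<close> the function vanishes in a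
    neighbourhood.\<close>
  define a where "a = - \<bar>R\<bar> - 1"
  define \<Psi> where "\<Psi> x = integral {a..x} \<eta>" for x
  have c: "continuous_on S \<eta>" for S
    using test_functionD(3)[OF assms(1)] continuous_on_subset by blast
  have left: "\<Psi> x = 0" if "x < - \<bar>R\<bar>" for x
  proof -
    have "\<Psi> x = integral {a..x} (\<lambda>_. 0)"
      unfolding \<Psi>_def using that by (intro integral_cong R) auto
    then show ?thesis
      by simp
  qed
  have right: "\<Psi> x = 0" if "x > \<bar>R\<bar>" for x
  proof -
    have "(LINT s:{a..x}|lborel. \<eta> s) = (LINT s|lborel. \<eta> s)"
      unfolding set_lebesgue_integral_def
    proof (rule Bochner_Integration.integral_cong[OF refl])
      show "indicator {a..x} s *\<^sub>R \<eta> s = \<eta> s" for s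
        using that R[of s] by (cases "\<bar>s\<bar> > R") (auto simp: indicator_def a_def)
    qed
    moreover have "(LINT s:{a..x}|lborel. \<eta> s) = \<Psi> x"
      unfolding \<Psi>_def
      by (intro set_borel_integral_eq_integral borel_integrable_atLeastAtMost') (rule c)
    ultimately show ?thesis
      using assms(2) by simp
  qed
  have deriv: "(\<Psi> has_field_derivative \<eta> x) (at x)" for x
  proof (cases "x > a")
    case True
    have "(\<Psi> has_field_derivative \<eta> x) (at x within {a..x + 1})"
      unfolding \<Psi>_def using True
      by (intro integral_has_real_derivative c) auto
    then show ?thesis
      using True by (simp add: at_within_Icc_at)
  next
    case False
    have "\<forall>\<^sub>F t in nhds x. \<Psi> t = 0"
      using False eventually_nhds_in_open[of "{..<- \<bar>R\<bar>}" x]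
      by (auto simp: a_def left elim!: eventually_mono)
    moreover have "\<eta> x = 0"
      using False by (intro R) (auto simp: a_def)
    ultimately show ?thesis
      by (subst DERIV_cong_ev[OF refl _ refl, of _ "\<lambda>_. 0"]) auto
  qed
  have "smooth_upto n \<Psi>" for n
    using assms(1) deriv
    by (cases n) (auto simp: test_function_iff simp del: smooth_upto.simps(2) intro: smooth_upto_Suc_deriv)
  moreover have "\<Psi> x = 0" if "\<bar>x\<bar> > \<bar>R\<bar>" for x
    using left[of x] right[of x] that by (cases "x < 0") auto
  ultimately have "test_function \<Psi>"
    by (auto simp: test_function_iff)
  moreover have "deriv \<Psi> = \<eta>"
    using deriv by (auto intro: DERIV_imp_deriv)
  ultimately show thesis
    by (rule that)
qed

lemma test_function_integral_1:
  obtains \<psi> where "test_function \<psi>" "(LINT s|lborel. \<psi> s) = 1"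
proof -
  define \<psi> where "\<psi> s = flat (1 * (s - - 1)) * flat (1 * (1 - s))" for s :: real
  have \<psi>: "test_function \<psi>"
    unfolding \<psi>_def by (rule test_function_bump) simp
  have nonneg: "\<psi> s \<ge> 0" for s
    by (simp add: \<psi>_def flat_bounds)
  have "(LINT s|lborel. \<psi> s) \<noteq> 0"
  proof
    assume "(LINT s|lborel. \<psi> s) = 0"
    then have "AE s in lborel. \<psi> s = 0"
      using nonneg test_functionD(6)[OF \<psi>] by (simp add: integral_nonneg_eq_0_iff_AE)
    then have "AE s in lborel. s \<notin> {-1<..<1::real}"
      by eventually_elim (auto simp: \<psi>_def flat_def)
    then have "emeasure lborel {s. - 1 < s \<and> s < (1::real)} = 0"
      by (subst (asm) AE_iff_measurable[OF _ refl]) auto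
    then have "emeasure lborel {-1<..<1::real} = 0"
      by (simp add: greaterThanLessThan_def greaterThan_def lessThan_def Collect_conj_eq)
    then show False
      by simp
  qed
  then have "(LINT s|lborel. inverse (LINT s|lborel. \<psi> s) * \<psi> s) = 1"
    by simp
  then show thesis
    using that test_function_scale[OF \<psi>] by blast
qed

text \<open>Subtracting a multiple of a fixed test function of integral \<open>1\<close> makes any
  test function have mean zero, hence be a derivative. So \<open>k - c\<close> annihilates all test
  functions, where \<open>c\<close> is the pairing of \<open>k\<close> with the fixed one.\<close>

theorem du_Bois_Reymond:
  assumes k: "locally_integrable k"
    and zero: "\<And>\<psi>. test_function \<psi> \<Longrightarrow> (LINT s|lborel. k s * complex_of_real (deriv \<psi> s)) = 0"
  obtains c where "AE s in lborel. k s = c"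
proof -
  obtain \<psi>0 where \<psi>0: "test_function \<psi>0" "(LINT s|lborel. \<psi>0 s) = 1"
    by (rule test_function_integral_1)
  define c where "c = (LINT s|lborel. k s * complex_of_real (\<psi>0 s))"
  have "set_integrable lborel {a..b} (\<lambda>_. c)" for a b :: real
    by (intro borel_integrable_atLeastAtMost' continuous_intros)
  then have lc: "locally_integrable (\<lambda>s. k s - c)"
    using k by (auto simp: locally_integrable_def)
  have "AE s in lborel. k s - c = 0"
  proof (rule fundamental_lemma[OF lc])
    fix \<psi> assume \<psi>: "test_function \<psi>"
    define I where "I = (LINT s|lborel. \<psi> s)"
    define \<eta> where "\<eta> s = \<psi> s + - I * \<psi>0 s" for s
    have \<eta>: "test_function \<eta>"
      unfolding \<eta>_def by (intro test_function_add test_function_scale \<psi> \<psi>0)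
    have "(LINT s|lborel. \<eta> s) = 0"
      using test_functionD(6)[OF \<psi>] test_functionD(6)[OF \<psi>0(1)]
      by (simp add: \<eta>_def I_def \<psi>0)
    then obtain \<Psi> where "test_function \<Psi>" "deriv \<Psi> = \<eta>"
      using test_function_primitive[OF \<eta>] by blast
    then have "(LINT s|lborel. k s * complex_of_real (\<eta> s)) = 0"
      using zero[of \<Psi>] by simp
    also have "(LINT s|lborel. k s * complex_of_real (\<eta> s))
        = (LINT s|lborel. k s * complex_of_real (\<psi> s) - complex_of_real I * (k s * complex_of_real (\<psi>0 s)))"
      by (simp add: \<eta>_def algebra_simps)
    also have "\<dots> = (LINT s|lborel. k s * complex_of_real (\<psi> s)) - complex_of_real I * c"
      using locally_integrable_test_mult[OF k] \<psi> \<psi>0 by (simp add: c_def)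
    finally have "(LINT s|lborel. k s * complex_of_real (\<psi> s)) = complex_of_real I * c"
      by simp
    moreover have "(LINT s|lborel. (k s - c) * complex_of_real (\<psi> s))
        = (LINT s|lborel. k s * complex_of_real (\<psi> s) - c * complex_of_real (\<psi> s))"
      by (simp add: algebra_simps)
    moreover have "integrable lborel (\<lambda>s. complex_of_real (\<psi> s))"
      using test_functionD(6)[OF \<psi>] by (rule integrable_of_real)
    ultimately show "(LINT s|lborel. (k s - c) * complex_of_real (\<psi> s)) = 0"
      using locally_integrable_test_mult[OF k \<psi>] integral_complex_of_real[of lborel \<psi>]
      by (simp add: I_def)
  qed
  then show thesis
    by (intro that[of c]) auto
qed


section \<open>Indefinite integrals\<close>

text \<open>Absolute continuity encoded by increments: \<open>f\<close> is a density of
  \<open>F\<close>, free to change on null sets, as suits representatives of classes in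
  \<open>L2\<close>.\<close>

definition is_primitive :: "(real \<Rightarrow> complex) \<Rightarrow> (real \<Rightarrow> complex) \<Rightarrow> bool" where
  "is_primitive F f \<longleftrightarrow> locally_integrable f \<and>
     (\<forall>a b. a \<le> b \<longrightarrow> F b - F a = (LINT s:{a..b}|lborel. f s))"

lemma is_primitiveD:
  assumes "is_primitive F f"
  shows "locally_integrable f" "set_integrable lborel {a..b} f" "f \<in> borel_measurable borel"
    "a \<le> b \<Longrightarrow> F b - F a = (LINT s:{a..b}|lborel. f s)"
  using assms by (auto simp: is_primitive_def locally_integrable_def)

lemma is_primitive_continuous:
  assumes "is_primitive F f"
  shows "continuous_on UNIV F"
proof (rule continuous_at_imp_continuous_on, rule ballI)
  fix x :: real
  note P = is_primitiveD[OF assms]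
  have "continuous_on {x - 1..x + 1} (\<lambda>t. F (x - 1) + integral {x - 1..t} f)"
    using P(2) by (intro continuous_intros indefinite_integral_continuous_1 set_borel_integral_eq_integral)
  moreover have "F (x - 1) + integral {x - 1..t} f = F t" if "t \<in> {x - 1..x + 1}" for t
    using P(4)[of "x - 1" t] set_borel_integral_eq_integral(2)[OF P(2)[of "x - 1" t]] that
    by (simp add: algebra_simps)
  ultimately have "continuous_on {x - 1..x + 1} F"
    by (rule continuous_on_eq)
  then show "isCont F x"
    by (rule continuous_on_interior) simp
qed

lemma is_primitive_measurable: "is_primitive F f \<Longrightarrow> F \<in> borel_measurable borel"
  by (intro borel_measurable_continuous_onI is_primitive_continuous)

lemma is_primitive_add_const: "is_primitive F f \<Longrightarrow> is_primitive (\<lambda>s. F s + c) f"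
  by (simp add: is_primitive_def)

lemma is_primitive_cnj:
  assumes "is_primitive F f"
  shows "is_primitive (\<lambda>s. cnj (F s)) (\<lambda>s. cnj (f s))"
proof -
  note P = is_primitiveD[OF assms]
  have [measurable]: "cnj \<in> borel_measurable borel"
    by (intro borel_measurable_continuous_onI continuous_intros)
  have eq: "indicator {a..b} s *\<^sub>R cnj (f s) = cnj (indicator {a..b} s *\<^sub>R f s)" for a b s :: real
    by simp
  have "set_integrable lborel {a..b} (\<lambda>s. cnj (f s))" for a b
    using P(2)[of a b] unfolding set_integrable_def eq complex_integrable_cnj .
  moreover have "(\<lambda>s. cnj (f s)) \<in> borel_measurable borel"
    using P(3) by measurable
  moreover have "(LINT s:{a..b}|lborel. cnj (f s)) = cnj (LINT s:{a..b}|lborel. f s)" for a b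
    unfolding set_lebesgue_integral_def eq by (rule Bochner_Integration.integral_cnj)
  ultimately show ?thesis
    using P(4) by (simp add: is_primitive_def locally_integrable_def flip: complex_cnj_diff)
qed

lemma is_primitive_diff:
  assumes "is_primitive F f" "is_primitive G g"
  shows "is_primitive (\<lambda>s. F s - G s) (\<lambda>s. f s - g s)"
  unfolding is_primitive_def
proof (intro conjI allI impI)
  note P = is_primitiveD[OF assms(1)] and Q = is_primitiveD[OF assms(2)]
  show "locally_integrable (\<lambda>s. f s - g s)"
    using P Q by (auto simp: locally_integrable_def)
  show "F b - G b - (F a - G a) = (LINT s:{a..b}|lborel. f s - g s)" if "a \<le> b" for a b
    using P(4)[OF that] Q(4)[OF that] by (simp add: set_integral_diff(2)[OF P(2) Q(2)] algebra_simps)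
qed

lemma primitive_exists:
  assumes "locally_integrable f"
  obtains F where "is_primitive F f"
proof
  \<comment> \<open>Integrals over reversed intervals are \<open>0\<close>, so the two terms
    together form the oriented integral from \<open>0\<close> to \<open>x\<close>.\<close>
  define F where "F x = integral {0..x} f - integral {x..0} f" for x
  have int: "set_integrable lborel {a..b} f" for a b
    using assms by (simp add: locally_integrable_def)
  note Henstock_Kurzweil_Integration.integral_combine[OF _ _ set_borel_integral_eq_integral(1)[OF int], simp]
  have "F b - F a = integral {a..b} f" if "a \<le> b" for a b
  proof -
    have *: "integral {0..x} f = 0" if "x \<le> 0" for x
      using that by (cases "x = 0") auto
    have **: "integral {x..0} f = 0" if "x \<ge> 0" for x
      using that by (cases "x = 0") auto
    consider "0 \<le> a" | "a \<le> 0" "0 \<le> b" | "b \<le> 0"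
      by linarith
    then show ?thesis
    proof cases
      case 1
      then have "integral {0..a} f + integral {a..b} f = integral {0..b} f"
        using that by simp
      then show ?thesis
        using 1 that by (simp add: F_def ** algebra_simps)
    next
      case 2
      then have "integral {a..0} f + integral {0..b} f = integral {a..b} f"
        by simp
      then show ?thesis
        using 2 by (simp add: F_def * ** algebra_simps)
    next
      case 3
      then have "integral {a..b} f + integral {b..0} f = integral {a..0} f"
        using that by simp
      then show ?thesis
        using 3 that by (simp add: F_def * algebra_simps)
    qed
  qed
  then show "is_primitive F f"
    using assms by (simp add: is_primitive_def set_borel_integral_eq_integral(2)[OF int])
qed

section \<open>Product rule and integration by parts\<close>

text \<open>The order of integration is exchanged over the half-plane \<open>t \<le> x\<close>;
  cutting both functions off to \<open>{a..b}\<close> turns it into the triangle of the product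
  rule.\<close>

lemma Fubini_triangle:
  fixes f g :: "real \<Rightarrow> complex"
  assumes f: "integrable lborel f" and g: "integrable lborel g"
  shows "(LINT x|lborel. (LINT t:{..x}|lborel. f t) * g x) = (LINT t|lborel. f t * (LINT x:{t..}|lborel. g x))"
proof -
  have [measurable]: "f \<in> borel_measurable borel" "g \<in> borel_measurable borel"
    using f g by (auto dest: borel_measurable_integrable)
  have prod: "integrable (lborel \<Otimes>\<^sub>M lborel) (\<lambda>(x, t). f t * g x)"
  proof (rule lborel_pair.Fubini_integrable)
    show "integrable lborel (\<lambda>x. LINT t|lborel. norm (case (x, t) of (x, t) \<Rightarrow> f t * g x))"
      using g by (simp add: norm_mult)
    show "AE x in lborel. integrable lborel (\<lambda>t. case (x, t) of (x, t) \<Rightarrow> f t * g x)"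
      using f by simp
  qed measurable
  have "integrable (lborel \<Otimes>\<^sub>M lborel) (\<lambda>z. indicator {(x, t). t \<le> x} z *\<^sub>R (case z of (x, t) \<Rightarrow> f t * g x))"
  proof (rule integrable_mult_indicator[OF _ prod])
    have "closed {z::real \<times> real. snd z \<le> fst z}"
      by (intro closed_Collect_le continuous_intros)
    then have "{z::real \<times> real. snd z \<le> fst z} \<in> sets (borel \<Otimes>\<^sub>M borel)"
      unfolding borel_prod by simp
    moreover have "sets (lborel \<Otimes>\<^sub>M lborel :: (real \<times> real) measure) = sets (borel \<Otimes>\<^sub>M borel)"
      by (intro sets_pair_measure_cong sets_lborel)
    ultimately show "{(x, t). t \<le> x} \<in> sets (lborel \<Otimes>\<^sub>M (lborel :: real measure))"
      by (simp only: case_prod_beta')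
  qed
  also have "(\<lambda>z. indicator {(x, t). t \<le> x} z *\<^sub>R (case z of (x, t) \<Rightarrow> f t * g x))
      = (\<lambda>(x, t). indicator {..x} t *\<^sub>R f t * g x)"
    by (auto simp: indicator_def fun_eq_iff)
  finally have "(LINT t|lborel. LINT x|lborel. indicator {..x} t *\<^sub>R f t * g x)
      = (LINT x|lborel. LINT t|lborel. indicator {..x} t *\<^sub>R f t * g x)"
    by (rule lborel_pair.Fubini_integral)
  also have "(LINT t|lborel. LINT x|lborel. indicator {..x} t *\<^sub>R f t * g x)
      = (LINT t|lborel. f t * (LINT x:{t..}|lborel. g x))"
  proof (rule Bochner_Integration.integral_cong[OF refl])
    fix t
    have "(LINT x|lborel. indicator {..x} t *\<^sub>R f t * g x) = (LINT x|lborel. f t * (indicator {t..} x *\<^sub>R g x))"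
      by (rule Bochner_Integration.integral_cong) (auto simp: indicator_def)
    then show "(LINT x|lborel. indicator {..x} t *\<^sub>R f t * g x) = f t * (LINT x:{t..}|lborel. g x)"
      by (simp only: set_lebesgue_integral_def integral_mult_right_zero)
  qed
  also have "(LINT x|lborel. LINT t|lborel. indicator {..x} t *\<^sub>R f t * g x)
      = (LINT x|lborel. (LINT t:{..x}|lborel. f t) * g x)"
    by (simp only: set_lebesgue_integral_def integral_mult_left_zero)
  finally show ?thesis
    by simp
qed

lemma locally_integrable_continuous_mult:
  assumes f: "locally_integrable f" and F: "continuous_on UNIV F"
  shows "locally_integrable (\<lambda>s. F s * f s)"
  unfolding locally_integrable_def
proof (intro conjI allI)
  have [measurable]: "f \<in> borel_measurable borel" "F \<in> borel_measurable borel"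
    using f F by (auto simp: locally_integrable_def intro: borel_measurable_continuous_onI)
  show "(\<lambda>s. F s * f s) \<in> borel_measurable borel"
    by measurable
  fix a b :: real
  have "bounded (F ` {a..b})"
    by (intro compact_imp_bounded compact_continuous_image continuous_on_subset[OF F]) auto
  then obtain B where B: "\<And>s. s \<in> {a..b} \<Longrightarrow> cmod (F s) \<le> B"
    unfolding bounded_iff by blast
  show "set_integrable lborel {a..b} (\<lambda>s. F s * f s)"
    unfolding set_integrable_def
  proof (rule Bochner_Integration.integrable_bound)
    show "integrable lborel (\<lambda>s. B * cmod (indicator {a..b} s *\<^sub>R f s))"
      using f by (intro integrable_mult_right integrable_norm) (simp add: locally_integrable_def set_integrable_def)
    have "norm (indicator {a..b} s *\<^sub>R (F s * f s)) \<le> norm (B * cmod (indicator {a..b} s *\<^sub>R f s))" for s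
      using B[of s] norm_ge_zero[of "F s"]
      by (auto simp: indicator_def norm_mult abs_mult intro!: mult_right_mono)
    then show "AE s in lborel. norm (indicator {a..b} s *\<^sub>R (F s * f s))
        \<le> norm (B * cmod (indicator {a..b} s *\<^sub>R f s))"
      by simp
  qed measurable
qed

text \<open>The product rule for indefinite integrals is Fubini's theorem on the triangle \<open>a \<le> t \<le> x \<le> b\<close>.\<close>

lemma is_primitive_mult:
  assumes "is_primitive F f" "is_primitive G g"
  shows "is_primitive (\<lambda>s. F s * G s) (\<lambda>s. f s * G s + F s * g s)"
  unfolding is_primitive_def
proof (intro conjI allI impI)
  note P = is_primitiveD[OF assms(1)] and Q = is_primitiveD[OF assms(2)]
  have fG: "locally_integrable (\<lambda>s. f s * G s)"
    using locally_integrable_continuous_mult[OF P(1) is_primitive_continuous[OF assms(2)]]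
    by (simp add: mult.commute)
  have Fg: "locally_integrable (\<lambda>s. F s * g s)"
    by (rule locally_integrable_continuous_mult[OF Q(1) is_primitive_continuous[OF assms(1)]])
  show "locally_integrable (\<lambda>s. f s * G s + F s * g s)"
    using fG Fg by (auto simp: locally_integrable_def)
  fix a b :: real assume ab: "a \<le> b"
  define f1 g1 where "f1 s = indicator {a..b} s *\<^sub>R f s" and "g1 s = indicator {a..b} s *\<^sub>R g s" for s
  have int: "integrable lborel f1" "integrable lborel g1"
    using P(2) Q(2) by (simp_all add: f1_def[abs_def] g1_def[abs_def] set_integrable_def)
  have left: "(LINT t:{..x}|lborel. f1 t) = F x - F a" if "x \<in> {a..b}" for x
  proof -
    have "(LINT t:{..x}|lborel. f1 t) = (LINT t:{a..x}|lborel. f t)"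
      unfolding set_lebesgue_integral_def using that
      by (intro Bochner_Integration.integral_cong) (auto simp: f1_def indicator_def)
    then show ?thesis
      using P(4)[of a x] that by simp
  qed
  have right: "(LINT x:{t..}|lborel. g1 x) = G b - G t" if "t \<in> {a..b}" for t
  proof -
    have "(LINT x:{t..}|lborel. g1 x) = (LINT x:{t..b}|lborel. g x)"
      unfolding set_lebesgue_integral_def using that
      by (intro Bochner_Integration.integral_cong) (auto simp: g1_def indicator_def)
    then show ?thesis
      using Q(4)[of t b] that by simp
  qed
  have "(LINT s:{a..b}|lborel. F s * g s - F a * g s) = (LINT x|lborel. (LINT t:{..x}|lborel. f1 t) * g1 x)"
    unfolding set_lebesgue_integral_def[of _ "{a..b}"]
    by (intro Bochner_Integration.integral_cong) (auto simp: g1_def left indicator_def algebra_simps)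
  also have "\<dots> = (LINT t|lborel. f1 t * (LINT x:{t..}|lborel. g1 x))"
    by (rule Fubini_triangle[OF int])
  also have "\<dots> = (LINT s:{a..b}|lborel. G b * f s - f s * G s)"
    unfolding set_lebesgue_integral_def[of _ "{a..b}"]
    by (intro Bochner_Integration.integral_cong) (auto simp: f1_def right indicator_def algebra_simps)
  finally have eq: "(LINT s:{a..b}|lborel. F s * g s - F a * g s) = (LINT s:{a..b}|lborel. G b * f s - f s * G s)" .
  have sfG: "set_integrable lborel {a..b} (\<lambda>s. f s * G s)" and sFg: "set_integrable lborel {a..b} (\<lambda>s. F s * g s)"
    using fG Fg by (simp_all add: locally_integrable_def)
  have "(LINT s:{a..b}|lborel. F s * g s - F a * g s) = (LINT s:{a..b}|lborel. F s * g s) - F a * (G b - G a)"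
    using sFg Q(2)[of a b] Q(4)[OF ab] by (subst set_integral_diff) auto
  moreover have "(LINT s:{a..b}|lborel. G b * f s - f s * G s) = G b * (F b - F a) - (LINT s:{a..b}|lborel. f s * G s)"
    using sfG P(2)[of a b] P(4)[OF ab] by (subst set_integral_diff) auto
  moreover have "(LINT s:{a..b}|lborel. f s * G s + F s * g s)
      = (LINT s:{a..b}|lborel. f s * G s) + (LINT s:{a..b}|lborel. F s * g s)"
    by (rule set_integral_add(2)[OF sfG sFg])
  ultimately show "F b * G b - F a * G a = (LINT s:{a..b}|lborel. f s * G s + F s * g s)"
    using eq by algebra
qed

lemma is_primitive_const: "is_primitive (\<lambda>_. c) (\<lambda>_. 0)"
  by (simp add: is_primitive_def locally_integrable_def set_integrable_def)

lemma is_primitive_scale: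
  assumes "is_primitive F f"
  shows "is_primitive (\<lambda>s. c * F s) (\<lambda>s. c * f s)"
  using is_primitive_mult[OF is_primitive_const[of c] assms] by simp

lemma is_primitive_add:
  assumes "is_primitive F f" "is_primitive G g"
  shows "is_primitive (\<lambda>s. F s + G s) (\<lambda>s. f s + g s)"
  using is_primitive_diff[OF assms(1) is_primitive_scale[OF assms(2), of "- 1"]] by simp

lemma is_primitive_cong_AE:
  assumes "is_primitive F f" "AE s in lborel. f s = g s" "g \<in> borel_measurable borel"
  shows "is_primitive F g"
proof -
  note P = is_primitiveD[OF assms(1)]
  have ae: "AE s in lborel. indicator {a..b} s *\<^sub>R f s = indicator {a..b} s *\<^sub>R g s" for a b :: real
    using assms(2) by eventually_elim simp
  have m: "(\<lambda>s. indicator {a..b} s *\<^sub>R f s) \<in> borel_measurable lborel"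
    "(\<lambda>s. indicator {a..b} s *\<^sub>R g s) \<in> borel_measurable lborel" for a b :: real
    using P(3) assms(3) by simp_all
  have "set_integrable lborel {a..b} g" for a b
    using P(2)[of a b] integrable_cong_AE[OF m ae] by (simp add: set_integrable_def)
  moreover have "(LINT s:{a..b}|lborel. g s) = (LINT s:{a..b}|lborel. f s)" for a b
    unfolding set_lebesgue_integral_def by (rule integral_cong_AE[OF m ae, symmetric])
  ultimately show ?thesis
    using assms(3) P(4) by (simp add: is_primitive_def locally_integrable_def)
qed

text \<open>The finite exceptional set admits a kink, as the damped plane waves have at
  \<open>0\<close>.\<close>

lemma is_primitive_if_continuous_derivative:
  assumes "finite S" "continuous_on UNIV F" "\<And>s. s \<notin> S \<Longrightarrow> (F has_vector_derivative f s) (at s)"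
    and f: "locally_integrable f"
  shows "is_primitive F f"
  unfolding is_primitive_def
proof (intro conjI allI impI f)
  fix a b :: real assume "a \<le> b"
  have "(f has_integral F b - F a) {a..b}"
    using assms continuous_on_subset[OF assms(2)]
    by (intro fundamental_theorem_of_calculus_interior_strong[of S] \<open>a \<le> b\<close>) auto
  then show "F b - F a = (LINT s:{a..b}|lborel. f s)"
    using f set_borel_integral_eq_integral(2)[of "{a..b}" f]
    by (simp add: locally_integrable_def integral_unique)
qed

lemma locally_integrable_continuous:
  assumes "continuous_on UNIV f"
  shows "locally_integrable f"
  using assms unfolding locally_integrable_def
  by (auto intro: borel_measurable_continuous_onI borel_integrable_atLeastAtMost' continuous_on_subset)

lemma is_primitive_test_function:
  assumes "test_function \<psi>"
  shows "is_primitive (\<lambda>s. complex_of_real (\<psi> s)) (\<lambda>s. complex_of_real (deriv \<psi> s))"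
proof (rule is_primitive_if_continuous_derivative[of "{}"])
  show "continuous_on UNIV (\<lambda>s. complex_of_real (\<psi> s))"
    by (intro continuous_intros test_functionD assms)
  show "locally_integrable (\<lambda>s. complex_of_real (deriv \<psi> s))"
    by (intro locally_integrable_continuous continuous_intros test_functionD(2,3) assms)
  show "((\<lambda>s. complex_of_real (\<psi> s)) has_vector_derivative complex_of_real (deriv \<psi> s)) (at s)" for s
    using test_functionD(1)[OF assms, of s]
    by (intro has_vector_derivative_of_real) (simp add: has_real_derivative_iff_has_vector_derivative)
qed simp

text \<open>The product of \<open>K\<close> and \<psi> is an indefinite integral whose boundary
  values vanish at \<open>- M\<close> and \<open>M\<close>, beyond the support.\<close>

lemma is_primitive_weak:
  assumes K: "is_primitive K k" and \<psi>: "test_function \<psi>"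
  shows "(LINT s|lborel. K s * complex_of_real (deriv \<psi> s)) = - (LINT s|lborel. k s * complex_of_real (\<psi> s))"
proof -
  obtain R where R: "\<And>s. \<bar>s\<bar> > R \<Longrightarrow> \<psi> s = 0"
    using \<psi> by (auto simp: test_function_iff)
  obtain R' where R': "\<And>s. \<bar>s\<bar> > R' \<Longrightarrow> deriv \<psi> s = 0"
    using test_functionD(2)[OF \<psi>] by (auto simp: test_function_iff)
  define M where "M = \<bar>R\<bar> + \<bar>R'\<bar> + 1"
  have lK: "locally_integrable K"
    by (intro locally_integrable_continuous is_primitive_continuous[OF K])
  have i: "integrable lborel (\<lambda>s. k s * complex_of_real (\<psi> s))" "integrable lborel (\<lambda>s. K s * complex_of_real (deriv \<psi> s))"
    by (intro locally_integrable_test_mult is_primitiveD(1)[OF K] lK test_functionD(2) \<psi>)+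
  have "M \<ge> 0"
    by (simp add: M_def)
  have "(LINT s|lborel. k s * complex_of_real (\<psi> s) + K s * complex_of_real (deriv \<psi> s))
      = (LINT s:{- M..M}|lborel. k s * complex_of_real (\<psi> s) + K s * complex_of_real (deriv \<psi> s))"
    unfolding set_lebesgue_integral_def
  proof (rule Bochner_Integration.integral_cong[OF refl])
    fix s
    show "k s * complex_of_real (\<psi> s) + K s * complex_of_real (deriv \<psi> s) =
         indicator {- M..M} s *\<^sub>R (k s * complex_of_real (\<psi> s) + K s * complex_of_real (deriv \<psi> s))"
      using R[of s] R'[of s] by (cases "s \<in> {- M..M}") (auto simp: M_def)
  qed
  also have "\<dots> = K M * complex_of_real (\<psi> M) - K (- M) * complex_of_real (\<psi> (- M))"
    using is_primitiveD(4)[OF is_primitive_mult[OF K is_primitive_test_function[OF \<psi>]], of "- M" M] \<open>M \<ge> 0\<close>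
    by simp
  also have "\<dots> = 0"
    using R[of M] R[of "- M"] by (simp add: M_def)
  finally show ?thesis
    using i by (simp add: add_eq_0_iff)
qed

text \<open>Integrability alone gives no pointwise decay of \<open>K\<close>, so stretched cutoffs
  are tested against. The side with the derivative of the cutoff carries a factor
  \<open>\<epsilon> n\<close> and disappears; the other side tends to \<open>\<eta> 0\<close> times
  the integral of \<open>k\<close>.\<close>

lemma integral_primitive_zero:
  assumes K: "is_primitive K k" and int: "integrable lborel K" "integrable lborel k"
  shows "(LINT s|lborel. k s) = 0"
proof -
  define \<eta> where "\<eta> s = flat (1 * (s - - 1)) * flat (1 * (1 - s))" for s :: real
  have \<eta>: "test_function \<eta>"
    unfolding \<eta>_def by (rule test_function_bump) simp
  \<comment> \<open>Any nonzero value at the origin serves; it is cancelled at the end.\<close>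
  have \<eta>0: "\<eta> 0 \<noteq> 0"
    by (simp add: \<eta>_def flat_def)
  obtain B where B: "\<And>s. \<bar>\<eta> s\<bar> \<le> B"
    using test_functionD(4)[OF \<eta>] by (auto simp: bounded_iff)
  obtain C where C: "\<And>s. \<bar>deriv \<eta> s\<bar> \<le> C"
    using test_functionD(4)[OF test_functionD(2)[OF \<eta>]] by (auto simp: bounded_iff)
  have [measurable]: "k \<in> borel_measurable borel" "K \<in> borel_measurable borel" "\<eta> \<in> borel_measurable borel"
    "deriv \<eta> \<in> borel_measurable borel"
    using int by (auto intro: test_functionD(5) \<eta> test_functionD(2) dest: borel_measurable_integrable)
  define \<epsilon> where "\<epsilon> n = inverse (real (Suc n))" for n
  have \<epsilon>: "\<epsilon> n > 0" for n
    by (simp add: \<epsilon>_def)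
  have \<epsilon>0: "\<epsilon> \<longlonglongrightarrow> 0"
    unfolding \<epsilon>_def[abs_def] by (rule LIMSEQ_inverse_real_of_nat)
  define X where "X n s = \<eta> (\<epsilon> n * s + 0)" for n s
  have dX: "deriv (X n) s = \<epsilon> n * deriv \<eta> (\<epsilon> n * s + 0)" for n s
    unfolding X_def
    by (rule DERIV_imp_deriv, rule DERIV_chain'[of "\<lambda>x. \<epsilon> n * x + 0" "\<epsilon> n", THEN DERIV_cong])
       (auto intro!: derivative_eq_intros test_functionD(1)[OF \<eta>] simp: mult.commute)
  have X: "test_function (X n)" for n
  proof -
    obtain R where R: "\<And>s. \<bar>s\<bar> > R \<Longrightarrow> \<eta> s = 0"
      using \<eta> by (auto simp: test_function_iff)
    have "X n s = 0" if "\<bar>s\<bar> > R / \<epsilon> n" for s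
      using that \<epsilon>[of n] R[of "\<epsilon> n * s"] by (simp add: X_def abs_mult pos_divide_less_eq mult.commute)
    moreover have "smooth_upto m (X n)" for m
      unfolding X_def using \<eta> by (intro smooth_upto_affine) (simp add: test_function_iff)
    ultimately show ?thesis
      by (auto simp: test_function_iff)
  qed
  have 1: "(\<lambda>n. LINT s|lborel. k s * complex_of_real (X n s)) \<longlonglongrightarrow> (LINT s|lborel. k s * complex_of_real (\<eta> 0))"
  proof (rule integral_dominated_convergence)
    show "integrable lborel (\<lambda>s. norm (k s) * B)"
      using int by (intro integrable_mult_left integrable_norm)
    show "AE s in lborel. (\<lambda>n. k s * complex_of_real (X n s)) \<longlonglongrightarrow> k s * complex_of_real (\<eta> 0)"
    proof (rule AE_I2)
      fix s
      have "isCont \<eta> 0"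
        using test_functionD(1)[OF \<eta>] by (rule DERIV_isCont)
      moreover have "(\<lambda>n. \<epsilon> n * s + 0) \<longlonglongrightarrow> 0"
        using tendsto_mult[OF \<epsilon>0 tendsto_const[of s]] by simp
      ultimately show "(\<lambda>n. k s * complex_of_real (X n s)) \<longlonglongrightarrow> k s * complex_of_real (\<eta> 0)"
        unfolding X_def by (intro tendsto_intros isCont_tendsto_compose[of 0 \<eta>]) auto
    qed
    show "AE s in lborel. norm (k s * complex_of_real (X n s)) \<le> norm (k s) * B" for n
      using B by (auto simp: norm_mult X_def intro!: mult_left_mono)
  qed (auto simp: X_def)
  have 2: "(\<lambda>n. LINT s|lborel. K s * complex_of_real (deriv (X n) s)) \<longlonglongrightarrow> (LINT s|(lborel :: real measure). 0)"
  proof (rule integral_dominated_convergence)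
    show "integrable lborel (\<lambda>s. norm (K s) * C)"
      using int by (intro integrable_mult_left integrable_norm)
    have bd: "norm (K s * complex_of_real (deriv (X n) s)) \<le> \<epsilon> n * (norm (K s) * C)" for n s
      using C[of "\<epsilon> n * s"] \<epsilon>[of n]
      by (simp add: norm_mult dX abs_mult mult.left_commute mult_left_mono)
    show "AE s in lborel. (\<lambda>n. K s * complex_of_real (deriv (X n) s)) \<longlonglongrightarrow> 0"
    proof (rule AE_I2)
      fix s
      have "(\<lambda>n. \<epsilon> n * (norm (K s) * C)) \<longlonglongrightarrow> 0"
        using tendsto_mult[OF \<epsilon>0 tendsto_const[of "norm (K s) * C"]] by simp
      then show "(\<lambda>n. K s * complex_of_real (deriv (X n) s)) \<longlonglongrightarrow> 0"
        by (rule Lim_null_comparison[rotated]) (simp add: bd)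
    qed
    have "0 \<le> C"
      using C[of 0] by linarith
    have "norm (K s * complex_of_real (deriv (X n) s)) \<le> norm (K s) * C" for n s
    proof -
      have "\<epsilon> n \<le> 1"
        by (simp add: \<epsilon>_def inverse_le_1_iff)
      then have "\<epsilon> n * (norm (K s) * C) \<le> 1 * (norm (K s) * C)"
        using \<open>0 \<le> C\<close> by (intro mult_right_mono) auto
      then show ?thesis
        using bd[of s n] by simp
    qed
    then show "AE s in lborel. norm (K s * complex_of_real (deriv (X n) s)) \<le> norm (K s) * C" for n
      by simp
  qed (auto simp: dX)
  have "(LINT s|lborel. k s * complex_of_real (X n s)) = - (LINT s|lborel. K s * complex_of_real (deriv (X n) s))" for n
    using is_primitive_weak[OF K X] by simp
  then have "(\<lambda>n. LINT s|lborel. k s * complex_of_real (X n s)) \<longlonglongrightarrow> - (LINT s|(lborel :: real measure). 0)"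
    using tendsto_minus[OF 2] by simp
  then have "(LINT s|lborel. k s * complex_of_real (\<eta> 0)) = 0"
    using 1 LIMSEQ_unique by fastforce
  then show ?thesis
    using \<eta>0 by simp
qed


section \<open>The Sobolev space \<open>H1\<close>\<close>

lemma square_integrable_indicator:
  fixes a b :: real
  assumes "a \<le> b"
  shows "square_integrable (\<lambda>s. complex_of_real (indicator {a..b} s))"
    and "norm (abs_L2 (\<lambda>s. complex_of_real (indicator {a..b} s))) = sqrt (b - a)"
proof -
  have eq: "(cmod (complex_of_real (indicator {a..b} s)))\<^sup>2 = indicator {a..b} s" for s :: real
    by (simp add: indicator_def)
  show sq: "square_integrable (\<lambda>s. complex_of_real (indicator {a..b} s))"
    unfolding square_integrable_def eq using assms
    by (auto intro!: integrable_real_indicator simp: emeasure_lborel_Icc)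
  have "(norm (abs_L2 (\<lambda>s. complex_of_real (indicator {a..b} s))))\<^sup>2 = b - a"
    unfolding norm_abs_L2[OF sq] eq using assms by simp
  then show "norm (abs_L2 (\<lambda>s. complex_of_real (indicator {a..b} s))) = sqrt (b - a)"
    by (metis norm_ge_zero real_sqrt_unique)
qed

text \<open>The Cauchy-Schwarz inequality against the indicator of the interval, whose norm is
  \<open>sqrt (b - a)\<close>.\<close>

lemma set_integral_cmod_le:
  fixes a b :: real
  assumes f: "square_integrable f" and "a \<le> b"
  shows "set_integrable lborel {a..b} f"
    and "(LINT s:{a..b}|lborel. cmod (f s)) \<le> sqrt (b - a) * norm (abs_L2 f)"
proof -
  have [measurable]: "f \<in> borel_measurable borel"
    using square_integrable_measurable[OF f] by simp
  note ind = square_integrable_indicator[OF assms(2)]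
  have eq: "cmod (complex_of_real (indicator {a..b} s)) * cmod (f s) = indicator {a..b} s *\<^sub>R cmod (f s)" for s
    by (simp add: indicator_def)
  have "integrable lborel (\<lambda>s. indicator {a..b} s *\<^sub>R cmod (f s))"
    using integrable_cmod_mult[OF ind(1) f] unfolding eq .
  then have "integrable lborel (\<lambda>s. norm (indicator {a..b} s *\<^sub>R f s))"
    by (simp add: norm_mult)
  then show "set_integrable lborel {a..b} f"
    unfolding set_integrable_def by (subst (asm) integrable_norm_iff) auto
  show "(LINT s:{a..b}|lborel. cmod (f s)) \<le> sqrt (b - a) * norm (abs_L2 f)"
    using integral_cmod_mult_le[OF ind(1) f] unfolding set_lebesgue_integral_def eq ind(2) .
qed

lemma set_integral_norm_bound':
  fixes f :: "real \<Rightarrow> complex"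
  shows "cmod (LINT s:A|lborel. f s) \<le> (LINT s:A|lborel. cmod (f s))"
  using integral_norm_bound[of lborel "\<lambda>s. indicator A s *\<^sub>R f s"]
  by (simp add: set_lebesgue_integral_def)

lemma square_integrable_locally_integrable:
  assumes "square_integrable f"
  shows "locally_integrable f"
  unfolding locally_integrable_def
proof (intro conjI allI)
  show "f \<in> borel_measurable borel"
    using square_integrable_measurable[OF assms] by simp
  show "set_integrable lborel {a..b} f" for a b
    by (cases "a \<le> b") (auto intro: set_integral_cmod_le[OF assms])
qed

text \<open>The set where the functions differ is open and null, hence empty.\<close>

lemma continuous_AE_eq:
  fixes F G :: "real \<Rightarrow> complex"
  assumes F: "continuous_on UNIV F" and G: "continuous_on UNIV G" and "AE s in lborel. F s = G s"
  shows "F = G"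
proof -
  have op: "open {s. F s \<noteq> G s}"
    by (intro open_Collect_neq F G)
  have "{s. F s \<noteq> G s} \<in> null_sets lborel"
  proof (rule null_setsI)
    show "emeasure lborel {s. F s \<noteq> G s} = 0"
      using assms(3) op by (subst (asm) AE_iff_measurable[OF _ refl]) auto
  qed (use op in simp)
  then have "negligible {s. F s \<noteq> G s}"
    using null_sets_completionI negligible_iff_null_sets by blast
  then have "{s. F s \<noteq> G s} = {}"
    using op open_not_negligible by blast
  then show ?thesis
    by auto
qed

lemma has_weak_derivative_abs_L2:
  assumes "square_integrable f" "square_integrable g"
  shows "has_weak_derivative (abs_L2 f) (abs_L2 g) \<longleftrightarrow>
    (\<forall>\<psi>. test_function \<psi> \<longrightarrow> (LINT s|lborel. f s * complex_of_real (deriv \<psi> s)) =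
        - (LINT s|lborel. g s * complex_of_real (\<psi> s)))"
  using assms by (intro has_weak_derivative.abs_eq L2_rel_refl)

lemma has_weak_derivativeI:
  assumes "square_integrable F" "square_integrable f" "is_primitive F f"
  shows "has_weak_derivative (abs_L2 F) (abs_L2 f)"
  using is_primitive_weak[OF assms(3)] by (simp add: has_weak_derivative_abs_L2 assms)

lemma has_weak_derivative_unique:
  assumes "has_weak_derivative u v" "has_weak_derivative u w"
  shows "v = w"
proof -
  obtain f g k where f: "square_integrable f" "u = abs_L2 f" and g: "square_integrable g" "v = abs_L2 g"
    and k: "square_integrable k" "w = abs_L2 k"
    by (metis L2_cases)
  have "AE s in lborel. g s - k s = 0"
  proof (rule fundamental_lemma)
    show "locally_integrable (\<lambda>s. g s - k s)"
      by (intro square_integrable_locally_integrable square_integrable_diff g k)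
    fix \<psi> assume \<psi>: "test_function \<psi>"
    have i: "integrable lborel (\<lambda>s. g s * complex_of_real (\<psi> s))" "integrable lborel (\<lambda>s. k s * complex_of_real (\<psi> s))"
      by (intro locally_integrable_test_mult square_integrable_locally_integrable g k \<psi>)+
    have "(LINT s|lborel. g s * complex_of_real (\<psi> s)) = (LINT s|lborel. k s * complex_of_real (\<psi> s))"
      using assms \<psi> unfolding f g k
      by (simp add: has_weak_derivative_abs_L2 f g k)
    then show "(LINT s|lborel. (g s - k s) * complex_of_real (\<psi> s)) = 0"
      using i by (simp add: left_diff_distrib)
  qed
  then show ?thesis
    unfolding g k by (subst abs_L2_eq_iff) (auto simp: g k)
qed

lemma weak_deriv_eq: "has_weak_derivative u v \<Longrightarrow> weak_deriv u = v"
  unfolding weak_deriv_def by (blast intro: has_weak_derivative_unique)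

text \<open>\<open>f\<close> minus an indefinite integral \<open>G\<close> of \<open>g\<close> has
  vanishing weak derivative, so it is almost everywhere a constant; adding this constant to
  \<open>G\<close> gives the representative.\<close>

lemma has_weak_derivative_primitive:
  assumes f: "square_integrable f" and g: "square_integrable g"
    and w: "has_weak_derivative (abs_L2 f) (abs_L2 g)"
  obtains F where "square_integrable F" "abs_L2 F = abs_L2 f" "is_primitive F g"
proof -
  have lf: "locally_integrable f" and lg: "locally_integrable g"
    using f g by (auto intro: square_integrable_locally_integrable)
  obtain G where G: "is_primitive G g"
    using lg by (rule primitive_exists)
  have lG: "locally_integrable G"
    by (intro locally_integrable_continuous is_primitive_continuous[OF G])
  obtain c where c: "AE s in lborel. f s - G s = c"
  proof (rule du_Bois_Reymond)
    show "locally_integrable (\<lambda>s. f s - G s)"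
      using lf lG by (auto simp: locally_integrable_def)
    fix \<psi> assume \<psi>: "test_function \<psi>"
    note i = locally_integrable_test_mult[OF lf test_functionD(2)[OF \<psi>]]
      locally_integrable_test_mult[OF lG test_functionD(2)[OF \<psi>]]
    have "(LINT s|lborel. f s * complex_of_real (deriv \<psi> s)) = (LINT s|lborel. G s * complex_of_real (deriv \<psi> s))"
      using w \<psi> is_primitive_weak[OF G \<psi>] by (simp add: has_weak_derivative_abs_L2 f g)
    then show "(LINT s|lborel. (f s - G s) * complex_of_real (deriv \<psi> s)) = 0"
      using i by (simp add: left_diff_distrib)
  qed
  define F where "F s = G s + c" for s
  have F: "is_primitive F g"
    unfolding F_def by (rule is_primitive_add_const[OF G])
  have ae: "AE s in lborel. F s = f s"
    using c by eventually_elim (auto simp: F_def algebra_simps)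
  have mF: "F \<in> borel_measurable lborel"
    using is_primitive_measurable[OF F] by simp
  have "AE s in lborel. (cmod (f s))\<^sup>2 = (cmod (F s))\<^sup>2"
    using ae by eventually_elim simp
  then have "integrable lborel (\<lambda>s. (cmod (F s))\<^sup>2)"
    using f mF by (subst integrable_cong_AE[where g = "\<lambda>s. (cmod (f s))\<^sup>2"]) (auto simp: square_integrable_def)
  then have sF: "square_integrable F"
    using mF by (simp add: square_integrable_def)
  show thesis
    by (rule that[OF sF _ F]) (simp add: abs_L2_eq_iff sF f ae)
qed

section \<open>Continuous representatives and point evaluation\<close>

text \<open>Gives point values to a class modulo null sets. Uniqueness is
  \<open>continuous_AE_eq\<close>; for classes without a continuous representative the value is
  unspecified.\<close>

definition continuous_rep :: "L2 \<Rightarrow> real \<Rightarrow> complex" where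
  "continuous_rep u = (THE U. continuous_on UNIV U \<and> square_integrable U \<and> abs_L2 U = u)"

lemma continuous_rep_abs_L2:
  assumes "continuous_on UNIV U" "square_integrable U"
  shows "continuous_rep (abs_L2 U) = U"
  unfolding continuous_rep_def
proof (rule the_equality)
  show "V = U" if V: "continuous_on UNIV V \<and> square_integrable V \<and> abs_L2 V = abs_L2 U" for V
    using V assms abs_L2_eq_iff[of V U] by (intro continuous_AE_eq) auto
qed (use assms in auto)

lemma H1_cases:
  assumes "u \<in> H1"
  obtains U V where "square_integrable U" "square_integrable V" "u = abs_L2 U" "weak_deriv u = abs_L2 V"
    "is_primitive U V" "continuous_rep u = U"
proof -
  obtain v where v: "has_weak_derivative u v"
    using assms by (auto simp: H1_def)
  obtain f V where f: "square_integrable f" "u = abs_L2 f" and V: "square_integrable V" "v = abs_L2 V"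
    by (metis L2_cases)
  obtain U where U: "square_integrable U" "abs_L2 U = abs_L2 f" "is_primitive U V"
    using has_weak_derivative_primitive[OF f(1) V(1)] v f V by metis
  have "continuous_rep u = U"
    using continuous_rep_abs_L2[OF is_primitive_continuous[OF U(3)] U(1)] f U by simp
  then show thesis
    using that[OF U(1) V(1) _ _ U(3)] f U V weak_deriv_eq[OF v] by simp
qed

lemma continuous_rep:
  assumes "u \<in> H1"
  shows "square_integrable (continuous_rep u)" "abs_L2 (continuous_rep u) = u"
  using assms by (auto elim: H1_cases)

lemma is_primitive_continuous_rep:
  assumes "u \<in> H1" "weak_deriv u = abs_L2 V" "square_integrable V"
  shows "is_primitive (continuous_rep u) V"
proof -
  obtain W where W: "square_integrable W" "weak_deriv u = abs_L2 W" "is_primitive (continuous_rep u) W"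
    using assms(1) by (auto elim: H1_cases)
  have "AE s in lborel. W s = V s"
    using abs_L2_eq_iff[OF W(1) assms(3)] W(2) assms(2) by simp
  then show ?thesis
    by (rule is_primitive_cong_AE[OF W(3)]) (use square_integrable_measurable[OF assms(3)] in simp)
qed

lemma weak_deriv_abs_L2:
  assumes "square_integrable U" "square_integrable V" "is_primitive U V"
  shows "abs_L2 U \<in> H1" "weak_deriv (abs_L2 U) = abs_L2 V" "continuous_rep (abs_L2 U) = U"
  using has_weak_derivativeI[OF assms] continuous_rep_abs_L2[OF is_primitive_continuous[OF assms(3)] assms(1)]
  by (auto simp: H1_def weak_deriv_eq)

lemma H1_add:
  assumes "u \<in> H1" "v \<in> H1"
  shows "u + v \<in> H1" "weak_deriv (u + v) = weak_deriv u + weak_deriv v"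
    "continuous_rep (u + v) = (\<lambda>s. continuous_rep u s + continuous_rep v s)"
proof -
  obtain U U' where U: "square_integrable U" "square_integrable U'" "u = abs_L2 U" "weak_deriv u = abs_L2 U'"
    "is_primitive U U'" "continuous_rep u = U"
    using assms(1) by (rule H1_cases)
  obtain V V' where V: "square_integrable V" "square_integrable V'" "v = abs_L2 V" "weak_deriv v = abs_L2 V'"
    "is_primitive V V'" "continuous_rep v = V"
    using assms(2) by (rule H1_cases)
  have eq: "u + v = abs_L2 (\<lambda>s. U s + V s)" "weak_deriv u + weak_deriv v = abs_L2 (\<lambda>s. U' s + V' s)"
    using U V by (simp_all add: plus_abs_L2)
  show "u + v \<in> H1" "weak_deriv (u + v) = weak_deriv u + weak_deriv v"
    "continuous_rep (u + v) = (\<lambda>s. continuous_rep u s + continuous_rep v s)"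
    using weak_deriv_abs_L2[OF square_integrable_add[OF U(1) V(1)] square_integrable_add[OF U(2) V(2)]
        is_primitive_add[OF U(5) V(5)]]
    unfolding eq U(6) V(6) by simp_all
qed

lemma H1_scaleC:
  assumes "u \<in> H1"
  shows "c *\<^sub>C u \<in> H1" "weak_deriv (c *\<^sub>C u) = c *\<^sub>C weak_deriv u"
    "continuous_rep (c *\<^sub>C u) = (\<lambda>s. c * continuous_rep u s)"
proof -
  obtain U U' where U: "square_integrable U" "square_integrable U'" "u = abs_L2 U" "weak_deriv u = abs_L2 U'"
    "is_primitive U U'" "continuous_rep u = U"
    using assms(1) by (rule H1_cases)
  have eq: "c *\<^sub>C u = abs_L2 (\<lambda>s. c * U s)" "c *\<^sub>C weak_deriv u = abs_L2 (\<lambda>s. c * U' s)"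
    using U by (simp_all add: scaleC_abs_L2)
  show "c *\<^sub>C u \<in> H1" "weak_deriv (c *\<^sub>C u) = c *\<^sub>C weak_deriv u"
    "continuous_rep (c *\<^sub>C u) = (\<lambda>s. c * continuous_rep u s)"
    using weak_deriv_abs_L2[OF square_integrable_scale[OF U(1), of c] square_integrable_scale[OF U(2), of c]
        is_primitive_scale[OF U(5), of c]]
    unfolding eq U(6) by simp_all
qed

text \<open>The product \<open>cnj (U s) * V s\<close> and its density are both integrable, so
  \<open>integral_primitive_zero\<close> disposes of the boundary terms at infinity.\<close>

lemma H1_integration_by_parts:
  assumes "u \<in> H1" "v \<in> H1"
  shows "cinner u (weak_deriv v) = - cinner (weak_deriv u) v"
proof -
  obtain U U' where U: "square_integrable U" "square_integrable U'" "u = abs_L2 U" "weak_deriv u = abs_L2 U'"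
    "is_primitive U U'"
    using assms(1) by (rule H1_cases)
  obtain V V' where V: "square_integrable V" "square_integrable V'" "v = abs_L2 V" "weak_deriv v = abs_L2 V'"
    "is_primitive V V'"
    using assms(2) by (rule H1_cases)
  have "is_primitive (\<lambda>s. cnj (U s) * V s) (\<lambda>s. cnj (U' s) * V s + cnj (U s) * V' s)"
    by (intro is_primitive_mult is_primitive_cnj U V)
  then have "(LINT s|lborel. cnj (U' s) * V s + cnj (U s) * V' s) = 0"
    by (rule integral_primitive_zero)
      (intro integrable_cnj_mult Bochner_Integration.integrable_add U V)+
  then have "cinner (weak_deriv u) v + cinner u (weak_deriv v) = 0"
    using U V by (simp add: cinner_abs_L2 integrable_cnj_mult)
  then show ?thesis
    by (simp add: add_eq_0_iff)
qed

lemma continuous_rep_increment_le: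
  assumes u: "u \<in> H1" and "a \<le> b"
  shows "cmod (continuous_rep u b - continuous_rep u a) \<le> sqrt (b - a) * norm (weak_deriv u)"
proof -
  obtain U V where U: "square_integrable V" "weak_deriv u = abs_L2 V" "is_primitive U V" "continuous_rep u = U"
    using u by (rule H1_cases)
  have "U b - U a = (LINT s:{a..b}|lborel. V s)"
    using is_primitiveD(4)[OF U(3) assms(2)] .
  then have "cmod (U b - U a) \<le> (LINT s:{a..b}|lborel. cmod (V s))"
    using set_integral_norm_bound' by simp
  also have "\<dots> \<le> sqrt (b - a) * norm (abs_L2 V)"
    by (rule set_integral_cmod_le[OF U(1) assms(2)])
  finally show ?thesis
    using U by simp
qed

text \<open>The one-dimensional Sobolev embedding: on \<open>{0..1}\<close> the value at
  \<open>0\<close> differs from the others by at most the norm of the weak derivative, and averaging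
  over this interval of length one bounds the others by \<open>norm u\<close>.\<close>

lemma continuous_rep_at_0_le:
  assumes u: "u \<in> H1"
  shows "cmod (continuous_rep u 0) \<le> norm u + norm (weak_deriv u)"
proof -
  let ?U = "continuous_rep u"
  let ?d = "norm (weak_deriv u)"
  note U = continuous_rep[OF u]
  have le: "cmod (?U 0) - ?d \<le> cmod (?U s)" if s: "s \<in> {0..1}" for s
  proof -
    have "cmod (?U s - ?U 0) \<le> sqrt (s - 0) * ?d"
      using s by (intro continuous_rep_increment_le[OF u]) auto
    also have "\<dots> \<le> ?d"
      using s by (intro mult_left_le_one_le) auto
    finally have "cmod (?U s - ?U 0) \<le> ?d" .
    then show ?thesis
      using norm_triangle_ineq2[of "?U 0" "?U s"] norm_minus_commute[of "?U 0" "?U s"] by linarith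
  qed
  have "cmod (?U 0) - ?d = (LINT s:{0..1::real}|lborel. cmod (?U 0) - ?d)"
    by (simp add: set_lebesgue_integral_def)
  also have "\<dots> \<le> (LINT s:{0..1}|lborel. cmod (?U s))"
  proof (rule set_integral_mono)
    show "set_integrable lborel {0..1::real} (\<lambda>_. cmod (?U 0) - ?d)"
      by (intro borel_integrable_atLeastAtMost' continuous_intros)
    show "set_integrable lborel {0..1} (\<lambda>s. cmod (?U s))"
      using integrable_norm[OF set_integral_cmod_le(1)[OF U(1), of 0 1, unfolded set_integrable_def]]
      by (simp add: set_integrable_def)
  qed (rule le)
  also have "\<dots> \<le> norm u"
    using set_integral_cmod_le(2)[OF U(1), of 0 1] by (simp add: U)
  finally show ?thesis
    by simp
qed

lemma square_integrable_test_function: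
  assumes "test_function \<psi>"
  shows "square_integrable (\<lambda>s. complex_of_real (\<psi> s))"
proof -
  have "test_function (\<lambda>s. \<psi> s * \<psi> s)"
    using assms by (intro test_function_mult) (auto simp: test_function_iff)
  then have "integrable lborel (\<lambda>s. \<psi> s * \<psi> s)"
    by (rule test_functionD)
  then show ?thesis
    using test_functionD(5)[OF assms]
    by (simp add: square_integrable_def power2_eq_square)
qed

lemma weak_deriv_test_function:
  assumes "test_function \<psi>"
  shows "abs_L2 (\<lambda>s. complex_of_real (\<psi> s)) \<in> H1"
    "weak_deriv (abs_L2 (\<lambda>s. complex_of_real (\<psi> s))) = abs_L2 (\<lambda>s. complex_of_real (deriv \<psi> s))"
  by (rule weak_deriv_abs_L2[OF square_integrable_test_function[OF assms]
        square_integrable_test_function[OF test_functionD(2)[OF assms]] is_primitive_test_function[OF assms]])+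

text \<open>Conjugation turns the defining integrals into inner products with elements of
  \<open>H1\<close>, the form in which the adjoint identity delivers weak derivatives.\<close>

lemma has_weak_derivative_iff_cinner:
  "has_weak_derivative u v \<longleftrightarrow> (\<forall>\<psi>. test_function \<psi> \<longrightarrow>
     cinner u (abs_L2 (\<lambda>s. complex_of_real (deriv \<psi> s))) = - cinner v (abs_L2 (\<lambda>s. complex_of_real (\<psi> s))))"
proof -
  obtain f g where f: "square_integrable f" "u = abs_L2 f" and g: "square_integrable g" "v = abs_L2 g"
    by (metis L2_cases)
  have *: "cnj (LINT s|lborel. k s * complex_of_real (\<psi> s)) = cinner (abs_L2 k) (abs_L2 (\<lambda>s. complex_of_real (\<psi> s)))"
    if "square_integrable k" "test_function \<psi>" for k \<psi>
  proof -
    have "(LINT s|lborel. cnj (k s * complex_of_real (\<psi> s))) = cnj (LINT s|lborel. k s * complex_of_real (\<psi> s))"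
      by (rule Bochner_Integration.integral_cnj)
    then show ?thesis
      by (simp add: cinner_abs_L2 that square_integrable_test_function)
  qed
  have "((LINT s|lborel. f s * complex_of_real (deriv \<psi> s)) = - (LINT s|lborel. g s * complex_of_real (\<psi> s)))
     \<longleftrightarrow> cinner u (abs_L2 (\<lambda>s. complex_of_real (deriv \<psi> s))) = - cinner v (abs_L2 (\<lambda>s. complex_of_real (\<psi> s)))"
    if "test_function \<psi>" for \<psi>
    using *[OF f(1) test_functionD(2)[OF that]] *[OF g(1) that] unfolding f(2) g(2)
    by (metis complex_cnj_cancel_iff complex_cnj_minus)
  then show ?thesis
    unfolding f(2) g(2) by (simp add: has_weak_derivative_abs_L2 f g)
qed

text \<open>A class orthogonal to all test functions is a weak derivative of \<open>0\<close>, and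
  weak derivatives are unique.\<close>

lemma L2_zero_if_orthogonal_test_functions:
  assumes "\<And>\<psi>. test_function \<psi> \<Longrightarrow> cinner (abs_L2 (\<lambda>s. complex_of_real (\<psi> s))) y = 0"
  shows "y = 0"
proof -
  have "cinner y (abs_L2 (\<lambda>s. complex_of_real (\<psi> s))) = 0" if "test_function \<psi>" for \<psi>
    using assms[OF that] cinner_commute[of y] by simp
  then have "has_weak_derivative 0 y"
    by (simp add: has_weak_derivative_iff_cinner)
  moreover have "has_weak_derivative 0 0"
    by (simp add: has_weak_derivative_iff_cinner)
  ultimately show ?thesis
    by (rule has_weak_derivative_unique)
qed


section \<open>Dirac operators on the line\<close>

lemma mult_op_abs_L2:
  assumes "a \<in> borel_measurable borel" "bounded (range a)" "square_integrable f"
  shows "square_integrable (\<lambda>s. complex_of_real (a s) * f s)"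
    and "mult_op a (abs_L2 f) = abs_L2 (\<lambda>s. complex_of_real (a s) * f s)"
proof -
  obtain C where "\<And>s. \<bar>a s\<bar> \<le> C"
    using assms(2) by (auto simp: bounded_iff)
  then show "square_integrable (\<lambda>s. complex_of_real (a s) * f s)"
    using assms(1) square_integrable_measurable[OF assms(3)]
    by (intro square_integrable_bound[OF assms(3), where C = C]) (auto simp: norm_mult mult_right_mono)
  show "mult_op a (abs_L2 f) = abs_L2 (\<lambda>s. complex_of_real (a s) * f s)"
    using mult_op.abs_eq[OF L2_rel_refl[OF assms(3)], of a] assms by simp
qed

lemma norm_abs_L2_le:
  assumes "square_integrable f" "square_integrable g" "\<And>s. cmod (f s) \<le> C * cmod (g s)" "0 \<le> C"
  shows "norm (abs_L2 f) \<le> C * norm (abs_L2 g)"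
proof -
  have "(norm (abs_L2 f))\<^sup>2 \<le> (LINT s|lborel. C\<^sup>2 * (cmod (g s))\<^sup>2)"
    unfolding norm_abs_L2[OF assms(1)]
  proof (rule integral_mono)
    show "(cmod (f s))\<^sup>2 \<le> C\<^sup>2 * (cmod (g s))\<^sup>2" for s
      using power_mono[OF assms(3), of s 2] by (simp add: power_mult_distrib)
  qed (use assms in \<open>simp_all add: square_integrable_def\<close>)
  also have "\<dots> = (C * norm (abs_L2 g))\<^sup>2"
    by (simp add: norm_abs_L2 assms power_mult_distrib)
  finally show ?thesis
    using assms(4) by (rule power2_le_imp_le[OF _ mult_nonneg_nonneg]) simp
qed

lemma norm_mult_op_le:
  assumes "a \<in> borel_measurable borel" "\<And>s. \<bar>a s\<bar> \<le> C"
  shows "norm (mult_op a u) \<le> C * norm u"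
proof -
  obtain f where f: "square_integrable f" "u = abs_L2 f"
    by (rule L2_cases)
  have b: "bounded (range a)"
    using assms(2) by (auto simp: bounded_iff)
  have "0 \<le> C"
    using assms(2)[of 0] by linarith
  then show ?thesis
    unfolding f(2) mult_op_abs_L2(2)[OF assms(1) b f(1)] using assms(2)
    by (intro norm_abs_L2_le mult_op_abs_L2(1)[OF assms(1) b] f(1)) (auto simp: norm_mult intro: mult_right_mono)
qed

lemma mult_op_linear:
  assumes a: "a \<in> borel_measurable borel" "bounded (range a)"
  shows "mult_op a (u + v) = mult_op a u + mult_op a v"
    and "mult_op a (c *\<^sub>C u) = c *\<^sub>C mult_op a u"
    and "cinner (mult_op a u) v = cinner u (mult_op a v)"
proof -
  obtain f g where f: "square_integrable f" "u = abs_L2 f" and g: "square_integrable g" "v = abs_L2 g"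
    by (metis L2_cases)
  note [simp] = mult_op_abs_L2[OF a] f g plus_abs_L2 scaleC_abs_L2 cinner_abs_L2
    square_integrable_add square_integrable_scale
  show "mult_op a (u + v) = mult_op a u + mult_op a v"
    by (simp add: distrib_left)
  show "mult_op a (c *\<^sub>C u) = c *\<^sub>C mult_op a u"
    by (simp add: mult.left_commute)
  show "cinner (mult_op a u) v = cinner u (mult_op a v)"
    by (simp add: mult.assoc mult.left_commute)
qed

lemma mult_op_diff_functions:
  assumes "a \<in> borel_measurable borel" "bounded (range a)" "b \<in> borel_measurable borel" "bounded (range b)"
  shows "mult_op (\<lambda>s. a s - b s) u = mult_op a u - mult_op b u"
proof -
  obtain f where f: "square_integrable f" "u = abs_L2 f"
    by (rule L2_cases)
  have ab: "(\<lambda>s. a s - b s) \<in> borel_measurable borel" "bounded (range (\<lambda>s. a s - b s))"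
    using assms by (auto intro: bounded_minus_comp)
  show ?thesis
    unfolding f(2) mult_op_abs_L2(2)[OF ab f(1)] mult_op_abs_L2(2)[OF assms(1,2) f(1)]
      mult_op_abs_L2(2)[OF assms(3,4) f(1)]
    by (simp add: diff_abs_L2 mult_op_abs_L2(1)[OF _ _ f(1)] assms left_diff_distrib)
qed

lemma mult_op_const: "mult_op (\<lambda>_. c) u = complex_of_real c *\<^sub>C u"
proof -
  obtain f where f: "square_integrable f" "u = abs_L2 f"
    by (rule L2_cases)
  show ?thesis
    unfolding f(2) by (subst mult_op_abs_L2(2)) (auto simp: f scaleC_abs_L2)
qed

lemma H1_zero: "0 \<in> H1" "weak_deriv 0 = 0"
proof -
  have "has_weak_derivative 0 0"
    by (simp add: has_weak_derivative_iff_cinner)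
  then show "0 \<in> H1" "weak_deriv 0 = 0"
    by (auto simp: H1_def weak_deriv_eq)
qed

section \<open>Self-adjointness on the Sobolev domain\<close>

definition dirac :: "(real \<Rightarrow> real) \<Rightarrow> (real \<Rightarrow> real) \<Rightarrow> L2 \<times> L2 \<Rightarrow> L2 \<times> L2" where
  "dirac a b = (\<lambda>(u, v). (mult_op a u - weak_deriv v, weak_deriv u + mult_op b v))"

lemma closure_subspace:
  fixes S :: "'a::complex_inner set"
  assumes "complex_vector.subspace S"
  shows "complex_vector.subspace (closure S)"
proof (rule complex_vector.subspaceI)
  show "0 \<in> closure S"
    using complex_vector.subspace_0[OF assms] closure_subset by blast
  show "x + y \<in> closure S" if xy: "x \<in> closure S" "y \<in> closure S" for x y
  proof -
    obtain f g where "\<And>n. f n \<in> S" "f \<longlonglongrightarrow> x" "\<And>n. g n \<in> S" "g \<longlonglongrightarrow> y"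
      using xy unfolding closure_sequential by blast
    then show ?thesis
      unfolding closure_sequential
      by (intro exI[of _ "\<lambda>n. f n + g n"])
         (auto intro: tendsto_add complex_vector.subspace_add[OF assms])
  qed
  show "c *\<^sub>C x \<in> closure S" if x: "x \<in> closure S" for c x
  proof -
    obtain f where "\<And>n. f n \<in> S" "f \<longlonglongrightarrow> x"
      using x unfolding closure_sequential by blast
    then show ?thesis
      unfolding closure_sequential
      by (intro exI[of _ "\<lambda>n. c *\<^sub>C f n"])
         (auto intro: tendsto_scaleC complex_vector.subspace_scale[OF assms])
  qed
qed

lemma subspace_h_domain: "complex_vector.subspace h_domain"
  by (rule complex_vector.subspaceI)
     (auto simp: h_domain_def zero_prod_def scaleC_prod_def H1_zero H1_add H1_scaleC)

text \<open>A closure that is not everything has a nonzero orthogonal vector; pairs with one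
  component \<open>0\<close> and a test function in the other annihilate both of its
  entries.\<close>

lemma dense_h_domain: "closure h_domain = UNIV"
proof (rule ccontr)
  assume "closure h_domain \<noteq> UNIV"
  then obtain y where y: "y \<noteq> 0" "\<forall>t\<in>closure h_domain. cinner t y = 0"
    using proper_closed_subspace_orthogonal[OF closure_subspace[OF subspace_h_domain] closed_closure] by blast
  have *: "cinner t y = 0" if "t \<in> h_domain" for t
    using y(2) that closure_subset by blast
  have "fst y = 0"
  proof (rule L2_zero_if_orthogonal_test_functions)
    fix \<psi> assume \<psi>: "test_function \<psi>"
    show "cinner (abs_L2 (\<lambda>s. complex_of_real (\<psi> s))) (fst y) = 0"
      using *[of "(abs_L2 (\<lambda>s. complex_of_real (\<psi> s)), 0)"] weak_deriv_test_function(1)[OF \<psi>]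
      by (simp add: h_domain_def cinner_prod_def H1_zero)
  qed
  moreover have "snd y = 0"
  proof (rule L2_zero_if_orthogonal_test_functions)
    fix \<psi> assume \<psi>: "test_function \<psi>"
    show "cinner (abs_L2 (\<lambda>s. complex_of_real (\<psi> s))) (snd y) = 0"
      using *[of "(0, abs_L2 (\<lambda>s. complex_of_real (\<psi> s)))"] weak_deriv_test_function(1)[OF \<psi>]
      by (simp add: h_domain_def cinner_prod_def H1_zero)
  qed
  ultimately show False
    using y(1) by (simp add: prod_eq_iff)
qed

theorem self_adjoint_dirac:
  assumes a: "a \<in> borel_measurable borel" "bounded (range a)"
    and b: "b \<in> borel_measurable borel" "bounded (range b)"
  shows "self_adjoint h_domain (dirac a b)"
proof (rule self_adjointI)
  note A = mult_op_linear[OF a] and B = mult_op_linear[OF b]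
  show "clinear_on h_domain (dirac a b)"
    unfolding clinear_on_def
    by (auto simp: subspace_h_domain[unfolded h_domain_def] h_domain_def dirac_def scaleC_prod_def A B H1_add H1_scaleC
        scaleC_add_right complex_vector.scale_right_diff_distrib)
  show "closure h_domain = UNIV"
    by (rule dense_h_domain)
  show "cinner x (dirac a b y) = cinner (dirac a b x) y" if xy0: "x \<in> h_domain" "y \<in> h_domain" for x y
  proof -
    obtain u v u' v' where xy: "x = (u, v)" "y = (u', v')" and H: "u \<in> H1" "v \<in> H1" "u' \<in> H1" "v' \<in> H1"
      using xy0 by (auto simp: h_domain_def)
    \<comment> \<open>The off-diagonal entries carry opposite signs, which compensates the sign in
      integration by parts.\<close>
    show ?thesis
      using H1_integration_by_parts[OF H(1,4)] H1_integration_by_parts[OF H(2,3)]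
      by (simp add: xy dirac_def cinner_prod_def cinner_add_left cinner_add_right cinner_diff_left
          cinner_diff_right A B)
  qed
  fix y z assume yz: "\<And>x. x \<in> h_domain \<Longrightarrow> cinner y (dirac a b x) = cinner z x"
  have zero [simp]: "mult_op a 0 = 0" "mult_op b 0 = 0"
    using A(2)[of 0 0] B(2)[of 0 0] by simp_all
  let ?\<psi> = "\<lambda>\<psi>. abs_L2 (\<lambda>s. complex_of_real (\<psi> s))"
  \<comment> \<open>A test pair with second entry \<open>0\<close> pairs \<open>snd y\<close> with
    the derivative of the test function, so it determines the weak derivative of
    \<open>snd y\<close>; the other kind of pair determines that of \<open>fst y\<close>.\<close>
  have "has_weak_derivative (snd y) (mult_op a (fst y) - fst z)"
    unfolding has_weak_derivative_iff_cinner
  proof (intro allI impI)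
    fix \<psi> assume \<psi>: "test_function \<psi>"
    show "cinner (snd y) (?\<psi> (deriv \<psi>)) = - cinner (mult_op a (fst y) - fst z) (?\<psi> \<psi>)"
      using yz[of "(?\<psi> \<psi>, 0)"] weak_deriv_test_function[OF \<psi>]
      by (simp add: h_domain_def dirac_def cinner_prod_def H1_zero cinner_diff_left A(3) algebra_simps)
  qed
  moreover have "has_weak_derivative (fst y) (snd z - mult_op b (snd y))"
    unfolding has_weak_derivative_iff_cinner
  proof (intro allI impI)
    fix \<psi> assume \<psi>: "test_function \<psi>"
    have "- cinner (fst y) (?\<psi> (deriv \<psi>)) + cinner (snd y) (mult_op b (?\<psi> \<psi>)) = cinner (snd z) (?\<psi> \<psi>)"
      using yz[of "(0, ?\<psi> \<psi>)"] weak_deriv_test_function[OF \<psi>]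
      by (simp add: h_domain_def dirac_def cinner_prod_def H1_zero cinner_minus_right)
    then show "cinner (fst y) (?\<psi> (deriv \<psi>)) = - cinner (snd z - mult_op b (snd y)) (?\<psi> \<psi>)"
      by (simp add: cinner_diff_left B(3) algebra_simps)
  qed
  ultimately show "y \<in> h_domain"
    by (cases y) (auto simp: h_domain_def H1_def)
qed

section \<open>Auxiliary estimates: Gronwall's inequality and cut-off potentials\<close>

text \<open>With \<open>y\<close> the right-hand side of \<open>le\<close>, the function
  \<open>exp (- (L * t)) * y t\<close> has derivative
  \<open>exp (- (L * t)) * (L * (n t - y t))\<close>, which is nonpositive.\<close>

lemma Gronwall:
  fixes n :: "real \<Rightarrow> real"
  assumes cont: "continuous_on {0..R} n" and "0 \<le> L"
    and le: "\<And>s. s \<in> {0..R} \<Longrightarrow> n s \<le> c + L * integral {0..s} n" and s: "s \<in> {0..R}"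
  shows "n s \<le> c * exp (L * s)"
proof -
  define y where "y t = c + L * integral {0..t} n" for t
  have "exp (- (L * s)) * y s \<le> exp (- (L * 0)) * y 0"
  proof (rule DERIV_nonpos_imp_decreasing_open[where f = "\<lambda>t. exp (- (L * t)) * y t"])
    show "0 \<le> s"
      using s by simp
    have "n integrable_on {0..s}"
      using cont s by (intro integrable_continuous_interval) (auto intro: continuous_on_subset)
    then show "continuous_on {0..s} (\<lambda>t. exp (- (L * t)) * y t)"
      unfolding y_def by (intro continuous_intros indefinite_integral_continuous_1)
    fix t assume t: "0 < t" "t < s"
    have "((\<lambda>t. integral {0..t} n) has_real_derivative n t) (at t within {0..R})"
      using cont t s by (intro integral_has_real_derivative) auto
    then have "((\<lambda>t. integral {0..t} n) has_real_derivative n t) (at t)"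
      using t s by (simp add: at_within_Icc_at)
    then have "((\<lambda>t. exp (- (L * t)) * y t) has_real_derivative exp (- (L * t)) * (L * (n t - y t))) (at t)"
      unfolding y_def by (auto intro!: derivative_eq_intros simp: algebra_simps)
    moreover have "exp (- (L * t)) * (L * (n t - y t)) \<le> 0"
      using le[of t] t s \<open>0 \<le> L\<close> by (intro mult_nonneg_nonpos) (auto simp: y_def)
    ultimately show "\<exists>z. ((\<lambda>t. exp (- (L * t)) * y t) has_real_derivative z) (at t) \<and> z \<le> 0"
      by blast
  qed
  then have "exp (- (L * s)) * y s \<le> c"
    by (simp add: y_def)
  then have "y s \<le> c * exp (L * s)"
    by (simp add: exp_minus divide_simps mult.commute)
  then show ?thesis
    using le[OF s] by (simp add: y_def)
qed

lemma norm_Pair_ge: "norm x \<le> norm (x, y)" "norm y \<le> norm (x, y)"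
  and norm_Pair_le: "norm (x, y) \<le> norm x + norm y"
  by (simp_all add: norm_Pair real_le_rsqrt sqrt_sum_squares_le_sum)

lemma norm_Pair_mono:
  assumes "norm x \<le> c * norm x'" "norm y \<le> c * norm y'" "0 \<le> c"
  shows "norm (x, y) \<le> c * norm (x', y')"
proof -
  have "norm (x, y) \<le> sqrt ((c * norm x')\<^sup>2 + (c * norm y')\<^sup>2)"
    unfolding norm_Pair using assms by (intro real_sqrt_le_mono add_mono power_mono) auto
  also have "\<dots> = c * norm (x', y')"
    using assms(3) by (simp add: norm_Pair power_mult_distrib real_sqrt_mult flip: distrib_left)
  finally show ?thesis .
qed

text \<open>The product is bounded pointwise by \<open>B * S\<close> times the indicator of an
  interval of length \<open>2 * R\<close>.\<close>

lemma norm_mult_op_cutoff_le: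
  assumes V: "V \<in> borel_measurable borel" "\<And>s. \<bar>V s\<bar> \<le> B" and U: "square_integrable U"
    and S: "\<And>s. \<bar>s\<bar> \<le> R \<Longrightarrow> cmod (U s) \<le> S" and "0 \<le> R"
  shows "norm (mult_op (\<lambda>s. indicator {-R..R} s * V s) (abs_L2 U)) \<le> B * S * sqrt (2 * R)"
proof -
  have "0 \<le> S" "0 \<le> B"
    using S[of 0] V(2)[of 0] \<open>0 \<le> R\<close> norm_ge_zero[of "U 0"] by linarith+
  have cut: "(\<lambda>s. indicator {-R..R} s * V s) \<in> borel_measurable borel"
    "bounded (range (\<lambda>s. indicator {-R..R} s * V s))"
  proof -
    show "(\<lambda>s. indicator {-R..R} s * V s) \<in> borel_measurable borel"
      using V(1) by measurable
    have "\<bar>indicator {-R..R} s * V s\<bar> \<le> B" for s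
      using V(2)[of s] \<open>0 \<le> B\<close> by (simp add: indicator_def)
    then show "bounded (range (\<lambda>s. indicator {-R..R} s * V s))"
      by (auto simp: bounded_iff)
  qed
  have "-R \<le> R"
    using \<open>0 \<le> R\<close> by simp
  note ind = square_integrable_indicator[OF this]
  have "norm (mult_op (\<lambda>s. indicator {-R..R} s * V s) (abs_L2 U))
      \<le> (B * S) * norm (abs_L2 (\<lambda>s. complex_of_real (indicator {-R..R} s)))"
    unfolding mult_op_abs_L2(2)[OF cut U]
  proof (rule norm_abs_L2_le[OF mult_op_abs_L2(1)[OF cut U] ind(1)])
    fix s
    show "cmod (complex_of_real (indicator {-R..R} s * V s) * U s)
        \<le> B * S * cmod (complex_of_real (indicator {-R..R} s))"
      using S[of s] V(2)[of s] \<open>0 \<le> B\<close>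
      by (auto simp: norm_mult indicator_def intro!: mult_mono)
  qed (use \<open>0 \<le> S\<close> \<open>0 \<le> B\<close> in simp)
  then show ?thesis
    by (simp add: ind(2))
qed

section \<open>Dirac operators with a decaying potential\<close>

text \<open>\<open>decay_V\<close> serves the gap, where the tail of the potential must be small;
  \<open>square_integrable_V\<close> serves the plane waves, whose product with the potential must
  stay bounded in norm.\<close>

locale dirac_decaying_potential =
  fixes m :: real and V :: "real \<Rightarrow> real"
  assumes mass_pos: "m > 0"
    and measurable_V: "V \<in> borel_measurable borel"
    and bounded_V: "bounded (range V)"
    and decay_V: "\<And>\<epsilon>. \<epsilon> > 0 \<Longrightarrow> \<exists>R. \<forall>s. \<bar>s\<bar> > R \<longrightarrow> \<bar>V s\<bar> \<le> \<epsilon>"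
    and square_integrable_V: "square_integrable (\<lambda>s. complex_of_real (V s))"
begin

definition A :: "L2 \<times> L2 \<Rightarrow> L2 \<times> L2" where
  "A = dirac (\<lambda>s. m - V s) (\<lambda>s. - m - V s)"

lemma coefficients:
  "(\<lambda>s. m - V s) \<in> borel_measurable borel" "bounded (range (\<lambda>s. m - V s))"
  "(\<lambda>s. - m - V s) \<in> borel_measurable borel" "bounded (range (\<lambda>s. - m - V s))"
  using measurable_V bounded_V by (auto intro!: bounded_minus_comp)

sublocale self_adjoint_operator h_domain A
  by unfold_locales (auto simp: A_def intro: self_adjoint_dirac coefficients)

lemma A_eq:
  "A (u, v) = (complex_of_real m *\<^sub>C u - mult_op V u - weak_deriv v,
    weak_deriv u - complex_of_real m *\<^sub>C v - mult_op V v)"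
proof -
  have "mult_op (\<lambda>s. c - V s) w = complex_of_real c *\<^sub>C w - mult_op V w" for c w
    using mult_op_diff_functions[of "\<lambda>_. c" V w] measurable_V bounded_V by (simp add: mult_op_const)
  from this[of m] this[of "- m"] show ?thesis
    by (simp add: A_def dirac_def complex_vector.scale_minus_left)
qed

text \<open>The data at the origin of the first-order system behind the operator, in a
  finite-dimensional space where bounded sequences have convergent subsequences.\<close>

definition initial_value :: "L2 \<times> L2 \<Rightarrow> complex \<times> complex" where
  "initial_value = (\<lambda>(u, v). (continuous_rep u 0, continuous_rep v 0))"

lemma initial_value_diff:
  assumes "x \<in> h_domain" "y \<in> h_domain"
  shows "initial_value (x - y) = initial_value x - initial_value y"
proof -
  have "continuous_rep (u - v) = (\<lambda>s. continuous_rep u s - continuous_rep v s)" if "u \<in> H1" "v \<in> H1" for u v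
    using H1_add(3)[OF that(1) H1_scaleC(1)[OF that(2), of "- 1"]] H1_scaleC(3)[OF that(2), of "- 1"]
    by (simp add: scaleC_minus1)
  then show ?thesis
    using assms by (auto simp: initial_value_def h_domain_def)
qed

lemma initial_value_scale:
  "x \<in> h_domain \<Longrightarrow> initial_value (c *\<^sub>C x) = (c * fst (initial_value x), c * snd (initial_value x))"
  by (auto simp: initial_value_def h_domain_def scaleC_prod_def H1_scaleC)

text \<open>The resolvent equation expresses both weak derivatives by \<open>x\<close> and its
  residual, and \<open>continuous_rep_at_0_le\<close> then bounds the point values.\<close>

lemma initial_value_bound:
  obtains K where "\<And>x. x \<in> h_domain \<Longrightarrow>
    norm (initial_value x) \<le> K * (norm x + norm (A x - complex_of_real l *\<^sub>C x))"
proof -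
  obtain B where B: "\<And>s. \<bar>V s\<bar> \<le> B"
    using bounded_V by (auto simp: bounded_iff)
  have B0: "0 \<le> B"
    using B[of 0] by linarith
  \<comment> \<open>\<open>L\<close> bounds the sum of all zero-order terms when the equation is
    solved for the derivatives.\<close>
  define L where "L = m + B + \<bar>l\<bar>"
  have "norm (initial_value x) \<le> (2 + 2 * L) * (norm x + norm (A x - complex_of_real l *\<^sub>C x))"
    if "x \<in> h_domain" for x
  proof -
    obtain u v where x: "x = (u, v)" and H: "u \<in> H1" "v \<in> H1"
      using \<open>x \<in> h_domain\<close> by (auto simp: h_domain_def)
    define y where "y = A x - complex_of_real l *\<^sub>C x"
    have y: "weak_deriv v = complex_of_real m *\<^sub>C u - mult_op V u - complex_of_real l *\<^sub>C u - fst y"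
      "weak_deriv u = snd y + complex_of_real m *\<^sub>C v + mult_op V v + complex_of_real l *\<^sub>C v"
      by (simp_all add: y_def x A_eq scaleC_prod_def)
    have n: "norm (fst y) \<le> norm y" "norm (snd y) \<le> norm y" "norm u \<le> norm x" "norm v \<le> norm x"
      using norm_Pair_ge[where x = "fst y" and y = "snd y"] norm_Pair_ge[where x = u and y = v]
      by (simp_all add: x)
    have bd: "norm (complex_of_real m *\<^sub>C w) \<le> m * norm x" "norm (complex_of_real l *\<^sub>C w) \<le> \<bar>l\<bar> * norm x"
      "norm (mult_op V w) \<le> B * norm x" if "norm w \<le> norm x" for w
      using that mass_pos norm_mult_op_le[OF measurable_V B, of w] mult_left_mono[OF that B0]
      by (auto simp: norm_scaleC intro!: mult_left_mono)
    have "norm (weak_deriv v) \<le> norm (complex_of_real m *\<^sub>C u) + norm (mult_op V u)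
        + norm (complex_of_real l *\<^sub>C u) + norm (fst y)"
      unfolding y by (intro order_trans[OF norm_triangle_ineq4] add_mono order_refl)
    then have dv: "norm (weak_deriv v) \<le> norm y + L * norm x"
      using bd[OF n(3)] n by (simp add: L_def algebra_simps)
    have "norm (weak_deriv u) \<le> norm (snd y) + norm (complex_of_real m *\<^sub>C v) + norm (mult_op V v)
        + norm (complex_of_real l *\<^sub>C v)"
      unfolding y by (intro order_trans[OF norm_triangle_ineq] add_mono order_refl)
    then have du: "norm (weak_deriv u) \<le> norm y + L * norm x"
      using bd[OF n(4)] n by (simp add: L_def algebra_simps)
    have "norm (initial_value x) \<le> (norm u + norm (weak_deriv u)) + (norm v + norm (weak_deriv v))"
      unfolding initial_value_def x prod.case
      by (intro order_trans[OF norm_Pair_le] add_mono continuous_rep_at_0_le H)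
    also have "\<dots> \<le> (2 + 2 * L) * norm x + 2 * norm y"
      using du dv n by (simp add: algebra_simps)
    also have "\<dots> \<le> (2 + 2 * L) * norm x + (2 + 2 * L) * norm y"
      using mass_pos B0 by (intro add_left_mono mult_right_mono) (auto simp: L_def)
    finally show ?thesis
      by (simp add: y_def distrib_left)
  qed
  then show thesis
    by (rule that)
qed

text \<open>In the squared norm the mixed terms \<open>inner u (weak_deriv v)\<close> and
  \<open>inner v (weak_deriv u)\<close> cancel; what exceeds the square of
  \<open>m * norm (u, v)\<close> is the sum of the squared norms of the derivatives.\<close>

lemma free_operator_bound:
  assumes "u \<in> H1" "v \<in> H1"
  shows "m * norm (u, v) \<le>
    norm (complex_of_real m *\<^sub>C u - weak_deriv v, weak_deriv u - complex_of_real m *\<^sub>C v)"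
proof -
  have ibp: "inner u (weak_deriv v) = - inner (weak_deriv u) v"
    using H1_integration_by_parts[OF assms] by (simp add: inner_eq_Re_cinner)
  have sq: "(norm (m *\<^sub>R p - q))\<^sup>2 = m\<^sup>2 * (norm p)\<^sup>2 - 2 * m * inner p q + (norm q)\<^sup>2" for p q :: L2
    unfolding power2_norm_eq_inner
    by (simp add: inner_diff_left inner_diff_right inner_commute power2_eq_square algebra_simps)
  have "(norm (complex_of_real m *\<^sub>C u - weak_deriv v, weak_deriv u - complex_of_real m *\<^sub>C v))\<^sup>2
      = (norm (m *\<^sub>R u - weak_deriv v))\<^sup>2 + (norm (m *\<^sub>R v - weak_deriv u))\<^sup>2"
    by (simp add: norm_Pair norm_minus_commute flip: scaleR_eq_scaleC)
  also have "\<dots> = (m * norm (u, v))\<^sup>2 + ((norm (weak_deriv u))\<^sup>2 + (norm (weak_deriv v))\<^sup>2)"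
    unfolding sq using ibp by (simp add: norm_Pair power_mult_distrib inner_commute algebra_simps)
  finally have "(norm (complex_of_real m *\<^sub>C u - weak_deriv v, weak_deriv u - complex_of_real m *\<^sub>C v))\<^sup>2
      = (m * norm (u, v))\<^sup>2 + ((norm (weak_deriv u))\<^sup>2 + (norm (weak_deriv v))\<^sup>2)" .
  then have "(m * norm (u, v))\<^sup>2
      \<le> (norm (complex_of_real m *\<^sub>C u - weak_deriv v, weak_deriv u - complex_of_real m *\<^sub>C v))\<^sup>2"
    by simp
  then show ?thesis
    by (rule power2_le_imp_le) simp
qed

end


lemma primitive_increment_le:
  assumes P: "is_primitive U u" and g: "square_integrable g" and W: "continuous_on UNIV W"
    and bd: "\<And>s. cmod (u s) \<le> cmod (g s) + L * cmod (W s)" and "a \<le> b"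
  shows "cmod (U b - U a) \<le> sqrt (b - a) * norm (abs_L2 g) + L * integral {a..b} (\<lambda>s. cmod (W s))"
proof -
  have norm_int: "set_integrable lborel {a..b} (\<lambda>s. cmod (k s))" if "set_integrable lborel {a..b} k" for k :: "real \<Rightarrow> complex"
    using integrable_norm[OF that[unfolded set_integrable_def]] by (simp add: set_integrable_def)
  have ig: "set_integrable lborel {a..b} (\<lambda>s. cmod (g s))"
    by (rule norm_int[OF set_integral_cmod_le(1)[OF g \<open>a \<le> b\<close>]])
  have iW: "set_integrable lborel {a..b} (\<lambda>s. cmod (W s))"
    by (intro borel_integrable_atLeastAtMost' continuous_intros continuous_on_subset[OF W]) simp
  have iLW: "set_integrable lborel {a..b} (\<lambda>s. L * cmod (W s))"
    using iW by simp
  have "cmod (U b - U a) \<le> (LINT s:{a..b}|lborel. cmod (u s))"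
    using set_integral_norm_bound'[of "{a..b}" u] is_primitiveD(4)[OF P \<open>a \<le> b\<close>] by simp
  also have "\<dots> \<le> (LINT s:{a..b}|lborel. cmod (g s) + L * cmod (W s))"
    by (rule set_integral_mono[OF norm_int[OF is_primitiveD(2)[OF P]] set_integral_add(1)[OF ig iLW] bd])
  also have "\<dots> = (LINT s:{a..b}|lborel. cmod (g s)) + L * (LINT s:{a..b}|lborel. cmod (W s))"
    by (simp add: set_integral_add(2)[OF ig iLW])
  also have "\<dots> \<le> sqrt (b - a) * norm (abs_L2 g) + L * integral {a..b} (\<lambda>s. cmod (W s))"
    using set_integral_cmod_le(2)[OF g \<open>a \<le> b\<close>] set_borel_integral_eq_integral(2)[OF iW] by simp
  finally show ?thesis .
qed

lemma integrable_mult_square_integrable: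
  assumes "square_integrable f" "square_integrable g"
  shows "integrable lborel (\<lambda>s. f s * g s)"
proof -
  have [measurable]: "cnj \<in> borel_measurable borel"
    by (intro borel_measurable_continuous_onI continuous_intros)
  have "(\<lambda>s. cnj (f s)) \<in> borel_measurable lborel"
    using square_integrable_measurable[OF assms(1)] by measurable
  then have "square_integrable (\<lambda>s. cnj (f s))"
    by (rule square_integrable_bound[OF assms(1), where C = 1]) simp
  from integrable_cnj_mult[OF this assms(2)] show ?thesis
    by simp
qed

context dirac_decaying_potential
begin

text \<open>For the continuous representatives the operator equation is a first-order linear system
  whose matrix has zero diagonal; Gronwall's inequality and the Wronskian argument both start from
  it.\<close>

lemma resolvent_equation_components:
  assumes "(u, v) \<in> h_domain" and f: "square_integrable f" and g: "square_integrable g"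
    and eq: "A (u, v) - complex_of_real l *\<^sub>C (u, v) = (abs_L2 f, abs_L2 g)"
  shows "is_primitive (continuous_rep u) (\<lambda>s. g s + complex_of_real (m + V s + l) * continuous_rep v s)"
    and "is_primitive (continuous_rep v) (\<lambda>s. complex_of_real (m - V s - l) * continuous_rep u s - f s)"
proof -
  have H: "u \<in> H1" "v \<in> H1"
    using assms(1) by (auto simp: h_domain_def)
  define U W where "U = continuous_rep u" and "W = continuous_rep v"
  have UW: "square_integrable U" "square_integrable W" "u = abs_L2 U" "v = abs_L2 W"
    unfolding U_def W_def using continuous_rep H by simp_all
  note sq = square_integrable_add square_integrable_diff square_integrable_scale
    mult_op_abs_L2(1)[OF measurable_V bounded_V] UW(1,2) f g
  note abs = plus_abs_L2 diff_abs_L2 scaleC_abs_L2 mult_op_abs_L2(2)[OF measurable_V bounded_V]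
  have "weak_deriv v = complex_of_real m *\<^sub>C u - mult_op V u - complex_of_real l *\<^sub>C u - abs_L2 f"
    "weak_deriv u = abs_L2 g + complex_of_real m *\<^sub>C v + mult_op V v + complex_of_real l *\<^sub>C v"
    using eq by (auto simp: A_eq scaleC_prod_def algebra_simps)
  then have d: "weak_deriv v = abs_L2 (\<lambda>s. complex_of_real m * U s - complex_of_real (V s) * U s
      - complex_of_real l * U s - f s)"
    "weak_deriv u = abs_L2 (\<lambda>s. g s + complex_of_real m * W s + complex_of_real (V s) * W s
      + complex_of_real l * W s)"
    by (simp_all add: UW(3,4) sq abs)
  have "is_primitive U (\<lambda>s. g s + complex_of_real m * W s + complex_of_real (V s) * W s + complex_of_real l * W s)"
    unfolding U_def by (rule is_primitive_continuous_rep[OF H(1) d(2)]) (intro sq)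
  then show "is_primitive (continuous_rep u) (\<lambda>s. g s + complex_of_real (m + V s + l) * continuous_rep v s)"
    by (simp add: U_def W_def algebra_simps)
  have "is_primitive W (\<lambda>s. complex_of_real m * U s - complex_of_real (V s) * U s - complex_of_real l * U s - f s)"
    unfolding W_def by (rule is_primitive_continuous_rep[OF H(2) d(1)]) (intro sq)
  then show "is_primitive (continuous_rep v) (\<lambda>s. complex_of_real (m - V s - l) * continuous_rep u s - f s)"
    by (simp add: U_def W_def algebra_simps)
qed

text \<open>Gronwall's inequality for the sum of the two moduli, run from \<open>0\<close> in both
  directions; the residual enters through its integral over an interval of length at most
  \<open>R\<close>.\<close>

lemma pointwise_growth:
  assumes x: "(u, v) \<in> h_domain" and B: "\<And>s. \<bar>V s\<bar> \<le> B" and R: "0 \<le> R" "\<bar>s\<bar> \<le> R"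
  shows "cmod (continuous_rep u s) + cmod (continuous_rep v s) \<le>
    (2 * norm (initial_value (u, v)) + 2 * sqrt R * norm (A (u, v) - complex_of_real l *\<^sub>C (u, v)))
      * exp ((m + B + \<bar>l\<bar>) * R)"
proof -
  define y where "y = A (u, v) - complex_of_real l *\<^sub>C (u, v)"
  obtain f g where f: "square_integrable f" "fst y = abs_L2 f" and g: "square_integrable g" "snd y = abs_L2 g"
    by (metis L2_cases)
  have "A (u, v) - complex_of_real l *\<^sub>C (u, v) = (abs_L2 f, abs_L2 g)"
    using f g by (simp add: y_def prod_eq_iff)
  note P = resolvent_equation_components[OF x f(1) g(1) this]
  define U W where "U = continuous_rep u" and "W = continuous_rep v"
  define n where "n t = cmod (U t) + cmod (W t)" for t
  define L where "L = m + B + \<bar>l\<bar>"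
  have "0 \<le> B"
    using B[of 0] by linarith
  then have L0: "0 \<le> L"
    using mass_pos by (simp add: L_def)
  have cont: "continuous_on S U" "continuous_on S W" "continuous_on S n" for S
    unfolding n_def
    using is_primitive_continuous[OF P(1)] is_primitive_continuous[OF P(2)]
    by (auto simp: U_def W_def intro!: continuous_intros intro: continuous_on_subset)
  have coeff: "cmod (complex_of_real (m + V t + l)) \<le> L" "cmod (complex_of_real (m - V t - l)) \<le> L" for t
    using B[of t] mass_pos unfolding norm_of_real L_def by linarith+
  \<comment> \<open>Each of the two components of the residual contributes at most
    \<open>sqrt R * norm y\<close>.\<close>
  define d where "d = 2 * sqrt R * norm y"
  have step: "cmod (U b - U a) + cmod (W b - W a) \<le> d + L * integral {a..b} n"
    if ab: "a \<le> b" "b - a \<le> R" for a b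
  proof -
    have 1: "cmod (U b - U a) \<le> sqrt (b - a) * norm (abs_L2 g) + L * integral {a..b} (\<lambda>s. cmod (W s))"
    proof (rule primitive_increment_le[OF P(1)[folded U_def W_def] g(1) cont(2) _ ab(1)])
      fix s
      have "cmod (complex_of_real (m + V s + l)) * cmod (W s) \<le> L * cmod (W s)"
        by (intro mult_right_mono coeff) auto
      then show "cmod (g s + complex_of_real (m + V s + l) * W s) \<le> cmod (g s) + L * cmod (W s)"
        by (intro order_trans[OF norm_triangle_ineq]) (simp add: norm_mult del: of_real_add)
    qed
    have 2: "cmod (W b - W a) \<le> sqrt (b - a) * norm (abs_L2 f) + L * integral {a..b} (\<lambda>s. cmod (U s))"
    proof (rule primitive_increment_le[OF P(2)[folded U_def W_def] f(1) cont(1) _ ab(1)])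
      fix s
      have "cmod (complex_of_real (m - V s - l)) * cmod (U s) \<le> L * cmod (U s)"
        by (intro mult_right_mono coeff) auto
      then show "cmod (complex_of_real (m - V s - l) * U s - f s) \<le> cmod (f s) + L * cmod (U s)"
        by (intro order_trans[OF norm_triangle_ineq4]) (simp add: norm_mult del: of_real_diff)
    qed
    have "integral {a..b} n = integral {a..b} (\<lambda>s. cmod (U s)) + integral {a..b} (\<lambda>s. cmod (W s))"
      unfolding n_def by (intro Henstock_Kurzweil_Integration.integral_add integrable_continuous_interval
          continuous_intros cont)
    moreover have "sqrt (b - a) * norm (abs_L2 k) \<le> sqrt R * norm y"
      if "norm (abs_L2 k) \<le> norm y" for k
      using that ab R by (intro mult_mono) auto
    moreover have "norm (abs_L2 f) \<le> norm y" "norm (abs_L2 g) \<le> norm y"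
      using norm_Pair_ge[where x = "fst y" and y = "snd y"] by (simp_all flip: f(2) g(2))
    ultimately have "sqrt (b - a) * norm (abs_L2 f) \<le> sqrt R * norm y"
      "sqrt (b - a) * norm (abs_L2 g) \<le> sqrt R * norm y"
      "integral {a..b} n = integral {a..b} (\<lambda>s. cmod (U s)) + integral {a..b} (\<lambda>s. cmod (W s))"
      by blast+
    then show ?thesis
      using 1 2 by (simp add: d_def distrib_left)
  qed
  have n0: "n 0 \<le> 2 * norm (initial_value (u, v))"
    using norm_Pair_ge[where x = "U 0" and y = "W 0"]
    by (simp add: n_def initial_value_def U_def W_def)
  have tri: "n b \<le> n a + (cmod (U b - U a) + cmod (W b - W a))" "n b \<le> n a + (cmod (U a - U b) + cmod (W a - W b))" for a b
    using norm_triangle_ineq2[of "U b" "U a"] norm_triangle_ineq2[of "W b" "W a"]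
    by (simp_all add: n_def norm_minus_commute[of "U a" "U b"] norm_minus_commute[of "W a" "W b"])
  have G: "k \<le> (n 0 + d) * exp (L * t) \<Longrightarrow> t \<le> R \<Longrightarrow>
      k \<le> (2 * norm (initial_value (u, v)) + d) * exp (L * R)" for k t
  proof -
    assume k: "k \<le> (n 0 + d) * exp (L * t)" and "t \<le> R"
    have "0 \<le> d"
      using R by (simp add: d_def)
    have "(n 0 + d) * exp (L * t) \<le> (2 * norm (initial_value (u, v)) + d) * exp (L * R)"
      using n0 \<open>0 \<le> d\<close> \<open>t \<le> R\<close> L0 by (intro mult_mono) (auto intro: mult_left_mono)
    with k show ?thesis
      by linarith
  qed
  have "n s \<le> (2 * norm (initial_value (u, v)) + d) * exp (L * R)"
  proof (cases "0 \<le> s")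
    case True
    have "n s \<le> (n 0 + d) * exp (L * s)"
    proof (rule Gronwall[OF cont(3) L0])
      show "s \<in> {0..R}"
        using True R by simp
      fix t assume "t \<in> {0..R}"
      then show "n t \<le> n 0 + d + L * integral {0..t} n"
        using step[of 0 t] tri(1)[of t 0] by simp
    qed
    then show ?thesis
      by (rule G) (use R in simp)
  next
    case False
    \<comment> \<open>For negative \<open>s\<close> the inequality is applied to the reflected
      function.\<close>
    have "n (- (- s)) \<le> (n 0 + d) * exp (L * - s)"
    proof (rule Gronwall[where n = "\<lambda>t. n (- t)" and R = R, OF _ L0])
      show "continuous_on {0..R} (\<lambda>t. n (- t))"
        by (intro continuous_on_compose2[OF cont(3)] continuous_intros) auto
      show "- s \<in> {0..R}"
        using False R by simp
      fix t assume t: "t \<in> {0..R}"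
      have "integral {- 0 - t.. - 0} n = integral {0..t} (\<lambda>t. n (- t))"
        using Henstock_Kurzweil_Integration.integral_reflect_real[of t 0 "\<lambda>t. n (- t)"] by simp
      then show "n (- t) \<le> n 0 + d + L * integral {0..t} (\<lambda>t. n (- t))"
        using step[of "- t" 0] tri(2)[of "- t" 0] t by simp
    qed
    then have "n s \<le> (n 0 + d) * exp (L * - s)"
      by simp
    then show ?thesis
      by (rule G) (use R in simp)
  qed
  then show ?thesis
    by (simp add: n_def U_def W_def L_def d_def y_def)
qed

text \<open>
  The free operator is bounded below by \<open>m\<close>. The potential perturbs this bound by a small constant
  outside \<open>{-R..R}\<close>, and inside \<open>{-R..R}\<close> the solution is controlled by its value at \<open>0\<close>.
\<close>

lemma bounded_below_modulo_initial_value: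
  assumes "\<bar>l\<bar> < m"
  obtains C where "\<And>x. x \<in> h_domain \<Longrightarrow>
    norm x \<le> C * (norm (A x - complex_of_real l *\<^sub>C x) + norm (initial_value x))"
proof -
  \<comment> \<open>Half of \<open>m - \<bar>l\<bar>\<close> is spent on the tail of the potential;
    the other half remains as the coefficient of \<open>norm x\<close>.\<close>
  define \<delta> where "\<delta> = (m - \<bar>l\<bar>) / 2"
  have \<delta>: "\<delta> > 0"
    using assms by (simp add: \<delta>_def)
  obtain R0 where R0: "\<And>s. \<bar>s\<bar> > R0 \<Longrightarrow> \<bar>V s\<bar> \<le> \<delta>"
    using decay_V[OF \<delta>] by blast
  \<comment> \<open>The absolute value secures \<open>0 \<le> R\<close>, since the bound from
    \<open>decay_V\<close> may be negative.\<close>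
  define R where "R = \<bar>R0\<bar>"
  have R: "0 \<le> R" "\<And>s. \<bar>s\<bar> > R \<Longrightarrow> \<bar>V s\<bar> \<le> \<delta>"
    using R0 by (auto simp: R_def)
  obtain B where B: "\<And>s. \<bar>V s\<bar> \<le> B"
    using bounded_V by (auto simp: bounded_iff)
  have B0: "0 \<le> B"
    using B[of 0] by linarith
  \<comment> \<open>The factor with which initial value and residual enter the cut-off part: two
    components, each at most \<open>B * S * sqrt (2 * R)\<close> with \<open>S\<close> from
    \<open>pointwise_growth\<close>.\<close>
  define T where "T = 2 * B * sqrt (2 * R) * exp ((m + B + \<bar>l\<bar>) * R)"
  have T0: "0 \<le> T"
    using B0 R by (simp add: T_def)
  define Vc where "Vc s = indicator {-R..R} s * V s" for s
  have Vc: "Vc \<in> borel_measurable borel" "bounded (range Vc)"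
  proof -
    show "Vc \<in> borel_measurable borel"
      unfolding Vc_def[abs_def] using measurable_V by measurable
    have "\<bar>Vc s\<bar> \<le> B" for s
      using B[of s] B0 by (simp add: Vc_def indicator_def)
    then show "bounded (range Vc)"
      by (auto simp: bounded_iff)
  qed
  have rest: "\<bar>V s - Vc s\<bar> \<le> \<delta>" for s
    using R(2)[of s] \<delta> by (auto simp: Vc_def indicator_def abs_le_iff not_le)
  have "norm x \<le> ((1 + T * (2 + 2 * sqrt R)) / \<delta>) * (norm (A x - complex_of_real l *\<^sub>C x) + norm (initial_value x))"
    if "x \<in> h_domain" for x
  proof -
    obtain u v where x: "x = (u, v)" and H: "u \<in> H1" "v \<in> H1"
      using \<open>x \<in> h_domain\<close> by (auto simp: h_domain_def)
    define y where "y = A x - complex_of_real l *\<^sub>C x"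
    define E where "E = initial_value x"
    define S where "S = (2 * norm E + 2 * sqrt R * norm y) * exp ((m + B + \<bar>l\<bar>) * R)"
    have S: "cmod (continuous_rep u s) \<le> S" "cmod (continuous_rep v s) \<le> S" if "\<bar>s\<bar> \<le> R" for s
      using pointwise_growth[OF \<open>x \<in> h_domain\<close>[unfolded x] B R(1) that, of l]
        norm_ge_zero[of "continuous_rep u s"] norm_ge_zero[of "continuous_rep v s"]
      unfolding S_def E_def y_def x by linarith+
    have cut: "norm (mult_op Vc w) \<le> B * S * sqrt (2 * R)"
      if "w \<in> H1" "\<And>s. \<bar>s\<bar> \<le> R \<Longrightarrow> cmod (continuous_rep w s) \<le> S" for w
      using norm_mult_op_cutoff_le[OF measurable_V B continuous_rep(1)[OF that(1)] that(2) R(1)]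
      by (simp add: Vc_def[abs_def] continuous_rep(2)[OF that(1)])
    have "norm (mult_op Vc u, mult_op Vc v) \<le> B * S * sqrt (2 * R) + B * S * sqrt (2 * R)"
      by (intro order_trans[OF norm_Pair_le] add_mono cut H S)
    also have "\<dots> = T * (2 * norm E + 2 * sqrt R * norm y)"
      by (simp add: S_def T_def)
    finally have 1: "norm (mult_op Vc u, mult_op Vc v) \<le> T * (2 * norm E + 2 * sqrt R * norm y)" .
    have 2: "norm (mult_op (\<lambda>s. V s - Vc s) u, mult_op (\<lambda>s. V s - Vc s) v) \<le> \<delta> * norm x"
      unfolding x using \<delta> measurable_V Vc(1)
      by (intro norm_Pair_mono norm_mult_op_le rest) auto
    have split: "mult_op V w = mult_op Vc w + mult_op (\<lambda>s. V s - Vc s) w" for w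
      by (simp add: mult_op_diff_functions measurable_V bounded_V Vc)
    \<comment> \<open>The free operator is written as residual plus shift plus potential, the latter
      split into its parts inside and outside \<open>{-R..R}\<close>.\<close>
    have "(complex_of_real m *\<^sub>C u - weak_deriv v, weak_deriv u - complex_of_real m *\<^sub>C v)
        = y + complex_of_real l *\<^sub>C x + ((mult_op Vc u, mult_op Vc v)
          + (mult_op (\<lambda>s. V s - Vc s) u, mult_op (\<lambda>s. V s - Vc s) v))"
      by (simp add: y_def x A_eq split algebra_simps)
    then have "m * norm x \<le> norm (y + complex_of_real l *\<^sub>C x + ((mult_op Vc u, mult_op Vc v)
          + (mult_op (\<lambda>s. V s - Vc s) u, mult_op (\<lambda>s. V s - Vc s) v)))"
      using free_operator_bound[OF H] by (simp add: x)
    also have "\<dots> \<le> (norm y + norm (complex_of_real l *\<^sub>C x)) + (norm (mult_op Vc u, mult_op Vc v)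
          + norm (mult_op (\<lambda>s. V s - Vc s) u, mult_op (\<lambda>s. V s - Vc s) v))"
      by (intro order_trans[OF norm_triangle_ineq] add_mono norm_triangle_ineq)
    also have "\<dots> \<le> (norm y + \<bar>l\<bar> * norm x) + (T * (2 * norm E + 2 * sqrt R * norm y) + \<delta> * norm x)"
      using 1 2 by (intro add_mono order_refl) (simp add: norm_scaleC)
    finally have "(m - \<bar>l\<bar> - \<delta>) * norm x \<le> norm y + T * (2 * norm E + 2 * sqrt R * norm y)"
      by (simp add: algebra_simps)
    also have "m - \<bar>l\<bar> - \<delta> = \<delta>"
      by (simp add: \<delta>_def field_simps)
    also have "norm y + T * (2 * norm E + 2 * sqrt R * norm y) \<le> (1 + T * (2 + 2 * sqrt R)) * (norm y + norm E)"
    proof -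
      have "0 \<le> norm E + 2 * (T * norm y) + 2 * (T * (sqrt R * norm E))"
        using T0 R(1) by (intro add_nonneg_nonneg mult_nonneg_nonneg) auto
      then show ?thesis
        by (simp add: algebra_simps)
    qed
    finally show ?thesis
      using \<delta> by (simp add: y_def E_def pos_le_divide_eq mult.commute)
  qed
  then show thesis
    by (rule that)
qed

section \<open>Simple and isolated eigenvalues in the gap\<close>

text \<open>The matrix of the first-order system has trace zero, so the density of the Wronskian
  vanishes. Its factors are not conjugated, hence the appeal to
  \<open>integrable_mult_square_integrable\<close>.\<close>

lemma Wronskian_zero:
  assumes x: "(u, v) \<in> h_domain" "A (u, v) = complex_of_real l *\<^sub>C (u, v)"
    and x': "(u', v') \<in> h_domain" "A (u', v') = complex_of_real l *\<^sub>C (u', v')"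
  shows "continuous_rep u s * continuous_rep v' s = continuous_rep u' s * continuous_rep v s"
proof -
  have zero: "(0, 0) = (abs_L2 (\<lambda>_. 0), abs_L2 (\<lambda>_. 0))"
    by (simp add: zero_L2_def)
  have "A (u, v) - complex_of_real l *\<^sub>C (u, v) = (abs_L2 (\<lambda>_. 0), abs_L2 (\<lambda>_. 0))"
    unfolding zero[symmetric] x(2) by (simp add: zero_prod_def)
  note P = resolvent_equation_components[OF x(1) square_integrable_zero square_integrable_zero this]
  have "A (u', v') - complex_of_real l *\<^sub>C (u', v') = (abs_L2 (\<lambda>_. 0), abs_L2 (\<lambda>_. 0))"
    unfolding zero[symmetric] x'(2) by (simp add: zero_prod_def)
  note P' = resolvent_equation_components[OF x'(1) square_integrable_zero square_integrable_zero this]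
  have H: "u \<in> H1" "v \<in> H1" "u' \<in> H1" "v' \<in> H1"
    using x(1) x'(1) by (auto simp: h_domain_def)
  define X where "X t = continuous_rep u t * continuous_rep v' t - continuous_rep u' t * continuous_rep v t" for t
  have "is_primitive X (\<lambda>_. 0)"
    using is_primitive_diff[OF is_primitive_mult[OF P(1) P'(2)] is_primitive_mult[OF P'(1) P(2)]]
    by (simp add: X_def[abs_def] algebra_simps)
  then have const: "X b = X a" if "a \<le> b" for a b
    using is_primitiveD(4)[OF _ that] by fastforce
  have "X t = X s" for t
    using const[of t s] const[of s t] by (cases "t \<le> s") auto
  then have "X = (\<lambda>_. X s)"
    by auto
  moreover have "integrable lborel X"
    unfolding X_def by (intro Bochner_Integration.integrable_diff integrable_mult_square_integrable continuous_rep(1) H)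
  ultimately have "integrable lborel (\<lambda>_::real. X s)"
    by simp
  \<comment> \<open>A nonzero constant is not integrable, as the line has infinite measure.\<close>
  then have "X s = 0"
    by (simp add: integrable_iff_bounded ennreal_mult_less_top)
  then show ?thesis
    by (simp add: X_def)
qed

text \<open>On the eigenspace the residual vanishes, so the lower bound makes
  \<open>initial_value\<close> injective there; the vanishing Wronskian at \<open>0\<close> makes
  the initial values of any two eigenvectors proportional.\<close>

lemma dim_eigenspace:
  assumes l: "\<bar>l\<bar> < m" and ne: "eigenspace h_domain A (complex_of_real l) \<noteq> {0}"
  shows "finite_cdim (eigenspace h_domain A (complex_of_real l))"
    and "complex_vector.dim (eigenspace h_domain A (complex_of_real l)) = 1"
proof -
  let ?N = "eigenspace h_domain A (complex_of_real l)"
  obtain C where C: "\<And>x. x \<in> h_domain \<Longrightarrow>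
    norm x \<le> C * (norm (A x - complex_of_real l *\<^sub>C x) + norm (initial_value x))"
    using bounded_below_modulo_initial_value[OF l] by blast
  have inj: "x = 0" if "x \<in> ?N" "initial_value x = 0" for x
    using C[of x] that by (simp add: eigenspace_def)
  have "0 \<in> ?N"
    using scale_A[OF zero_D, of 0] zero_D by (simp add: eigenspace_def)
  then obtain x where x: "x \<in> ?N" "x \<noteq> 0"
    using ne by blast
  have diff_N: "y - c *\<^sub>C x \<in> ?N" if "y \<in> ?N" for y c
    using that x(1) by (auto simp: eigenspace_def diff_D scale_D diff_A scale_A scaleC_scaleC mult.commute
        complex_vector.scale_right_diff_distrib)
  have multiple: "\<exists>c. y = c *\<^sub>C x" if y: "y \<in> ?N" for y
  proof -
    obtain u v u' v' where uv: "x = (u, v)" "y = (u', v')"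
      by (cases x, cases y)
    have D: "(u, v) \<in> h_domain" "(u', v') \<in> h_domain"
      using x y by (simp_all add: eigenspace_def uv)
    have "A (u, v) = complex_of_real l *\<^sub>C (u, v)" "A (u', v') = complex_of_real l *\<^sub>C (u', v')"
      using x y by (simp_all add: eigenspace_def uv)
    then have W: "fst (initial_value x) * snd (initial_value y) = fst (initial_value y) * snd (initial_value x)"
      using Wronskian_zero[OF D(1) _ D(2), of l 0] by (simp add: uv initial_value_def)
    have nz: "initial_value x \<noteq> 0"
      using inj x by blast
    \<comment> \<open>The factor is the quotient in whichever component of
      \<open>initial_value x\<close> is nonzero; the Wronskian identity settles the other
      component.\<close>
    obtain c where "initial_value y = (c * fst (initial_value x), c * snd (initial_value x))"
    proof (cases "fst (initial_value x) = 0")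
      case True
      then have "snd (initial_value x) \<noteq> 0"
        using nz by (simp add: prod_eq_iff)
      then show thesis
        using W True that[of "snd (initial_value y) / snd (initial_value x)"] by (simp add: prod_eq_iff)
    next
      case False
      then show thesis
        using W that[of "fst (initial_value y) / fst (initial_value x)"]
        by (simp add: prod_eq_iff field_simps)
    qed
    then have "initial_value (y - c *\<^sub>C x) = 0"
      using D by (simp add: uv initial_value_diff scale_D initial_value_scale)
    then show ?thesis
      using inj[OF diff_N[OF y]] by auto
  qed
  have sub: "?N \<subseteq> complex_vector.span {x}"
    using multiple unfolding complex_vector.span_singleton by blast
  then show "finite_cdim ?N"
    unfolding finite_cdim_def by blast
  have "complex_vector.span {x} = complex_vector.span ?N"
  proof
    show "complex_vector.span {x} \<subseteq> complex_vector.span ?N"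
      using x(1) by (intro complex_vector.span_mono) auto
    show "complex_vector.span ?N \<subseteq> complex_vector.span {x}"
      using sub by (intro complex_vector.span_minimal) auto
  qed
  moreover have "complex_vector.independent {x}"
    using x(2) by simp
  ultimately show "complex_vector.dim ?N = 1"
    using complex_vector.dim_eq_card[of "{x}" ?N] by simp
qed

lemma gap_spectrum:
  assumes "\<bar>l\<bar> < m" "complex_of_real l \<in> spectrum h_domain A"
  shows "complex_of_real l \<in> discrete_spectrum h_domain A"
proof -
  have eig: "\<exists>u\<in>h_domain. norm u = 1 \<and> A u = complex_of_real b *\<^sub>C u"
    if b: "\<bar>b\<bar> < m" "complex_of_real b \<in> spectrum h_domain A" for b
  proof -
    obtain K C where "\<And>x. x \<in> h_domain \<Longrightarrow> norm (initial_value x) \<le> K * (norm x + norm (A x - complex_of_real b *\<^sub>C x))"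
      and "\<And>x. x \<in> h_domain \<Longrightarrow> norm x \<le> C * (norm (A x - complex_of_real b *\<^sub>C x) + norm (initial_value x))"
      using initial_value_bound[of b] bounded_below_modulo_initial_value[OF b(1)] by metis
    from spectrum_imp_eigenvalue[OF initial_value_diff this b(2)] show ?thesis
      by blast
  qed
  obtain K C where KC: "\<And>x. x \<in> h_domain \<Longrightarrow> norm (initial_value x) \<le> K * (norm x + norm (A x - complex_of_real l *\<^sub>C x))"
    "\<And>x. x \<in> h_domain \<Longrightarrow> norm x \<le> C * (norm (A x - complex_of_real l *\<^sub>C x) + norm (initial_value x))"
    using initial_value_bound[of l] bounded_below_modulo_initial_value[OF assms(1)] by metis
  have "complex_of_real l isolated_in spectrum h_domain A"
  proof (rule spectrum_point_isolated[OF initial_value_diff KC assms(2)])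
    \<comment> \<open>This radius keeps neighbouring spectral points inside the gap, where they are
      eigenvalues too.\<close>
    show "0 < m - \<bar>l\<bar>"
      using assms(1) by simp
    show "\<exists>u\<in>h_domain. norm u = 1 \<and> A u = complex_of_real b *\<^sub>C u"
      if "\<bar>b - l\<bar> < m - \<bar>l\<bar>" "complex_of_real b \<in> spectrum h_domain A" for b
      using that by (intro eig) auto
  qed
  moreover have "eigenspace h_domain A (complex_of_real l) \<noteq> {0}"
  proof -
    obtain u where "u \<in> eigenspace h_domain A (complex_of_real l)" "norm u = 1"
      using eig[OF assms] unfolding eigenspace_def by blast
    then show ?thesis
      by force
  qed
  ultimately show ?thesis
    using dim_eigenspace(1)[OF assms(1)] by (simp add: discrete_spectrum_def)
qed

end

section \<open>Damped plane waves and the spectrum outside the gap\<close>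

lemma norm_scaleC_Pair: "norm (p *\<^sub>C z, q *\<^sub>C z) = norm (p, q) * norm (z::'a::complex_inner)"
  by (simp add: norm_Pair norm_scaleC power_mult_distrib real_sqrt_mult flip: distrib_right)

text \<open>On each open half-line \<open>w\<close> is \<open>exp (c * t)\<close> with a constant
  \<open>c\<close>, so the kink at \<open>0\<close> is the only exceptional point.\<close>

lemma is_primitive_damped_plane_wave:
  fixes \<kappa> \<epsilon> :: real
  defines "w \<equiv> \<lambda>s::real. exp (complex_of_real (- \<epsilon> * \<bar>s\<bar>) + \<i> * complex_of_real (\<kappa> * s))"
  shows "is_primitive w (\<lambda>s. (\<i> * complex_of_real \<kappa> - complex_of_real (\<epsilon> * sgn s)) * w s)"
proof (rule is_primitive_if_continuous_derivative[of "{0}"])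
  show cont: "continuous_on UNIV w"
    unfolding w_def by (intro continuous_intros)
  show "locally_integrable (\<lambda>s. (\<i> * complex_of_real \<kappa> - complex_of_real (\<epsilon> * sgn s)) * w s)"
  proof -
    have sgn_eq: "sgn s = indicator {0<..} s - indicator {..<0} s" for s :: real
      by (auto simp: indicator_def sgn_if)
    have [measurable]: "(sgn :: real \<Rightarrow> real) \<in> borel_measurable borel"
      unfolding sgn_eq[abs_def] by measurable
    have "set_integrable lborel {a..b} (\<lambda>s. \<i> * complex_of_real \<kappa> - complex_of_real (\<epsilon> * sgn s))" for a b
      unfolding set_integrable_def
    proof (rule Bochner_Integration.integrable_bound)
      show "integrable lborel (\<lambda>s. indicator {a..b} s *\<^sub>R (\<bar>\<kappa>\<bar> + \<bar>\<epsilon>\<bar>))"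
        using borel_integrable_atLeastAtMost'[of a b "\<lambda>_. \<bar>\<kappa>\<bar> + \<bar>\<epsilon>\<bar>"] by (simp add: set_integrable_def)
      have "cmod (\<i> * complex_of_real \<kappa> - complex_of_real (\<epsilon> * sgn s)) \<le> \<bar>\<kappa>\<bar> + \<bar>\<epsilon>\<bar>" for s
        by (rule order_trans[OF norm_triangle_ineq4]) (auto simp: norm_mult abs_mult sgn_if)
      then show "AE s in lborel. norm (indicator {a..b} s *\<^sub>R (\<i> * complex_of_real \<kappa> - complex_of_real (\<epsilon> * sgn s)))
          \<le> norm (indicator {a..b} s *\<^sub>R (\<bar>\<kappa>\<bar> + \<bar>\<epsilon>\<bar>))"
        by (simp add: indicator_def)
    qed measurable
    moreover have "(\<lambda>s. \<i> * complex_of_real \<kappa> - complex_of_real (\<epsilon> * sgn s)) \<in> borel_measurable borel"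
      by measurable
    ultimately have "locally_integrable (\<lambda>s. \<i> * complex_of_real \<kappa> - complex_of_real (\<epsilon> * sgn s))"
      by (simp add: locally_integrable_def)
    from locally_integrable_continuous_mult[OF this cont] show ?thesis
      by (simp add: mult.commute)
  qed
  fix s :: real assume "s \<notin> {0}"
  define c where "c = \<i> * complex_of_real \<kappa> - complex_of_real (\<epsilon> * sgn s)"
  have deriv: "((\<lambda>t. exp (c * complex_of_real t)) has_vector_derivative c * exp (c * complex_of_real s)) (at s)"
    by (rule has_vector_derivative_real_field) (auto intro!: derivative_eq_intros)
  have eq: "exp (c * complex_of_real t) = w t" if "sgn t = sgn s" for t
  proof -
    have "sgn s * t = \<bar>t\<bar>"
      using that by (simp add: abs_sgn mult.commute flip: that)
    then have "c * complex_of_real t = complex_of_real (- \<epsilon> * \<bar>t\<bar>) + \<i> * complex_of_real (\<kappa> * t)"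
      unfolding c_def by (simp add: left_diff_distrib flip: of_real_mult mult.assoc) (simp add: mult.assoc)
    then show ?thesis
      by (simp only: w_def)
  qed
  define S where "S = (if s > 0 then {0<..} else {..<0::real})"
  have S: "open S" "s \<in> S" "\<And>t. t \<in> S \<Longrightarrow> sgn t = sgn s"
    using \<open>s \<notin> {0}\<close> by (auto simp: S_def split: if_splits)
  have "(w has_vector_derivative c * exp (c * complex_of_real s)) (at s)"
    by (rule has_vector_derivative_transform_within_open[OF deriv S(1,2)]) (rule eq[OF S(3)])
  then show "(w has_vector_derivative (\<i> * complex_of_real \<kappa> - complex_of_real (\<epsilon> * sgn s)) * w s) (at s)"
    using eq[of s] by (simp only: c_def)
qed simp

context dirac_decaying_potential
begin

text \<open>
  For \<open>\<bar>l\<bar> \<ge> m\<close> the damped plane waves \<open>exp (- \<epsilon> \<bar>s\<bar> + \<i> \<kappa> s) (p, q)\<close> with \<open>\<kappa>\<^sup>2 = l\<^sup>2 - m\<^sup>2\<close> have norm of order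
  \<open>1 / sqrt \<epsilon>\<close>, whereas \<open>A - l\<close> maps them to vectors that remain bounded as \<open>\<epsilon>\<close> tends to \<open>0\<close>.
\<close>

lemma plane_wave_spectrum:
  assumes pq: "complex_of_real (m - l) * p = \<i> * complex_of_real \<kappa> * q"
    "complex_of_real (m + l) * q = \<i> * complex_of_real \<kappa> * p" "(p, q) \<noteq> 0"
  shows "complex_of_real l \<in> spectrum h_domain A"
proof (rule ccontr)
  assume "\<not> ?thesis"
  then obtain C where C: "\<And>x. x \<in> h_domain \<Longrightarrow> norm x \<le> C * norm (A x - complex_of_real l *\<^sub>C x)"
    by (auto simp: spectrum_def resolvent_set_def)
  define r where "r = norm (p, q)"
  have r: "r > 0"
    using pq(3) by (simp add: r_def)
  let ?V = "abs_L2 (\<lambda>s. complex_of_real (V s))"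
  \<comment> \<open>The lower bound for the wave, divided by its amplitude \<open>r\<close> and
    multiplied by \<open>sqrt \<epsilon>\<close>, has left-hand side \<open>1\<close>.\<close>
  have main: "1 \<le> \<bar>C\<bar> * (\<epsilon> + sqrt \<epsilon> * norm ?V)" if \<epsilon>: "\<epsilon> > 0" for \<epsilon>
  proof -
    define w where "w s = exp (complex_of_real (- \<epsilon> * \<bar>s\<bar>) + \<i> * complex_of_real (\<kappa> * s))" for s :: real
    define \<sigma> where "\<sigma> s = complex_of_real (sgn s) * w s" for s
    have prim: "is_primitive w (\<lambda>s. (\<i> * complex_of_real \<kappa> - complex_of_real (\<epsilon> * sgn s)) * w s)"
      unfolding w_def by (rule is_primitive_damped_plane_wave)
    have cm: "cmod (w s) = cmod (complex_of_real (exp (- \<epsilon> * \<bar>s\<bar>)))" for s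
      by (simp add: w_def norm_exp_eq_Re)
    note ex = square_integrable_exp_neg_abs[OF \<epsilon>]
    have mw [measurable]: "w \<in> borel_measurable borel"
      by (rule is_primitive_measurable[OF prim])
    have w: "square_integrable w"
      by (rule square_integrable_bound[OF ex(1), where C = 1]) (simp_all add: cm)
    have nw: "(norm (abs_L2 w))\<^sup>2 = 1 / \<epsilon>"
      unfolding ex(2)[symmetric] norm_abs_L2[OF w] norm_abs_L2[OF ex(1)] cm ..
    have sgn_eq: "sgn s = indicator {0<..} s - indicator {..<0} s" for s :: real
      by (auto simp: indicator_def sgn_if)
    have [measurable]: "(sgn :: real \<Rightarrow> real) \<in> borel_measurable borel"
      unfolding sgn_eq[abs_def] by measurable
    have cs: "cmod (\<sigma> s) \<le> 1 * cmod (w s)" for s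
      by (simp add: \<sigma>_def norm_mult sgn_if)
    have \<sigma>: "square_integrable \<sigma>"
      by (rule square_integrable_bound[OF w _ cs]) (simp add: \<sigma>_def[abs_def])
    have n\<sigma>: "norm (abs_L2 \<sigma>) \<le> norm (abs_L2 w)"
      using norm_abs_L2_le[OF \<sigma> w cs] by simp
    \<comment> \<open>Since \<open>cmod (w s) \<le> 1\<close>, the bound is the same for all
      \<epsilon>; square integrability of the potential enters here.\<close>
    have Vw: "norm (mult_op V (abs_L2 w)) \<le> norm ?V"
    proof -
      have "norm (abs_L2 (\<lambda>s. complex_of_real (V s) * w s)) \<le> 1 * norm ?V"
      proof (rule norm_abs_L2_le[OF mult_op_abs_L2(1)[OF measurable_V bounded_V w] square_integrable_V])
        fix s
        have "cmod (w s) \<le> 1"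
          using \<epsilon> by (simp add: cm)
        then show "cmod (complex_of_real (V s) * w s) \<le> 1 * cmod (complex_of_real (V s))"
          by (simp add: norm_mult mult_left_le)
      qed simp
      then show ?thesis
        by (simp add: mult_op_abs_L2(2)[OF measurable_V bounded_V w])
    qed
    have deq: "(\<lambda>s. (\<i> * complex_of_real \<kappa> - complex_of_real (\<epsilon> * sgn s)) * w s)
        = (\<lambda>s. \<i> * complex_of_real \<kappa> * w s - complex_of_real \<epsilon> * \<sigma> s)"
      by (simp add: \<sigma>_def fun_eq_iff algebra_simps)
    have wH: "abs_L2 w \<in> H1" and dw: "weak_deriv (abs_L2 w)
        = (\<i> * complex_of_real \<kappa>) *\<^sub>C abs_L2 w - complex_of_real \<epsilon> *\<^sub>C abs_L2 \<sigma>"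
    proof -
      have sq: "square_integrable (\<lambda>s. \<i> * complex_of_real \<kappa> * w s - complex_of_real \<epsilon> * \<sigma> s)"
        by (intro square_integrable_diff square_integrable_scale w \<sigma>)
      note d = weak_deriv_abs_L2[OF w sq prim[unfolded deq]]
      show "abs_L2 w \<in> H1"
        by (rule d)
      show "weak_deriv (abs_L2 w) = (\<i> * complex_of_real \<kappa>) *\<^sub>C abs_L2 w - complex_of_real \<epsilon> *\<^sub>C abs_L2 \<sigma>"
        unfolding d(2) by (simp add: scaleC_abs_L2 diff_abs_L2 square_integrable_scale w \<sigma>)
    qed
    define x where "x = (p *\<^sub>C abs_L2 w, q *\<^sub>C abs_L2 w)"
    have xD: "x \<in> h_domain"
      by (simp add: x_def h_domain_def H1_scaleC wH)
    have comm: "mult_op V (c *\<^sub>C abs_L2 w) = c *\<^sub>C mult_op V (abs_L2 w)" for c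
      by (rule mult_op_linear[OF measurable_V bounded_V])
    have "A x - complex_of_real l *\<^sub>C x
        = ((complex_of_real (m - l) * p - \<i> * complex_of_real \<kappa> * q) *\<^sub>C abs_L2 w,
           (\<i> * complex_of_real \<kappa> * p - complex_of_real (m + l) * q) *\<^sub>C abs_L2 w)
        + ((complex_of_real \<epsilon> * q) *\<^sub>C abs_L2 \<sigma>, (- complex_of_real \<epsilon> * p) *\<^sub>C abs_L2 \<sigma>)
        - (p *\<^sub>C mult_op V (abs_L2 w), q *\<^sub>C mult_op V (abs_L2 w))"
      by (simp add: x_def A_eq scaleC_prod_def H1_scaleC[OF wH] dw comm scaleC_scaleC
          complex_vector.scale_right_diff_distrib complex_vector.scale_left_diff_distrib
          scaleC_add_left complex_vector.scale_minus_left algebra_simps)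
    \<comment> \<open>The conditions \<open>pq\<close> say that the undamped wave solves the free
      equation, so only damping and potential contribute.\<close>
    also have "\<dots> = ((complex_of_real \<epsilon> * q) *\<^sub>C abs_L2 \<sigma>, (- complex_of_real \<epsilon> * p) *\<^sub>C abs_L2 \<sigma>)
        - (p *\<^sub>C mult_op V (abs_L2 w), q *\<^sub>C mult_op V (abs_L2 w))"
      by (simp add: pq(1,2) del: of_real_diff of_real_add)
    finally have "norm (A x - complex_of_real l *\<^sub>C x)
        \<le> norm ((complex_of_real \<epsilon> * q) *\<^sub>C abs_L2 \<sigma>, (- complex_of_real \<epsilon> * p) *\<^sub>C abs_L2 \<sigma>)
        + norm (p *\<^sub>C mult_op V (abs_L2 w), q *\<^sub>C mult_op V (abs_L2 w))"
      using norm_triangle_ineq4 by metis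
    also have "\<dots> = \<epsilon> * r * norm (abs_L2 \<sigma>) + r * norm (mult_op V (abs_L2 w))"
    proof -
      have "norm (complex_of_real \<epsilon> * q, - complex_of_real \<epsilon> * p) = \<epsilon> * r"
        using \<epsilon> by (simp add: r_def norm_Pair norm_mult power_mult_distrib real_sqrt_mult add.commute
            flip: distrib_left)
      then show ?thesis
        by (simp only: norm_scaleC_Pair r_def)
    qed
    also have "\<dots> \<le> \<epsilon> * r * norm (abs_L2 w) + r * norm ?V"
      using \<epsilon> r n\<sigma> Vw by (intro add_mono mult_left_mono) auto
    finally have "norm (A x - complex_of_real l *\<^sub>C x) \<le> r * (\<epsilon> * norm (abs_L2 w) + norm ?V)"
      by (simp add: algebra_simps)
    then have "\<bar>C\<bar> * norm (A x - complex_of_real l *\<^sub>C x) \<le> \<bar>C\<bar> * (r * (\<epsilon> * norm (abs_L2 w) + norm ?V))"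
      by (intro mult_left_mono) auto
    moreover have "norm x \<le> \<bar>C\<bar> * norm (A x - complex_of_real l *\<^sub>C x)"
      using C[OF xD] mult_right_mono[OF abs_ge_self[of C] norm_ge_zero] by (rule order_trans)
    moreover have "norm x = r * norm (abs_L2 w)"
      by (simp only: x_def norm_scaleC_Pair r_def)
    ultimately have "r * norm (abs_L2 w) \<le> r * (\<bar>C\<bar> * (\<epsilon> * norm (abs_L2 w) + norm ?V))"
      by (simp add: mult.left_commute)
    then have le: "norm (abs_L2 w) \<le> \<bar>C\<bar> * (\<epsilon> * norm (abs_L2 w) + norm ?V)"
      using r by simp
    have "norm (abs_L2 w) = 1 / sqrt \<epsilon>"
      using nw by (metis norm_ge_zero real_sqrt_divide real_sqrt_one real_sqrt_unique)
    with le have "1 / sqrt \<epsilon> * sqrt \<epsilon> \<le> \<bar>C\<bar> * (\<epsilon> * (1 / sqrt \<epsilon>) + norm ?V) * sqrt \<epsilon>"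
      using \<epsilon> by (intro mult_right_mono) auto
    also have "\<dots> = \<bar>C\<bar> * (\<epsilon> * (1 / sqrt \<epsilon> * sqrt \<epsilon>) + sqrt \<epsilon> * norm ?V)"
      by (simp only: distrib_right distrib_left mult_ac)
    finally show ?thesis
      using \<epsilon> by simp
  qed
  \<comment> \<open>Taking \<epsilon> to be \<open>inverse (real (Suc n))\<close>, the limit of
    \<open>main\<close> becomes \<open>1 \<le> 0\<close>.\<close>
  have "(\<lambda>n. \<bar>C\<bar> * (inverse (real (Suc n)) + sqrt (inverse (real (Suc n))) * norm ?V))
      \<longlonglongrightarrow> \<bar>C\<bar> * (0 + sqrt 0 * norm ?V)"
    by (intro tendsto_intros LIMSEQ_inverse_real_of_nat)
  then have "1 \<le> \<bar>C\<bar> * (0 + sqrt 0 * norm ?V)"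
    by (rule Lim_bounded2) (use main in simp)
  then show False
    by simp
qed

text \<open>With this \<kappa> the two conditions on the amplitude are linearly dependent. The
  solution is chosen according to the sign of \<open>l\<close>, so that its entry
  \<open>m + l\<close> or \<open>m - l\<close> is nonzero; this includes the thresholds, where
  \<open>\<kappa> = 0\<close>.\<close>

lemma outer_spectrum:
  assumes "m \<le> \<bar>l\<bar>"
  shows "complex_of_real l \<in> spectrum h_domain A"
proof -
  define \<kappa> where "\<kappa> = sqrt (l\<^sup>2 - m\<^sup>2)"
  have "m\<^sup>2 \<le> l\<^sup>2"
    using assms mass_pos by (metis abs_le_square_iff abs_of_pos)
  then have "\<kappa> * \<kappa> = (l - m) * (l + m)"
    by (simp add: \<kappa>_def power2_eq_square algebra_simps)
  then have \<kappa>: "complex_of_real \<kappa> * complex_of_real \<kappa> = complex_of_real (l - m) * complex_of_real (l + m)"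
    by (simp only: of_real_mult[symmetric])
  consider "l \<ge> m" | "l \<le> - m"
    using assms by linarith
  then show ?thesis
  proof cases
    case 1
    have nz: "complex_of_real (m + l) \<noteq> 0"
      using 1 mass_pos by (simp only: of_real_eq_0_iff)
    show ?thesis
    proof (rule plane_wave_spectrum)
      show "complex_of_real (m - l) * complex_of_real (m + l)
          = \<i> * complex_of_real \<kappa> * (\<i> * complex_of_real \<kappa>)"
        using \<kappa> by (simp add: algebra_simps)
      show "(complex_of_real (m + l), \<i> * complex_of_real \<kappa>) \<noteq> 0"
        using nz by (simp add: zero_prod_def)
    qed simp
  next
    case 2
    have nz: "complex_of_real (m - l) \<noteq> 0"
      using 2 mass_pos by (simp only: of_real_eq_0_iff)
    show ?thesis
    proof (rule plane_wave_spectrum)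
      show "complex_of_real (m - l) * (\<i> * complex_of_real \<kappa>) = \<i> * complex_of_real \<kappa> * complex_of_real (m - l)"
        by (rule mult.commute)
      show "complex_of_real (m + l) * complex_of_real (m - l)
          = \<i> * complex_of_real \<kappa> * (\<i> * complex_of_real \<kappa>)"
        using \<kappa> by (simp add: algebra_simps)
      show "(\<i> * complex_of_real \<kappa>, complex_of_real (m - l)) \<noteq> 0"
        using nz by (simp add: zero_prod_def)
    qed
  qed
qed

lemma outer_not_isolated:
  assumes "m \<le> \<bar>l\<bar>"
  shows "\<not> complex_of_real l isolated_in spectrum h_domain A"
proof -
  have "complex_of_real l islimpt spectrum h_domain A"
    unfolding islimpt_approachable
  proof (intro allI impI)
    fix e :: real assume "e > 0"
    \<comment> \<open>Moving away from the gap keeps \<open>m \<le> \<bar>b\<bar>\<close>.\<close>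
    define b where "b = (if l \<ge> 0 then l + e / 2 else l - e / 2)"
    have "complex_of_real b \<in> spectrum h_domain A"
      using assms \<open>e > 0\<close> by (intro outer_spectrum) (auto simp: b_def)
    moreover have "complex_of_real b \<noteq> complex_of_real l" "dist (complex_of_real b) (complex_of_real l) < e"
      using \<open>e > 0\<close> by (auto simp: b_def dist_norm norm_mult simp flip: of_real_diff)
    ultimately show "\<exists>z\<in>spectrum h_domain A. z \<noteq> complex_of_real l \<and> dist z (complex_of_real l) < e"
      by blast
  qed
  then show ?thesis
    by (simp add: isolated_in_islimpt_iff)
qed

lemma spectrum_real: "z \<in> spectrum h_domain A \<Longrightarrow> z = complex_of_real (Re z)"
  using nonreal_resolvent[of z] by (auto simp: spectrum_def complex_eq_iff)

text \<open>Isolation alone decides: outer points are never isolated, whether or not they are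
  eigenvalues, and spectral points in the gap satisfy all three conditions by
  \<open>gap_spectrum\<close>.\<close>

lemma discrete_spectrum_eq:
  "discrete_spectrum h_domain A = {z \<in> spectrum h_domain A. \<bar>Re z\<bar> < m}"
proof (intro set_eqI iffI)
  fix z assume z: "z \<in> discrete_spectrum h_domain A"
  then have iso: "z isolated_in spectrum h_domain A"
    by (simp add: discrete_spectrum_def)
  then have "z \<in> spectrum h_domain A"
    by (simp add: isolated_in_def)
  then show "z \<in> {z \<in> spectrum h_domain A. \<bar>Re z\<bar> < m}"
    using outer_not_isolated[of "Re z"] iso spectrum_real[of z] by (metis mem_Collect_eq not_le)
next
  fix z assume "z \<in> {z \<in> spectrum h_domain A. \<bar>Re z\<bar> < m}"
  then show "z \<in> discrete_spectrum h_domain A"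
    using gap_spectrum[of "Re z"] spectrum_real[of z] by simp
qed

lemma essential_spectrum_eq:
  "essential_spectrum h_domain A = complex_of_real ` ({..- m} \<union> {m..})"
proof (intro set_eqI iffI)
  fix z assume "z \<in> essential_spectrum h_domain A"
  then have "z \<in> spectrum h_domain A" "m \<le> \<bar>Re z\<bar>"
    by (auto simp: essential_spectrum_def discrete_spectrum_eq)
  then show "z \<in> complex_of_real ` ({..- m} \<union> {m..})"
    using spectrum_real[of z] by (intro image_eqI[of _ _ "Re z"]) auto
next
  fix z assume "z \<in> complex_of_real ` ({..- m} \<union> {m..})"
  then obtain l where "z = complex_of_real l" "m \<le> \<bar>l\<bar>"
    by auto
  then show "z \<in> essential_spectrum h_domain A"
    using outer_spectrum[of l] by (simp add: essential_spectrum_def discrete_spectrum_eq)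
qed

lemma discrete_spectrum_simple:
  assumes "z \<in> discrete_spectrum h_domain A"
  shows "complex_vector.dim (eigenspace h_domain A z) = 1"
proof -
  have "z = complex_of_real (Re z)" "\<bar>Re z\<bar> < m"
    using assms spectrum_real[of z] by (auto simp: discrete_spectrum_eq)
  moreover have "eigenspace h_domain A z \<noteq> {0}"
    using assms by (simp add: discrete_spectrum_def)
  ultimately show ?thesis
    using dim_eigenspace(2)[of "Re z"] by simp
qed

end

section \<open>The exponential potential\<close>

theorem proposition1:
  fixes m e Q :: real
  assumes "m > 0" and "e > 0" and "Q > 0"
  shows "self_adjoint h_domain (h m e Q) \<and>
    essential_spectrum h_domain (h m e Q) = complex_of_real ` ({..- m} \<union> {m..}) \<and>
    (\<forall>z\<in>discrete_spectrum h_domain (h m e Q).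
       complex_vector.dim (eigenspace h_domain (h m e Q) z) = 1)"
proof -
  \<comment> \<open>The potential to which the general theory is applied; apart from the positive
    mass, its requirements are properties of a scaled \<open>exp (- \<bar>s\<bar>)\<close>.\<close>
  let ?V = "\<lambda>s. e * phi Q s"
  interpret dirac_decaying_potential m ?V
  proof
    show "?V \<in> borel_measurable borel"
      by (intro borel_measurable_times phi_bounded_measurable) simp
    show "bounded (range ?V)"
      using bounded_scaling[OF phi_bounded_measurable(2)[of Q], of e] by (simp add: image_image)
    have "(phi Q \<longlongrightarrow> 0) at_infinity"
    proof -
      have "((\<lambda>s::real. Q / 2 * exp (- norm s)) \<longlongrightarrow> Q / 2 * 0) at_infinity"
        by (intro tendsto_intros filterlim_compose[OF exp_at_bot]
            filterlim_compose[OF filterlim_uminus_at_bot_at_top] filterlim_norm_at_top)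
      then show ?thesis
        by (simp add: phi_def[abs_def])
    qed
    then have "(?V \<longlongrightarrow> 0) at_infinity"
      using tendsto_mult_left[of "phi Q" 0 at_infinity e] by simp
    then have ev: "\<forall>\<^sub>F s in at_infinity. dist (?V s) 0 < \<epsilon>" if "\<epsilon> > 0" for \<epsilon>
      using that by (rule tendstoD)
    show "\<exists>R. \<forall>s. \<bar>s\<bar> > R \<longrightarrow> \<bar>?V s\<bar> \<le> \<epsilon>" if "\<epsilon> > 0" for \<epsilon>
    proof -
      obtain R where "\<And>s. R \<le> \<bar>s\<bar> \<Longrightarrow> \<bar>?V s\<bar> < \<epsilon>"
        using ev[OF \<open>\<epsilon> > 0\<close>] by (auto simp: eventually_at_infinity)
      then show ?thesis
        by (intro exI[of _ R]) (auto intro: less_imp_le)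
    qed
    \<comment> \<open>The potential is a scalar multiple of the exponential with rate
      \<open>1\<close>.\<close>
    have "square_integrable (\<lambda>s. complex_of_real (e * Q / 2) * complex_of_real (exp (- 1 * \<bar>s\<bar>)))"
      by (intro square_integrable_scale square_integrable_exp_neg_abs) simp
    then show "square_integrable (\<lambda>s. complex_of_real (?V s))"
      by (simp add: phi_def mult.assoc)
  qed (fact assms(1))
  have "h m e Q = A"
    by (simp add: h_def A_def dirac_def)
  then show ?thesis
    using self_adjoint essential_spectrum_eq discrete_spectrum_simple by simp
qed

end
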